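(* Let $X=\{a_1<\cdots<a_n\}$ be a finite nonempty set of positive integers. There is a bijection $\zeta:\mathrm{RAT}^+(X)\to \mathrm{AS}(X)$ such that if $\zeta(R)=\tau$, then \begin{align*} \mathrm{diag}(R)&=\mathrm{neg}(\tau), & \mathrm{tile}(R)&=\mathrm{sinv}(\tau), & \mathrm{row}(R)&=\mathrm{wex}(\tau),\\ \mathrm{topup}(R)&=\mathrm{RLmin}^*(\tau), & \mathrm{frow}(R)&=\mathrm{LRmax}^*(\tau), & \mathrm{fcell}(R)&=\mathrm{cro}(\tau). \end{align*} In particular, for $X=[n+1]$ this gives a bijection $\mathrm{RAT}^+(n+1,r+1)\to \mathrm{AS}(n+1,r+1)$ with these properties.
   Context: Rhombic diagrams. For a word $w=w_1\cdots w_m\in\{0,1,2\}^m$, the rhombic diagram $\Gamma_w$ is the region bounded by two lattice paths from a common starting point $P$: the southeast border, obtained by reading $w$ from left to right and taking a unit step south for each $2$, a step southwest (vector $(-1,-1)$) for each $1$, and a step west for each $0$; and the northwest border, consisting of (number of $0$'s) steps west, then (number of $1$'s) steps southwest, then (number of $2$'s) steps south. The region is tiled by unit squares, tall rhombi (two vertical and two diagonal sides) and short rhombi (two horizontal and two diagonal sides) via the maximal tiling: if there is no $i$ with $w_i>w_{i+1}$ there is nothing to tile; otherwise take the smallest $i$ with $w_i>w_{i+1}$, tile the region for the word $w'$ obtained by swapping $w_i,w_{i+1}$, and fill the remaining tile by a tall rhombus, a square, or a short rhombus according as $(w_i,w_{i+1})=(2,1),(2,0),(1,0)$. Each tile $\tau$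 has a north side, south side, east side and west side (for a square the obvious ones; for a short rhombus N and S are its horizontal sides and W,E its diagonal sides; for a tall rhombus N and S are its diagonal sides and W,E its vertical sides). Strips and labels. If the southeast border edges are labeled $x_1<\cdots<x_m$ from northeast to southwest, a strip is a maximal sequence of tiles connected through parallel edges; each southeast border edge starts a strip (possibly with no tiles) ending on the northwest border, and the strip gets that edge's label. Strips starting at vertical edges are rows (squares and tall rhombi), at horizontal edges columns (squares and short rhombi), at diagonal edges diagonal strips (short and tall rhombi). Every tile lies in exactly two strips; for labels $i<j$, the cell $(i,j)$ is the tile in strips $i$ and $j$ (if it exists). RAT. A rhombic alternative tableau (RAT) of shape $w$ is a filling of some tiles of $\Gamma_w$ with up-arrows and left-arrows, where up-arrows lie only in tiles belonging to a column and left-arrows only in tiles belonging to a row; a left-arrow points to all other cells of its row lying between it and the northwest border (to its west), an up-arrow to all other cells of its column between it and the northwest border (to its north); no arrow may lie in a cell pointed to by another arrow. A free cell is an empty cell to which no arrow points; a free row is a row with no left-arrow. $\mathrm{RAT}^+(X)$ is the set of RAT whose southeast border edges are labeled by $a_1,\dots,a_n$ (northeast to southwest), whose first southeast border step is diagonal, and in which every column contains an up-arrow (extended RAT). $\mathrm{RAT}^+(n+1,r+1)$ is $\mathrm{RAT}^+([n+1])$ restricted to $r+1$ diagonal steps. For $R\in\mathrm{RAT}^+(X)$: $\mathrm{diag}(R)$ is the set of labels of diagonal strips; $\mathrm{tile}(R)$ the number of tiles; $\mathrm{row}(R)$ the number of rows; $\mathrm{frow}(R)$ the number of free rows; $\mathrm{fcell}(R)$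 the number of free cells; $\mathrm{topup}(R)$ the number of up-arrows in the diagonal strip labeled $a_1$. Signed permutations. A signed permutation on $X$ is a bijection $\tau$ of $X\cup(-X)$ with $\tau(-i)=-\tau(i)$; write $\mathrm{neg}(\tau)=\{i\in X:\tau(i)<0\}$. $\mathrm{AS}(X)$ is the set of signed permutations $\tau$ on $X$ with $a_1\in\mathrm{neg}(\tau)$ and, writing $\mathrm{neg}(\tau)=\{d_1<\cdots<d_r\}$, $|\tau(d_1)|<\cdots<|\tau(d_r)|$. (These are in natural bijection with assemblées on $X$, i.e. sets of permutations of the blocks of a set partition of $X$: order blocks by increasing first element, concatenate, and negate each block's first element.) $\mathrm{AS}(n+1,r+1)$ is the set of $\tau\in\mathrm{AS}([n+1])$ with $|\mathrm{neg}(\tau)|=r+1$. Statistics. The shape of $\tau$ is $w_1\cdots w_n$ with $w_i=2$ if $\tau(a_i)\ge a_i$, $w_i=1$ if $\tau(a_i)<0$, $w_i=0$ if $0<\tau(a_i)<a_i$; $\mathrm{sinv}(\tau)$ is the number of pairs $i<j$ with $w_i>w_j$; $\mathrm{wex}(\tau)$ is the number of $a_i$ with $\tau(a_i)\ge a_i$. $\tau(a_i)$ is a special LR-maximum if $\tau(a_i)>|\tau(k)|$ for all $k\in\{a_1,\dots,a_{i-1}\}\cup\mathrm{neg}(\tau)$, and a special RL-minimum if $0<\tau(a_i)<|\tau(k)|$ for all $k\in\{a_{i+1},\dots,a_n\}\cup\mathrm{neg}(\tau)$; $\mathrm{LRmax}^*(\tau)$, $\mathrm{RLmin}^*(\tau)$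 count them. Crossings. Define a total order $<_\tau$ on $\mathrm{neg}(\tau)$: $i<_\tau j$ iff $\min(i,|\tau(i)|)<\min(j,|\tau(j)|)$, or $\min(i,|\tau(i)|)=i=|\tau(j)|=\min(j,|\tau(j)|)$. Write $\mathrm{neg}(\tau)=\{e_1<_\tau\cdots<_\tau e_r\}$. The arc diagram has points $-r<\cdots<-1<a_1<\cdots<a_n$ on the real line, and for each $i\in X$: if $\tau(i)\ge i$ an upper arc $(i,\tau(i))$; if $0<\tau(i)<i$ a lower arc $(\tau(i),i)$; if $i=e_j$ a lower arc $(-j,i)$ and an upper arc $(-j,|\tau(i)|)$. An upper crossing is a pair of upper arcs $(a,b),(c,d)$ with $a<c\le b<d$; a lower crossing a pair of lower arcs $(a,b),(c,d)$ with $a<c<b<d$. $\mathrm{cro}(\tau)$ is the total number of crossings. *)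

theory Defs
  imports Main "HOL-Library.Product_Plus"
begin

section \<open>Rhombic diagrams and their maximal tilings\<close>

text \<open>Letters are the natural numbers 0 (west step), 1 (southwest step), 2 (south step); the common
  starting point of the two border paths is taken to be the origin, with x-axis pointing east and
  y-axis pointing north.\<close>

type_synonym point = "int \<times> int"
type_synonym word = "nat list"

definition is_word :: "word \<Rightarrow> bool" where
  "is_word w \<longleftrightarrow> set w \<subseteq> {0, 1, 2}"

definition step :: "nat \<Rightarrow> point" where
  "step c = (if c = 2 then (0, -1) else if c = 1 then (-1, -1) else (-1, 0))"

definition vertex :: "word \<Rightarrow> nat \<Rightarrow> point" where
  "vertex w i = sum_list (map step (take i w))"

text \<open>\<open>Edge p c\<close> is the unit segment from \<open>p\<close> to \<open>p + step c\<close>.\<close>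

datatype edge = Edge point nat

definition border_edge :: "word \<Rightarrow> nat \<Rightarrow> edge" where
  "border_edge w i = Edge (vertex w i) (w ! i)"

text \<open>\<open>Tile p a b\<close> with \<open>a > b\<close> is the parallelogram with vertices \<open>p\<close>, \<open>p + step a\<close>,
  \<open>p + step b\<close> and \<open>p + step a + step b\<close>: a tall rhombus, a unit square or a short rhombus
  according as \<open>(a, b)\<close> is \<open>(2, 1)\<close>, \<open>(2, 0)\<close> or \<open>(1, 0)\<close>. In each of the three cases the
  functions below give the sides named in the usual way: for a square the obvious ones, for a
  short rhombus N and S are horizontal and W and E diagonal, for a tall rhombus N and S are
  diagonal and W and E vertical.\<close>

datatype tile = Tile point nat nat

fun east :: "tile \<Rightarrow> edge" where
  "east (Tile p a b) = Edge p a"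

fun south :: "tile \<Rightarrow> edge" where
  "south (Tile p a b) = Edge (p + step a) b"

fun north :: "tile \<Rightarrow> edge" where
  "north (Tile p a b) = Edge p b"

fun west :: "tile \<Rightarrow> edge" where
  "west (Tile p a b) = Edge (p + step b) a"

definition descent :: "word \<Rightarrow> nat \<Rightarrow> bool" where
  "descent w i \<longleftrightarrow> Suc i < length w \<and> w ! i > w ! Suc i"

definition first_descent :: "word \<Rightarrow> nat" where
  "first_descent w = (LEAST i. descent w i)"

definition swap_at :: "nat \<Rightarrow> word \<Rightarrow> word" where
  "swap_at i w = w[i := w ! Suc i, Suc i := w ! i]"

lemma swap_at_lex:
  assumes "descent w i"
  shows "(swap_at i w, w) \<in> lex less_than"
proof -
  have l: "Suc i < length w" and d: "w ! Suc i < w ! i"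
    using assms by (auto simp: descent_def)
  define u a b v where "u = take i w" and "a = w ! i" and "b = w ! Suc i"
    and "v = drop (Suc (Suc i)) w"
  have w: "w = u @ a # b # v"
    using l unfolding u_def a_def b_def v_def
    by (metis Cons_nth_drop_Suc Suc_lessD append_take_drop_id)
  have i: "length u = i"
    using l by (simp add: u_def)
  have s: "swap_at i w = u @ b # a # v"
    unfolding swap_at_def a_def[symmetric] b_def[symmetric]
    by (simp add: w i[symmetric] list_update_append)
  have "(b # a # v, a # b # v) \<in> lex less_than"
    using d by (simp add: a_def b_def)
  then show ?thesis
    using s w by (metis lex_append_leftI)
qed

function maximal_tiling :: "word \<Rightarrow> tile set" where
  "maximal_tiling w =
     (if \<exists>i. descent w i then
        insert (Tile (vertex w (first_descent w)) (w ! first_descent w) (w ! Suc (first_descent w)))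
          (maximal_tiling (swap_at (first_descent w) w))
      else {})"
  by auto
termination
proof (relation "lex less_than")
  show "wf (lex less_than)" by (simp add: wf_lex)
next
  fix w assume "\<exists>i. descent w i"
  then have "descent w (first_descent w)"
    unfolding first_descent_def by (rule LeastI_ex)
  then show "(swap_at (first_descent w) w, w) \<in> lex less_than" by (rule swap_at_lex)
qed

declare maximal_tiling.simps [simp del]

section \<open>Strips\<close>

text \<open>\<open>crosses T\<close> relates an east (south) side of a tile of \<open>T\<close> to the parallel west (north) side
  of the same tile. The tiles met when travelling in this way from an edge \<open>e\<close> towards the
  northwest border form \<open>onward T e\<close>; starting at a southeast border edge one obtains a strip.\<close>

definition crosses :: "tile set \<Rightarrow> (edge \<times> edge) set" where
  "crosses T = (\<lambda>t. (east t, west t)) ` T \<union> (\<lambda>t. (south t, north t)) ` T"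

definition onward :: "tile set \<Rightarrow> edge \<Rightarrow> tile set" where
  "onward T e = {t \<in> T. (e, east t) \<in> (crosses T)\<^sup>* \<or> (e, south t) \<in> (crosses T)\<^sup>*}"

definition strip :: "word \<Rightarrow> nat \<Rightarrow> tile set" where
  "strip w i = onward (maximal_tiling w) (border_edge w i)"

section \<open>Rhombic alternative tableaux\<close>

datatype arrow = Up_Arrow | Left_Arrow

text \<open>The entry of \<open>labels\<close> at position \<open>i\<close> is the label of the \<open>i\<close>-th southeast border edge and of
  the strip starting there.\<close>

record tableau =
  shape :: word
  labels :: "int list"
  filling :: "tile \<Rightarrow> arrow option"

definition tiles :: "tableau \<Rightarrow> tile set" where
  "tiles R = maximal_tiling (shape R)"

definition pointed :: "tableau \<Rightarrow> tile set" where
  "pointed R =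
     (\<Union>t\<in>{t \<in> tiles R. filling R t = Some Left_Arrow}. onward (tiles R) (west t)) \<union>
     (\<Union>t\<in>{t \<in> tiles R. filling R t = Some Up_Arrow}. onward (tiles R) (north t))"

definition is_RAT :: "tableau \<Rightarrow> bool" where
  "is_RAT R \<longleftrightarrow>
     is_word (shape R) \<and>
     length (labels R) = length (shape R) \<and> sorted_wrt (<) (labels R) \<and>
     dom (filling R) \<subseteq> tiles R \<and>
     (\<forall>t. filling R t = Some Up_Arrow \<longrightarrow>
        (\<exists>i<length (shape R). shape R ! i = 0 \<and> t \<in> strip (shape R) i)) \<and>
     (\<forall>t. filling R t = Some Left_Arrow \<longrightarrow>
        (\<exists>i<length (shape R). shape R ! i = 2 \<and> t \<in> strip (shape R) i)) \<and>
     (\<forall>t\<in>pointed R. filling R t = None)"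

definition RAT_ext :: "int set \<Rightarrow> tableau set" where
  "RAT_ext X = {R. is_RAT R \<and> labels R = sorted_list_of_set X \<and>
     shape R \<noteq> [] \<and> hd (shape R) = 1 \<and>
     (\<forall>i<length (shape R). shape R ! i = 0 \<longrightarrow>
        (\<exists>t\<in>strip (shape R) i. filling R t = Some Up_Arrow))}"

definition RAT_ext_nat :: "nat \<Rightarrow> nat \<Rightarrow> tableau set" where
  "RAT_ext_nat m k = {R \<in> RAT_ext {1..int m}. count_list (shape R) 1 = k}"

definition diag :: "tableau \<Rightarrow> int set" where
  "diag R = {labels R ! i | i. i < length (shape R) \<and> shape R ! i = 1}"

definition tile_number :: "tableau \<Rightarrow> nat" where
  "tile_number R = card (tiles R)"

definition row_number :: "tableau \<Rightarrow> nat" where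
  "row_number R = card {i. i < length (shape R) \<and> shape R ! i = 2}"

definition frow :: "tableau \<Rightarrow> nat" where
  "frow R = card {i. i < length (shape R) \<and> shape R ! i = 2 \<and>
     (\<forall>t\<in>strip (shape R) i. filling R t \<noteq> Some Left_Arrow)}"

definition fcell :: "tableau \<Rightarrow> nat" where
  "fcell R = card {t \<in> tiles R. filling R t = None \<and> t \<notin> pointed R}"

text \<open>The smallest label belongs to position 0; for extended tableaux this strip is diagonal.\<close>

definition topup :: "tableau \<Rightarrow> nat" where
  "topup R = card {t \<in> strip (shape R) 0. filling R t = Some Up_Arrow}"

section \<open>Signed permutations of assemblee type\<close>

text \<open>Signed permutations are extended by the identity outside \<open>X \<union> - X\<close>, so that they are
  determined by their values on \<open>X \<union> - X\<close>.\<close>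

definition signed_perm :: "int set \<Rightarrow> (int \<Rightarrow> int) \<Rightarrow> bool" where
  "signed_perm X \<tau> \<longleftrightarrow>
     bij_betw \<tau> (X \<union> uminus ` X) (X \<union> uminus ` X) \<and>
     (\<forall>i\<in>X \<union> uminus ` X. \<tau> (- i) = - \<tau> i) \<and>
     (\<forall>i. i \<notin> X \<union> uminus ` X \<longrightarrow> \<tau> i = i)"

definition neg :: "int set \<Rightarrow> (int \<Rightarrow> int) \<Rightarrow> int set" where
  "neg X \<tau> = {i \<in> X. \<tau> i < 0}"

definition AS :: "int set \<Rightarrow> (int \<Rightarrow> int) set" where
  "AS X = {\<tau>. signed_perm X \<tau> \<and> Min X \<in> neg X \<tau> \<and>
     strict_mono_on (neg X \<tau>) (\<lambda>i. \<bar>\<tau> i\<bar>)}"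

definition AS_nat :: "nat \<Rightarrow> nat \<Rightarrow> (int \<Rightarrow> int) set" where
  "AS_nat m k = {\<tau> \<in> AS {1..int m}. card (neg {1..int m} \<tau>) = k}"

definition perm_shape :: "int set \<Rightarrow> (int \<Rightarrow> int) \<Rightarrow> word" where
  "perm_shape X \<tau> =
     map (\<lambda>a. if \<tau> a \<ge> a then 2 else if \<tau> a < 0 then 1 else 0) (sorted_list_of_set X)"

definition sinv :: "int set \<Rightarrow> (int \<Rightarrow> int) \<Rightarrow> nat" where
  "sinv X \<tau> = card {(i, j). i < j \<and> j < length (perm_shape X \<tau>) \<and>
     perm_shape X \<tau> ! i > perm_shape X \<tau> ! j}"

definition wex :: "int set \<Rightarrow> (int \<Rightarrow> int) \<Rightarrow> nat" where
  "wex X \<tau> = card {a \<in> X. \<tau> a \<ge> a}"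

definition LRmax :: "int set \<Rightarrow> (int \<Rightarrow> int) \<Rightarrow> nat" where
  "LRmax X \<tau> = card {a \<in> X. \<forall>k\<in>{b \<in> X. b < a} \<union> neg X \<tau>. \<tau> a > \<bar>\<tau> k\<bar>}"

definition RLmin :: "int set \<Rightarrow> (int \<Rightarrow> int) \<Rightarrow> nat" where
  "RLmin X \<tau> = card {a \<in> X. 0 < \<tau> a \<and> (\<forall>k\<in>{b \<in> X. a < b} \<union> neg X \<tau>. \<tau> a < \<bar>\<tau> k\<bar>)}"

subsection \<open>Crossings\<close>

text \<open>The strict order on \<open>neg X \<tau>\<close>. The condition \<open>i \<noteq> j\<close> is needed for irreflexivity: without it
  the second alternative would hold for \<open>i = j\<close> whenever \<open>\<bar>\<tau> i\<bar> = i\<close>.\<close>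

definition neg_less :: "(int \<Rightarrow> int) \<Rightarrow> int \<Rightarrow> int \<Rightarrow> bool" where
  "neg_less \<tau> i j \<longleftrightarrow> i \<noteq> j \<and>
     (min i \<bar>\<tau> i\<bar> < min j \<bar>\<tau> j\<bar> \<or>
      min i \<bar>\<tau> i\<bar> = i \<and> i = \<bar>\<tau> j\<bar> \<and> \<bar>\<tau> j\<bar> = min j \<bar>\<tau> j\<bar>)"

text \<open>The index \<open>j\<close> with \<open>i = e\<^sub>j\<close> in the increasing enumeration \<open>e\<^sub>1, \<dots>, e\<^sub>r\<close> of
  \<open>neg X \<tau>\<close> with respect to this order.\<close>

definition neg_index :: "int set \<Rightarrow> (int \<Rightarrow> int) \<Rightarrow> int \<Rightarrow> nat" where
  "neg_index X \<tau> i = Suc (card {k \<in> neg X \<tau>. neg_less \<tau> k i})"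

definition upper_arcs :: "int set \<Rightarrow> (int \<Rightarrow> int) \<Rightarrow> (int \<times> int) set" where
  "upper_arcs X \<tau> = {(i, \<tau> i) | i. i \<in> X \<and> \<tau> i \<ge> i} \<union>
     {(- int (neg_index X \<tau> i), \<bar>\<tau> i\<bar>) | i. i \<in> neg X \<tau>}"

definition lower_arcs :: "int set \<Rightarrow> (int \<Rightarrow> int) \<Rightarrow> (int \<times> int) set" where
  "lower_arcs X \<tau> = {(\<tau> i, i) | i. i \<in> X \<and> 0 < \<tau> i \<and> \<tau> i < i} \<union>
     {(- int (neg_index X \<tau> i), i) | i. i \<in> neg X \<tau>}"

definition cro :: "int set \<Rightarrow> (int \<Rightarrow> int) \<Rightarrow> nat" where
  "cro X \<tau> =
     card {((a, b), (c, d)) | a b c d.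
       (a, b) \<in> upper_arcs X \<tau> \<and> (c, d) \<in> upper_arcs X \<tau> \<and> a < c \<and> c \<le> b \<and> b < d} +
     card {((a, b), (c, d)) | a b c d.
       (a, b) \<in> lower_arcs X \<tau> \<and> (c, d) \<in> lower_arcs X \<tau> \<and> a < c \<and> c < b \<and> b < d}"

end

theory Submission
  imports Defs "HOL-Computational_Algebra.Polynomial" "HOL-Library.FuncSet"
begin

text \<open>
  It suffices to show, for every shape \<open>w\<close>, that the generating polynomials of the two families of
  objects of shape \<open>w\<close> agree, where \<open>q\<close> marks free cells and crossings, \<open>y\<close> marks top up-arrows and
  special RL-minima, and \<open>z\<close> marks free rows and special LR-maxima; the three remaining statistics
  depend on the shape only. Since in the maximal tiling the cells are the inversions of \<open>w\<close>, a tableau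
  can be built by appending columns, and the number of ways depends only on the number of free rows. A
  signed permutation is an arc diagram read from left to right, and the number of ways depends only on
  the numbers of open arcs. In both cases the letters 2, 1, 0 act as operators \<open>D\<close>, \<open>A\<close>, \<open>E\<close> with
  \<open>DE = qED + D + E\<close>, \<open>DA = qAD + A\<close>, \<open>AE = qEA + A\<close>, and these relations determine the generating
  polynomials by induction on the word.
\<close>

section \<open>The matrix ansatz\<close>

text \<open>No map is written down: the joint distributions of the statistics are shown equal shape
  by shape, and \<open>\<zeta>\<close> is glued from arbitrary bijections between fibres of equal
  size. The obstacle is the weight of a record. On the tableau side AE = qEA + A requires a diagonal
  strip to be present already. On the arc side the state \<open>n = r\<close>, \<open>l = 0\<close>
  must be kept away, which holds as long as a further negative arc exists. The mandatory first
  diagonal step supplies both. A column directly after this step is the boundary case, and there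
  both sides simply gain a factor \<open>y\<close>; the sorted words without 0 give a power of
  \<open>z\<close>. Arc states are moreover restricted to the reachable ones, which satisfy a
  balance between open arcs and letters still to come. Negative arcs offer no choice of partner:
  absolute values increase along them, so their end points determine them, and they contribute only
  powers of \<open>q\<close>.\<close>

locale weights =
  fixes q y z :: "'a::comm_ring_1"
begin

text \<open>The \<open>q\<close>-analogue of \<open>k\<close> whose leading term \<open>q\<^sup>k\<^sup>-\<^sup>1\<close> carries the weight \<open>t\<close> of a record.\<close>

definition bracket :: "'a \<Rightarrow> int \<Rightarrow> 'a" where
  "bracket t k = (if k \<le> 0 then 0 else (\<Sum>j<nat k - 1. q ^ j) + q ^ (nat k - 1) * t)"

lemma bracket_nonpos [simp]: "k \<le> 0 \<Longrightarrow> bracket t k = 0"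
  by (simp add: bracket_def)

lemma bracket_1 [simp]: "bracket t 1 = t"
  by (simp add: bracket_def)

text \<open>Among nonnegative \<open>k\<close> the recursion breaks only at \<open>k = 0\<close>,
  where it would read \<open>t = 1\<close>. This exception is the source of the side conditions in
  the relations below.\<close>

lemma bracket_succ:
  assumes "1 \<le> k \<or> 0 \<le> k \<and> t = 1"
  shows "bracket t (k + 1) = q * bracket t k + 1"
proof (cases "k = 0")
  case True
  then show ?thesis using assms by (simp add: bracket_def)
next
  case False
  define m where "m = nat (k - 1)"
  have m: "k = int (Suc m)"
    using False assms unfolding m_def by auto
  have "(\<Sum>j<Suc m. q ^ j) = q * (\<Sum>j<m. q ^ j) + 1"
    by (subst sum.lessThan_Suc_shift) (simp add: sum_distrib_left)
  then show ?thesis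
    by (simp add: bracket_def m nat_add_distrib algebra_simps)
qed

text \<open>Appending a diagonal strip to \<open>k\<close> live rows: each row either has a free
  cell there, weight \<open>q\<close>, and stays live, or receives a left-arrow and dies. The
  recursion decides one row; unfolded, it is the sum of binomial(k, j) * q^j * V j over j.\<close>

fun diag_op :: "(nat \<Rightarrow> 'a) \<Rightarrow> nat \<Rightarrow> 'a" where
  "diag_op V 0 = V 0"
| "diag_op V (Suc k) = q * diag_op (\<lambda>j. V (Suc j)) k + diag_op V k"

text \<open>Appending a column. The southernmost live row holds the up-arrow, and then the rows
  north of it are pointed to but stay live; or its cell is free, weight \<open>q\<close>; or it
  holds a left-arrow. Once the rows are exhausted the up-arrow lies in a diagonal strip, with total
  weight \<open>c\<close>.\<close>

fun col_op :: "'a \<Rightarrow> (nat \<Rightarrow> 'a) \<Rightarrow> nat \<Rightarrow> 'a" where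
  "col_op c V 0 = c * V 0"
| "col_op c V (Suc k) = V (Suc k) + q * col_op c (\<lambda>j. V (Suc j)) k + col_op c V k"

lemma diag_op_add: "diag_op (\<lambda>k. V k + W k) k = diag_op V k + diag_op W k"
  by (induction k arbitrary: V W) (simp_all add: algebra_simps)

lemma diag_op_scale: "diag_op (\<lambda>k. a * V k) k = a * diag_op V k"
  by (induction k arbitrary: V) (simp_all add: algebra_simps)

lemma col_op_add: "col_op c (\<lambda>k. V k + W k) k = col_op c V k + col_op c W k"
  by (induction k arbitrary: V W) (simp_all add: algebra_simps)

lemma col_op_scale: "col_op c (\<lambda>k. a * V k) k = a * col_op c V k"
  by (induction k arbitrary: V) (simp_all add: algebra_simps)

text \<open>This is AE = qEA + A for operators: \<open>d\<close> and \<open>c\<close> will be the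
  brackets with and without the new diagonal strip.\<close>

lemma diag_op_col_op:
  assumes "d = q * c + 1"
  shows "diag_op (col_op d V) k = q * col_op c (diag_op V) k + diag_op V k"
proof (induction k arbitrary: V)
  case 0
  then show ?case by (simp add: assms algebra_simps)
next
  case (Suc k)
  show ?case
    by (simp add: diag_op_add diag_op_scale col_op_add col_op_scale Suc.IH algebra_simps)
qed

text \<open>The total weight of all ways of adding the letters of \<open>w\<close>, one column of the tableau at a time,
  to a tableau with \<open>b\<close> diagonal strips and \<open>k\<close> rows without left-arrow.\<close>

fun live_value :: "nat \<Rightarrow> nat list \<Rightarrow> nat \<Rightarrow> 'a" where
  "live_value b [] k = z ^ k"
| "live_value b (c # w) k =
     (if c = 2 then live_value b w (Suc k)
      else if c = 1 then diag_op (live_value (Suc b) w) k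
      else col_op (bracket y (int b)) (live_value b w) k)"

lemma live_value_fun:
  "live_value b (2 # w) = (\<lambda>k. live_value b w (Suc k))"
  "live_value b (Suc 0 # w) = diag_op (live_value (Suc b) w)"
  "live_value b (0 # w) = col_op (bracket y (int b)) (live_value b w)"
  by (rule ext, simp)+

text \<open>Letters act linearly on the values of the suffix, so a relation between suffixes
  survives a common prefix. The prefix raises \<open>b\<close> by its number of 1's, which is where
  the hypothesis is posed. Three terms on the right cover all relations.\<close>

lemma live_value_append_linear:
  assumes "\<And>k. live_value (b + count_list u 1) v1 k =
      q * live_value (b + count_list u 1) v2 k + s * live_value (b + count_list u 1) v3 k
      + t * live_value (b + count_list u 1) v4 k"
  shows "live_value b (u @ v1) k =
      q * live_value b (u @ v2) k + s * live_value b (u @ v3) k + t * live_value b (u @ v4) k"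
  using assms
proof (induction u arbitrary: b k)
  case Nil
  then show ?case by simp
next
  case (Cons c u)
  show ?case
  proof (cases "c = 1")
    case True
    have "live_value (Suc b) (u @ v1) = (\<lambda>k. q * live_value (Suc b) (u @ v2) k
        + s * live_value (Suc b) (u @ v3) k + t * live_value (Suc b) (u @ v4) k)"
      using Cons True by (intro ext Cons.IH) simp
    then show ?thesis
      using True by (simp add: diag_op_add diag_op_scale)
  next
    case False
    have "live_value b (u @ v1) = (\<lambda>k. q * live_value b (u @ v2) k
        + s * live_value b (u @ v3) k + t * live_value b (u @ v4) k)"
      using Cons False by (intro ext Cons.IH) simp
    then show ?thesis
      using False by (simp add: col_op_add col_op_scale)
  qed
qed

text \<open>The recursion of \<open>col_op\<close>, read as DE = qED + D + E.\<close>

lemma live_value_20: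
  "live_value b (u @ 2 # 0 # v) k = q * live_value b (u @ 0 # 2 # v) k
     + live_value b (u @ 2 # v) k + live_value b (u @ 0 # v) k"
proof -
  have "live_value b (u @ 2 # 0 # v) k = q * live_value b (u @ 0 # 2 # v) k
     + 1 * live_value b (u @ 2 # v) k + 1 * live_value b (u @ 0 # v) k"
    by (rule live_value_append_linear) (simp add: live_value_fun)
  then show ?thesis by simp
qed

lemma live_value_21:
  "live_value b (u @ 2 # 1 # v) k = q * live_value b (u @ 1 # 2 # v) k + live_value b (u @ 1 # v) k"
proof -
  have "live_value b (u @ 2 # 1 # v) k = q * live_value b (u @ 1 # 2 # v) k
     + 1 * live_value b (u @ 1 # v) k + 0 * live_value b (u @ []) k"
    by (rule live_value_append_linear) (simp add: live_value_fun)
  then show ?thesis by simp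
qed

text \<open>The values \<open>bracket y 0 = 0\<close> and \<open>bracket y 1 = y\<close> violate
  \<open>bracket_succ\<close>, so one diagonal strip has to precede.\<close>

lemma live_value_10:
  assumes "b \<ge> 1"
  shows "live_value b (u @ 1 # 0 # v) k = q * live_value b (u @ 0 # 1 # v) k + live_value b (u @ 1 # v) k"
proof -
  have "bracket y (int (b + count_list u 1) + 1) = q * bracket y (int (b + count_list u 1)) + 1"
    using assms by (intro bracket_succ) auto
  then have "live_value b (u @ 1 # 0 # v) k = q * live_value b (u @ 0 # 1 # v) k
     + 1 * live_value b (u @ 1 # v) k + 0 * live_value b (u @ []) k"
    by (intro live_value_append_linear) (simp add: live_value_fun diag_op_col_op add.commute[of 1])
  then show ?thesis by simp
qed

text \<open>Arc diagrams are read from left to right; \<open>p\<close> and \<open>n\<close> count the open upper arcs that start at a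
  positive, respectively negative, point, and \<open>l\<close> the open lower arcs that start at a positive point.
  \<open>arc_op\<close> sums over the arc ending or starting at the current point in its role as a value: an
  upper arc is closed, or a lower arc is opened. The factor \<open>z\<close> marks closing the outermost upper arc after all
  negative ones, and \<open>y\<close> marks the outermost lower arc opened before the first negative upper arc
  closes. The letter of the word decides the role of the point as an argument.\<close>

definition arc_op :: "int \<Rightarrow> (int \<Rightarrow> int \<Rightarrow> int \<Rightarrow> 'a) \<Rightarrow> int \<Rightarrow> int \<Rightarrow> int \<Rightarrow> 'a" where
  "arc_op r f p n l =
     bracket (if n = 0 then z else 1) p * f (p - 1) n l + q ^ nat p * f p (n - 1) l
     + bracket (if n = r then y else 1) (l + 1) * f p n (l + 1)"

fun arc_value :: "int \<Rightarrow> nat list \<Rightarrow> int \<Rightarrow> int \<Rightarrow> int \<Rightarrow> 'a" where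
  "arc_value r [] p n l = (if p = 0 \<and> n = 0 \<and> l = 0 then 1 else 0)"
| "arc_value r (c # w) p n l =
     (if c = 2 then arc_op r (arc_value r w) (p + 1) n l
      else if c = 1 then q ^ nat l * arc_op r (arc_value r w) p n l
      else arc_op r (arc_value r w) p n (l - 1))"

text \<open>The factor \<open>bracket _ (l + 1)\<close> vanishes for \<open>l + 1 \<le> 0\<close>,
  so a negative \<open>l\<close> cannot climb back to 0, and \<open>n\<close> never grows.\<close>

lemma arc_value_neg: "n < 0 \<or> l < 0 \<Longrightarrow> arc_value r w p n l = 0"
proof (induction w arbitrary: p n l)
  case (Cons c w)
  have 1: "arc_op r (arc_value r w) p' n l = 0" for p'
    using Cons.prems by (cases "n < 0") (auto simp: arc_op_def Cons.IH)
  have 2: "arc_op r (arc_value r w) p' n (l - 1) = 0" for p'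
    using Cons.prems by (cases "n < 0") (auto simp: arc_op_def Cons.IH)
  show ?case by (simp add: 1 2)
qed auto

lemma arc_op_neg: "n < 0 \<or> l < 0 \<Longrightarrow> arc_op r (arc_value r w) p n l = 0"
  by (cases "n < 0") (auto simp: arc_op_def arc_value_neg)

text \<open>Only the letter 0 closes the lower arcs counted by \<open>l\<close>, one each, so a
  surplus of them stays open.\<close>

lemma arc_value_no_closers: "l > int (count_list w 0) \<Longrightarrow> set w \<subseteq> {0,1,2} \<Longrightarrow> arc_value r w p n l = 0"
proof (induction w arbitrary: p n l)
  case (Cons c w)
  have "l > int (count_list w 0)" "c = 0 \<Longrightarrow> l - 1 > int (count_list w 0)"
    using Cons.prems by (auto split: if_splits)
  then have "arc_op r (arc_value r w) p' n l = 0" "c = 0 \<Longrightarrow> arc_op r (arc_value r w) p' n (l - 1) = 0" for p'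
    using Cons by (auto simp: arc_op_def)
  then show ?case using Cons.prems(2) by auto
qed auto

text \<open>As for \<open>live_value\<close>, but restricted to reachable states. The balance
  \<open>p + n = l + number of remaining 1's\<close> comes from counting the remaining points once
  as arguments and once as values; every letter preserves it.\<close>

lemma arc_value_append_linear:
  assumes base: "\<And>p n l. 0 \<le> p \<Longrightarrow> 0 \<le> n \<Longrightarrow> 0 \<le> l \<Longrightarrow> n \<le> r \<Longrightarrow>
      p + n = l + int (count_list v1 1) \<Longrightarrow>
      arc_value r v1 p n l = q * arc_value r v2 p n l + s * arc_value r v3 p n l
        + t * arc_value r v4 p n l"
    and "0 \<le> p" "n \<le> r" "p + n = l + int (count_list (u @ v1) 1)"
  shows "arc_value r (u @ v1) p n l = q * arc_value r (u @ v2) p n l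
      + s * arc_value r (u @ v3) p n l + t * arc_value r (u @ v4) p n l"
  using assms(2-)
proof (induction u arbitrary: p n l)
  case Nil
  then show ?case
  proof (cases "n < 0 \<or> l < 0")
    case True
    then show ?thesis by (simp add: arc_value_neg)
  next
    case False
    then show ?thesis using Nil base by simp
  qed
next
  case (Cons c u)
  \<comment> \<open>Between the argument role and the value role of a point the balance is off by
    one, whichever the letter.\<close>
  have step: "arc_op r (arc_value r (u @ v1)) p' n l' =
      q * arc_op r (arc_value r (u @ v2)) p' n l' + s * arc_op r (arc_value r (u @ v3)) p' n l'
      + t * arc_op r (arc_value r (u @ v4)) p' n l'"
    if "0 \<le> p'" "p' + n = l' + 1 + int (count_list (u @ v1) 1)" for p' l'
  proof -
    \<comment> \<open>At \<open>p' = 0\<close> the state \<open>p' - 1\<close> is outside the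
      induction hypothesis, but the bracket annihilates both sides.\<close>
    have a: "bracket x p' * arc_value r (u @ v1) (p' - 1) n l' = bracket x p' *
       (q * arc_value r (u @ v2) (p' - 1) n l'
      + s * arc_value r (u @ v3) (p' - 1) n l' + t * arc_value r (u @ v4) (p' - 1) n l')" for x
      using that Cons.prems by (cases "p' = 0") (simp, subst Cons.IH, auto)
    have b: "arc_value r (u @ v1) p' (n - 1) l' = 
       (q * arc_value r (u @ v2) p' (n - 1) l'
      + s * arc_value r (u @ v3) p' (n - 1) l' + t * arc_value r (u @ v4) p' (n - 1) l')"
      using that Cons.prems by (subst Cons.IH) auto
    have c: "arc_value r (u @ v1) p' n (l' + 1) = 
       (q * arc_value r (u @ v2) p' n (l' + 1)
      + s * arc_value r (u @ v3) p' n (l' + 1) + t * arc_value r (u @ v4) p' n (l' + 1))"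
      using that Cons.prems by (subst Cons.IH) auto
    show ?thesis
      unfolding arc_op_def a b c by (simp add: algebra_simps)
  qed
  show ?case
    using Cons.prems step[of "p + 1" l] step[of p l] step[of p "l - 1"] by (auto simp: algebra_simps)
qed

text \<open>Both brackets have to satisfy \<open>bracket_succ\<close>. If \<open>n = 0\<close> and
  \<open>p = 0\<close>, the balance forces \<open>l = 0\<close>, and the factor with
  \<open>l - 1\<close> vanishes. For the weight \<open>y\<close>, the bad state
  \<open>n = r\<close>, \<open>l = 0\<close> would force at least \<open>r\<close> letters 1 in
  \<open>v\<close>, which the last assumption excludes.\<close>

lemma arc_value_20:
  assumes "0 \<le> p" "n \<le> r" "p + n = l + int (count_list (u @ 2 # 0 # v) 1)"
    and r: "int (count_list v 1) < r"
  shows "arc_value r (u @ 2 # 0 # v) p n l = q * arc_value r (u @ 0 # 2 # v) p n l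
     + arc_value r (u @ 2 # v) p n l + arc_value r (u @ 0 # v) p n l"
proof -
  have "arc_value r (u @ 2 # 0 # v) p n l = q * arc_value r (u @ 0 # 2 # v) p n l
     + 1 * arc_value r (u @ 2 # v) p n l + 1 * arc_value r (u @ 0 # v) p n l"
  proof (rule arc_value_append_linear[OF _ assms(1-3)], goal_cases)
    case (1 p n l)
    define Y where "Y = arc_op r (arc_value r v)"
    have h: "p + n = l + int (count_list v 1)" using 1 by simp
    have c: "bracket (if n = 0 then z else 1) (p + 1) * Y p n (l - 1) =
        (q * bracket (if n = 0 then z else 1) p + 1) * Y p n (l - 1)"
    proof (cases "n = 0 \<and> p = 0")
      case True
      then have "l = 0" using h 1 by auto
      then show ?thesis by (simp add: Y_def arc_op_neg)
    next
      case False
      then show ?thesis using 1 by (subst bracket_succ) auto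
    qed
    have o: "bracket (if n = r then y else 1) (l + 1) = q * bracket (if n = r then y else 1) l + 1"
      using h r 1 by (intro bracket_succ) auto
    have p: "nat (p + 1) = Suc (nat p)" using 1 by auto
    have "arc_value r (2 # 0 # v) p n l =
        bracket (if n = 0 then z else 1) (p + 1) * Y p n (l - 1) + q ^ nat (p + 1) * Y (p + 1) (n - 1) (l - 1)
        + bracket (if n = r then y else 1) (l + 1) * Y (p + 1) n l"
      by (simp add: arc_op_def[of r "arc_value r (0 # v)"] Y_def)
    also have "\<dots> = q * (bracket (if n = 0 then z else 1) p * Y p n (l - 1) + q ^ nat p * Y (p + 1) (n - 1) (l - 1)
        + bracket (if n = r then y else 1) l * Y (p + 1) n l) + 1 * Y (p + 1) n l + 1 * Y p n (l - 1)"
      unfolding c o p by (simp add: algebra_simps)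
    also have "\<dots> = q * arc_value r (0 # 2 # v) p n l + 1 * arc_value r (2 # v) p n l + 1 * arc_value r (0 # v) p n l"
      by (simp add: arc_op_def[of r "arc_value r (2 # v)"] Y_def)
    finally show ?case .
  qed
  then show ?thesis by simp
qed

text \<open>A preceding 2 multiplies each term of \<open>arc_op\<close> by \<open>q\<close>, and the
  term closing a positive arc gains an additional summand, which yields the word without the 2. If
  \<open>n = 0\<close>, the pending 1 and the balance give \<open>p \<ge> 1\<close>, so the bracket
  recursion applies.\<close>

lemma arc_value_21:
  assumes "0 \<le> p" "n \<le> r" "p + n = l + int (count_list (u @ 2 # 1 # v) 1)"
  shows "arc_value r (u @ 2 # 1 # v) p n l = q * arc_value r (u @ 1 # 2 # v) p n l + arc_value r (u @ 1 # v) p n l"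
proof -
  have "arc_value r (u @ 2 # 1 # v) p n l = q * arc_value r (u @ 1 # 2 # v) p n l
     + 1 * arc_value r (u @ 1 # v) p n l + 0 * arc_value r (u @ []) p n l"
  proof (rule arc_value_append_linear[OF _ assms], goal_cases)
    case (1 p n l)
    define Y where "Y = arc_op r (arc_value r v)"
    have c: "bracket (if n = 0 then z else 1) (p + 1) =
        q * bracket (if n = 0 then z else 1) p + 1"
      using 1 by (subst bracket_succ) auto
    have p: "nat (p + 1) = Suc (nat p)" "nat (l + 1) = Suc (nat l)" using 1 by auto
    have "arc_value r (2 # 1 # v) p n l =
        bracket (if n = 0 then z else 1) (p + 1) * (q ^ nat l * Y p n l) + q ^ nat (p + 1) * (q ^ nat l * Y (p + 1) (n - 1) l)
        + bracket (if n = r then y else 1) (l + 1) * (q ^ nat (l + 1) * Y (p + 1) n (l + 1))"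
      by (simp add: arc_op_def[of r "arc_value r (Suc 0 # v)"] Y_def)
    also have "\<dots> = q * (q ^ nat l * (bracket (if n = 0 then z else 1) p * Y p n l + q ^ nat p * Y (p + 1) (n - 1) l
        + bracket (if n = r then y else 1) (l + 1) * Y (p + 1) n (l + 1))) + 1 * (q ^ nat l * Y p n l) + 0 * arc_value r [] p n l"
      unfolding c p by (simp add: algebra_simps)
    also have "\<dots> = q * arc_value r (1 # 2 # v) p n l + 1 * arc_value r (1 # v) p n l + 0 * arc_value r [] p n l"
      by (simp add: arc_op_def[of r "arc_value r (2 # v)"] Y_def)
    finally show ?case .
  qed
  then show ?thesis by simp
qed

text \<open>The last assumption says that besides the displayed 1 and those in \<open>v\<close>
  there is another negative arc; then the balance excludes \<open>n = r\<close> with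
  \<open>l = 0\<close>.\<close>

lemma arc_value_10:
  assumes "0 \<le> p" "n \<le> r" "p + n = l + int (count_list (u @ 1 # 0 # v) 1)"
    and r: "int (count_list v 1) + 1 < r"
  shows "arc_value r (u @ 1 # 0 # v) p n l = q * arc_value r (u @ 0 # 1 # v) p n l + arc_value r (u @ 1 # v) p n l"
proof -
  have "arc_value r (u @ 1 # 0 # v) p n l = q * arc_value r (u @ 0 # 1 # v) p n l
     + 1 * arc_value r (u @ 1 # v) p n l + 0 * arc_value r (u @ []) p n l"
  proof (rule arc_value_append_linear[OF _ assms(1-3)], goal_cases)
    case (1 p n l)
    define Y where "Y = arc_op r (arc_value r v)"
    have h: "p + n = l + 1 + int (count_list v 1)" using 1 by simp
    have o: "bracket (if n = r then y else 1) (l + 1) = q * bracket (if n = r then y else 1) l + 1"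
      using h r 1 by (intro bracket_succ) auto
    have z: "l > 0 \<Longrightarrow> nat l = Suc (nat (l - 1))" using 1 by auto
    have q: "q ^ nat l * Y a b (l - 1) = q * (q ^ nat (l - 1) * Y a b (l - 1))" for a b
      using 1 z by (cases "l = 0") (auto simp: Y_def arc_op_neg)
    have e: "arc_value r (1 # 0 # v) p n l =
        bracket (if n = 0 then z else 1) p * (q ^ nat l * Y (p - 1) n (l - 1)) + q ^ nat p * (q ^ nat l * Y p (n - 1) (l - 1))
        + bracket (if n = r then y else 1) (l + 1) * (q ^ nat l * Y p n l)"
      by (simp add: arc_op_def[of r "arc_value r (0 # v)"] Y_def algebra_simps)
    have "arc_value r (1 # 0 # v) p n l = q * (bracket (if n = 0 then z else 1) p * (q ^ nat (l - 1) * Y (p - 1) n (l - 1)) + q ^ nat p * (q ^ nat (l - 1) * Y p (n - 1) (l - 1))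
        + bracket (if n = r then y else 1) l * (q ^ nat l * Y p n l)) + 1 * (q ^ nat l * Y p n l) + 0 * arc_value r [] p n l"
      unfolding e o q by (simp add: algebra_simps)
    also have "\<dots> = q * arc_value r (0 # 1 # v) p n l + 1 * arc_value r (1 # v) p n l + 0 * arc_value r [] p n l"
      by (simp add: arc_op_def[of r "arc_value r (Suc 0 # v)"] Y_def)
    finally show ?case .
  qed
  then show ?thesis by simp
qed

lemma arc_value_10_initial:
  "arc_value r (1 # 0 # v) 0 r 0 = y * arc_value r (1 # v) 0 r 0"
  by (simp add: arc_op_def[of r "arc_value r (0 # v)"] arc_op_neg)

lemma live_value_10_initial:
  "live_value 1 (0 # v) 0 = y * live_value 1 v 0"
  by simp

lemma live_value_sorted: "live_value b (replicate i 1 @ replicate j 2) 0 = z ^ j"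
proof (induction i arbitrary: b)
  case 0
  have "live_value b (replicate j 2) k = z ^ (j + k)" for k
    by (induction j arbitrary: k) auto
  then show ?case by simp
qed auto

text \<open>Without the letter 0 no lower arc may be opened. So every 1 closes a negative arc, and
  every 2 becomes a loop of weight \<open>z\<close>. The inequality for \<open>r\<close> lets
  \<open>i\<close> decrease while \<open>r\<close> stays fixed.\<close>

lemma arc_value_sorted:
  "r \<ge> int i \<Longrightarrow> arc_value r (replicate i 1 @ replicate j 2) 0 (int i) 0 = z ^ j"
proof (induction i)
  case 0
  show ?case
  proof (induction j)
    case (Suc j)
    have "arc_value r (replicate j 2) 1 0 1 = 0"
      by (rule arc_value_no_closers) (auto simp: count_list_0_iff)
    then show ?case
      using Suc by (simp add: arc_op_def arc_value_neg)
  qed simp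
next
  case (Suc i)
  have "arc_value r (replicate i 1 @ replicate j 2) 0 (int i + 1) 1 = 0"
    by (rule arc_value_no_closers) (auto simp: count_list_0_iff)
  then show ?case
    using Suc by (simp add: arc_op_def add.commute)
qed

section \<open>Reduction of arbitrary words to sorted ones\<close>

lemma no_descent_split:
  fixes w :: "nat list"
  assumes "\<And>u a b v. w = u @ a # b # v \<Longrightarrow> a \<le> b"
  shows "sorted w"
  using assms
proof (induction w rule: induct_list012)
  case (3 a b w)
  have "a \<le> b" using "3.prems"[of "[]"] by simp
  moreover have "sorted (b # w)"
    using "3.prems" by (intro "3.IH"(2)) (metis append_Cons)
  ultimately show ?case by auto
qed auto

lemma sorted_12:
  "sorted w \<Longrightarrow> set w \<subseteq> {1, 2::nat} \<Longrightarrow> \<exists>i j. w = replicate i 1 @ replicate j 2"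
proof (induction w)
  case Nil
  then show ?case by simp
next
  case (Cons c w)
  then obtain i j where w: "w = replicate i 1 @ replicate j 2" by auto
  show ?case
  proof (cases "c = 1")
    case True
    then show ?thesis using w by (metis append_Cons replicate_Suc)
  next
    case False
    then have "c = 2" "i = 0" using Cons.prems w by (cases i, auto)+
    then show ?thesis using w by (metis append_Nil replicate_0 replicate_Suc)
  qed
qed

text \<open>Both sides satisfy \<open>DE = qED + D + E\<close>, \<open>DA = qAD + A\<close>, \<open>AE = qEA + A\<close> in every context
  and the same boundary conditions, which determine them.\<close>

theorem live_value_eq_arc_value:
  assumes "set w \<subseteq> {0, 1, 2}" "r = int (count_list (1 # w) 1)"
  shows "live_value 1 w 0 = arc_value r (1 # w) 0 r 0"
  using assms
proof (induction w rule: wf_induct_rule[OF wf_lenlex[OF wf_less_than]])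
  case (1 w)
  have IH: "live_value 1 w' 0 = arc_value r (1 # w') 0 r 0"
    if "(w', w) \<in> lenlex less_than" "set w' \<subseteq> {0, 1, 2}" "count_list w' 1 = count_list w 1" for w'
    using 1 that by auto
  have swap: "(u @ b # a # v, u @ a # b # v) \<in> lenlex less_than" if "b < a" for u v and a b :: nat
    using that by (auto simp: lenlex_conv intro!: lex_append_leftI)
  have del: "(u @ a # v, u @ b # c # v) \<in> lenlex less_than" for u v and a b c :: nat
    by (auto simp: lenlex_conv)
  show ?case
  proof (cases "\<exists>u a b v. w = u @ a # b # v \<and> b < a")
    case True
    then obtain u a b v where w: "w = u @ a # b # v" and "b < a" by blast
    then have "(a, b) \<in> {(2, 0), (2, 1), (1, 0)}" using 1(2) by auto
    moreover have c: "r = int (count_list (u @ a # b # v) 1) + 1" using 1(3) w by simp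
    ultimately consider "a = 2" "b = 0" | "a = 2" "b = 1" | "a = 1" "b = 0" by auto
    then show ?thesis
    proof cases
      case 1
      note e = \<open>a = 2\<close> \<open>b = 0\<close>
      have "live_value 1 w 0 = q * live_value 1 (u @ 0 # 2 # v) 0
          + live_value 1 (u @ 2 # v) 0 + live_value 1 (u @ 0 # v) 0"
        unfolding w e by (rule live_value_20)
      \<comment> \<open>The initial 1 is absorbed into the prefix. It is the further negative arc
        that makes the number of 1's in \<open>v\<close> smaller than \<open>r\<close>.\<close>
      also have "\<dots> = q * arc_value r ((1 # u) @ 0 # 2 # v) 0 r 0
          + arc_value r ((1 # u) @ 2 # v) 0 r 0 + arc_value r ((1 # u) @ 0 # v) 0 r 0"
        using "1.prems" swap[of 0 2 u v] del[of u _ v 2 0] by (subst (1 2 3) IH) (auto simp: w e)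
      also have "\<dots> = arc_value r ((1 # u) @ 2 # 0 # v) 0 r 0"
        using c e by (intro arc_value_20[symmetric]) auto
      finally show ?thesis by (simp add: w e)
    next
      case 2
      note e = \<open>a = 2\<close> \<open>b = 1\<close>
      have "live_value 1 w 0 = q * live_value 1 (u @ 1 # 2 # v) 0
          + live_value 1 (u @ 1 # v) 0"
        unfolding w e by (rule live_value_21)
      also have "\<dots> = q * arc_value r ((1 # u) @ 1 # 2 # v) 0 r 0
          + arc_value r ((1 # u) @ 1 # v) 0 r 0"
        using "1.prems" swap[of 1 2 u v] del[of u 1 v 2 1] by (subst (1 2) IH) (auto simp: w e)
      also have "\<dots> = arc_value r ((1 # u) @ 2 # 1 # v) 0 r 0"
        using c e by (intro arc_value_21[symmetric]) auto
      finally show ?thesis by (simp add: w e)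
    next
      case 3
      note e = \<open>a = 1\<close> \<open>b = 0\<close>
      have "live_value 1 w 0 = q * live_value 1 (u @ 0 # 1 # v) 0
          + live_value 1 (u @ 1 # v) 0"
        unfolding w e by (rule live_value_10) simp
      also have "\<dots> = q * arc_value r ((1 # u) @ 0 # 1 # v) 0 r 0
          + arc_value r ((1 # u) @ 1 # v) 0 r 0"
        using "1.prems" swap[of 0 1 u v] del[of u 1 v 1 0] by (subst (1 2) IH) (auto simp: w e)
      also have "\<dots> = arc_value r ((1 # u) @ 1 # 0 # v) 0 r 0"
        using c e by (intro arc_value_10[symmetric]) auto
      finally show ?thesis by (simp add: w e)
    qed
  next
    case False
    then have s: "sorted w" by (intro no_descent_split) (metis not_le)
    show ?thesis
    proof (cases "\<exists>v. w = 0 # v")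
      case True
      then obtain v where w: "w = 0 # v" by blast
      have "live_value 1 v 0 = arc_value r (1 # v) 0 r 0"
        using "1.prems" by (intro IH) (auto simp: w lenlex_conv)
      then show ?thesis
        unfolding w live_value_10_initial arc_value_10_initial by simp
    next
      case False
      have "0 \<notin> set w"
        using s False by (cases w) force+
      then obtain i j where w: "w = replicate i 1 @ replicate j 2"
        using sorted_12[OF s] "1.prems"(1) by (metis insert_iff singleton_iff subset_iff)
      have "count_list (replicate i (1::nat)) 1 = i" by (induction i) auto
      then have "count_list w 1 = i" by (simp add: w count_list_0_iff)
      then have r: "r = int (Suc i)" using "1.prems"(2) by simp
      have e: "1 # w = replicate (Suc i) 1 @ replicate j 2" by (simp add: w)
      have "live_value 1 w 0 = z ^ j" unfolding w by (rule live_value_sorted)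
      also have "\<dots> = arc_value r (1 # w) 0 r 0"
        unfolding e r by (rule arc_value_sorted[symmetric]) simp
      finally show ?thesis .
    qed
  qed
qed

end

section \<open>Coordinates for the maximal tiling\<close>

definition inversions :: "word \<Rightarrow> (nat \<times> nat) set" where
  "inversions w = {(i, m). i < m \<and> m < length w \<and> w ! m < w ! i}"

text \<open>The lexicographic order on (letter, position) as a single number: the order of the
  stable sort of \<open>w\<close>, whose result spells the northwest border.\<close>

definition key :: "word \<Rightarrow> nat \<Rightarrow> nat" where
  "key w k = w ! k * length w + k"

text \<open>In the maximal tiling the letters are inserted from left to right into a sorted word. When the
  letter at position \<open>m\<close> moves past the one at position \<open>i\<close>, exactly the positions \<open>k < m\<close> of smaller
  key lie before it; this gives the corner of the tile.\<close>

definition corner :: "word \<Rightarrow> nat \<Rightarrow> nat \<Rightarrow> point" where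
  "corner w K m = (\<Sum>k | k < m \<and> key w k < K. step (w ! k))"

definition cell :: "word \<Rightarrow> nat \<times> nat \<Rightarrow> tile" where
  "cell w c = Tile (corner w (key w (fst c)) (snd c)) (w ! fst c) (w ! snd c)"

lemma letter_cases: "is_word w \<Longrightarrow> k < length w \<Longrightarrow> w ! k = 0 \<or> w ! k = 1 \<or> w ! k = 2"
  unfolding is_word_def by (meson nth_mem insertE singletonD subsetD)

lemma key_less_iff:
  assumes "i < length w" "j < length w"
  shows "key w i < key w j \<longleftrightarrow> w ! i < w ! j \<or> w ! i = w ! j \<and> i < j"
proof -
  have *: "a * n + i < b * n + j" if "a < b" "i < n" for a b n i j :: nat
  proof -
    have "Suc a * n \<le> b * n" using that(1) by (intro mult_le_mono1) simp
    then show ?thesis using that(2) by simp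
  qed
  show ?thesis
  proof (cases "w ! i" "w ! j" rule: linorder_cases)
    case less
    then show ?thesis using *[of "w ! i" "w ! j"] assms by (simp add: key_def)
  next
    case equal
    then show ?thesis by (simp add: key_def)
  next
    case greater
    then show ?thesis using *[of "w ! j" "w ! i" j "length w" i] assms by (simp add: key_def)
  qed
qed

lemma key_le_iff:
  assumes "i < length w" "j < length w"
  shows "key w i \<le> key w j \<longleftrightarrow> w ! i < w ! j \<or> w ! i = w ! j \<and> i \<le> j"
  using key_less_iff[OF assms(2,1)] by auto

lemma first_descent_prefix_sorted:
  assumes "\<exists>i. descent w i" "i \<le> j" "j \<le> first_descent w"
  shows "w ! i \<le> w ! j"
proof -
  have d: "descent w (first_descent w)"
    unfolding first_descent_def using assms(1) by (rule LeastI_ex)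
  show ?thesis
    using assms(2,3)
  proof (induction j rule: dec_induct)
    case (step k)
    then have "\<not> descent w k"
      using not_less_Least[of k "descent w"] assms(3) unfolding first_descent_def by auto
    then have "w ! k \<le> w ! Suc k" using d step by (auto simp: descent_def)
    then show ?case using step by simp
  qed simp
qed

lemma vertex_eq_sum: "i \<le> length w \<Longrightarrow> vertex w i = (\<Sum>k<i. step (w ! k))"
  unfolding vertex_def
  by (simp add: sum_list_sum_nth atLeast0LessThan)

text \<open>Removing the first descent \<open>d\<close> is a transposition of adjacent positions. It
  carries all inversions other than \<open>(d, Suc d)\<close> to the inversions of the swapped word
  and respects keys. Only the relative position of \<open>d\<close> and \<open>Suc d\<close>
  changes, and since the word is sorted up to \<open>d\<close> this does not affect any
  corner.\<close>

lemma maximal_tiling_eq: "maximal_tiling w = cell w ` inversions w"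
proof (induction w rule: maximal_tiling.induct)
  case (1 w)
  show ?case
  proof (cases "\<exists>i. descent w i")
    case False
    have le: "w ! i \<le> w ! m" if "i \<le> m" "m < length w" for i m
      using that
    proof (induction m rule: dec_induct)
      case (step k)
      then have "\<not> descent w k" using False by blast
      then have "w ! k \<le> w ! Suc k" using step by (auto simp: descent_def)
      then show ?case using step by simp
    qed simp
    have "\<not> (i < m \<and> m < length w \<and> w ! m < w ! i)" for i m
      using le[of i m] by auto
    then have "inversions w = {}" by (auto simp: inversions_def)
    then show ?thesis using False by (simp add: maximal_tiling.simps[of w])
  next
    case True
    define d where "d = first_descent w"
    define w' where "w' = swap_at d w"
    define s where "s k = (if k = d then Suc d else if k = Suc d then d else k)" for k
    have "descent w d" unfolding d_def first_descent_def using True by (rule LeastI_ex)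
    then have d: "Suc d < length w" "w ! Suc d < w ! d" by (auto simp: descent_def)
    have sorted: "w ! i \<le> w ! j" if "i \<le> j" "j \<le> d" for i j
      using first_descent_prefix_sorted[OF True that(1)] that(2) by (simp add: d_def)
    have len: "length w' = length w" by (simp add: w'_def swap_at_def)
    have ss: "s (s k) = k" and s_less: "s k < length w \<longleftrightarrow> k < length w" for k
      using d by (auto simp: s_def)
    have w's: "w' ! s k = w ! k" if "k < length w" for k
      using d that by (auto simp: w'_def swap_at_def s_def nth_list_update)
    have s_mono: "s a < s b \<longleftrightarrow> a < b" if "{a, b} \<noteq> {d, Suc d}" for a b
      using that by (auto simp: s_def)
    have inv_iff: "(s i, s m) \<in> inversions w' \<longleftrightarrow> (i, m) \<in> inversions w - {(d, Suc d)}" for i m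
    proof (cases "i < length w \<and> m < length w")
      case True
      show ?thesis
      proof (cases "{i, m} = {d, Suc d}")
        case True
        then show ?thesis using d w's[of d] w's[of "Suc d"]
          by (auto simp: doubleton_eq_iff inversions_def s_def)
      next
        case False
        then show ?thesis using True w's s_mono[OF False] by (auto simp: inversions_def len s_less)
      qed
    qed (use s_less[of i] s_less[of m] in \<open>auto simp: inversions_def len\<close>)
    have key_s: "key w' (s a) < key w' (s b) \<longleftrightarrow> key w a < key w b"
      if ab: "a < length w" "b < length w" for a b
    proof -
      have "w ! a = w ! b \<Longrightarrow> s a < s b \<longleftrightarrow> a < b"
        using d(2) by (cases "{a, b} = {d, Suc d}") (auto simp: doubleton_eq_iff s_mono)
      then show ?thesis
        using ab w's by (auto simp: key_less_iff len s_less)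
    qed
    have cell_s: "cell w' (s i, s m) = cell w (i, m)" if im: "(i, m) \<in> inversions w - {(d, Suc d)}" for i m
    proof -
      have i: "i < m" "m < length w" "w ! m < w ! i" using im by (auto simp: inversions_def)
      \<comment> \<open>Only \<open>{k, m} = {d, Suc d}\<close> is critical. If
        \<open>m = Suc d\<close> and \<open>k = d\<close>, then \<open>i < d\<close> and the key of
        \<open>d\<close> exceeds that of \<open>i\<close>, so neither side holds; and
        \<open>m = d\<close> cannot end an inversion, because the prefix is sorted.\<close>
      have *: "s k < s m \<and> key w' (s k) < key w' (s i) \<longleftrightarrow> k < m \<and> key w k < key w i"
        if "k < length w" for k
      proof (cases "{k, m} = {d, Suc d}")
        case False
        then show ?thesis using s_mono[OF False] key_s that i by auto
      next
        case True
        then consider "k = d" "m = Suc d" | "k = Suc d" "m = d" by (auto simp: doubleton_eq_iff)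
        then show ?thesis
        proof cases
          case 1
          then have "i < d" using im i by auto
          then have "w ! i \<le> w ! d" by (intro sorted) auto
          then show ?thesis using 1 key_s[of k i] that i \<open>i < d\<close> by (auto simp: key_less_iff s_def)
        next
          case 2
          then have "w ! i \<le> w ! m" using i by (intro sorted) auto
          then show ?thesis using i by simp
        qed
      qed
      have "corner w (key w i) m = corner w' (key w' (s i)) (s m)"
        unfolding corner_def
      proof (rule sum.reindex_bij_witness[of _ s s], goal_cases)
        case (2 k) then show ?case using * i by auto
      next
        case (4 k)
        have "s m < length w" using i by (simp add: s_less)
        then have "k < length w" using 4 by simp
        then have "s k < length w" by (simp add: s_less)
        then show ?case using *[of "s k"] 4 by (simp add: ss)
      next
        case (5 k) then show ?case using w's i by simp
      qed (auto simp: ss)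
      then show ?thesis using w's i by (simp add: cell_def)
    qed
    have "inversions w' = (\<lambda>(i, m). (s i, s m)) ` (inversions w - {(d, Suc d)})"
    proof (intro set_eqI iffI)
      fix c assume "c \<in> inversions w'"
      then have "(s (fst c), s (snd c)) \<in> inversions w - {(d, Suc d)}"
        using inv_iff[of "s (fst c)" "s (snd c)"] by (simp add: ss)
      then have "(\<lambda>(i, m). (s i, s m)) (s (fst c), s (snd c)) \<in> (\<lambda>(i, m). (s i, s m)) ` (inversions w - {(d, Suc d)})"
        by (rule imageI)
      then show "c \<in> (\<lambda>(i, m). (s i, s m)) ` (inversions w - {(d, Suc d)})" by (simp add: ss)
    qed (use inv_iff in auto)
    then have "cell w' ` inversions w' =
        (\<lambda>c. cell w' (s (fst c), s (snd c))) ` (inversions w - {(d, Suc d)})"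
      by (simp add: image_image split_beta)
    also have "\<dots> = cell w ` (inversions w - {(d, Suc d)})"
    proof (rule image_cong[OF refl])
      fix c assume "c \<in> inversions w - {(d, Suc d)}"
      then show "cell w' (s (fst c), s (snd c)) = cell w c"
        using cell_s[of "fst c" "snd c"] by simp
    qed
    finally have "cell w' ` inversions w' = cell w ` (inversions w - {(d, Suc d)})" .
    moreover have "Tile (vertex w d) (w ! d) (w ! Suc d) = cell w (d, Suc d)"
    proof -
      \<comment> \<open>The letters lying before the tile of the descent are exactly those before
        \<open>d\<close>, so its corner is the border vertex \<open>d\<close>.\<close>
      have "k < Suc d \<and> key w k < key w d \<longleftrightarrow> k < d" for k
      proof (cases "k < d")
        case True
        then have "w ! k \<le> w ! d" by (intro sorted) auto
        then show ?thesis using True d by (auto simp: key_less_iff)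
      qed (auto simp: less_Suc_eq)
      then have "{k. k < Suc d \<and> key w k < key w d} = {..<d}" by blast
      then show ?thesis using d by (simp add: cell_def corner_def vertex_eq_sum)
    qed
    moreover have "(d, Suc d) \<in> inversions w" using d by (simp add: inversions_def)
    ultimately show ?thesis
      using True 1 by (subst maximal_tiling.simps) (auto simp: d_def[symmetric] w'_def[symmetric])
  qed
qed

text \<open>In the coordinates of \<open>corner\<close> a strip is a hook: it starts vertically as the letter at position
  \<open>i\<close> moves towards its place, and continues horizontally as later letters move past it.\<close>

definition hook :: "word \<Rightarrow> nat \<Rightarrow> (nat \<times> nat) set" where
  "hook w i = {(key w i, m) | m. i \<le> m \<and> m \<le> length w} \<union> {(K, i) | K. key w i \<le> K}"

definition strip_edges :: "word \<Rightarrow> nat \<Rightarrow> edge set" where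
  "strip_edges w i = (\<lambda>(K, m). Edge (corner w K m) (w ! i)) ` hook w i"

text \<open>A coordinate that grows along a strip towards the northwest border: vertical edges move
  west or southwest, diagonal ones west or north, horizontal ones north or northeast.\<close>

definition progress :: "edge \<Rightarrow> int" where
  "progress e = (case e of Edge p c \<Rightarrow>
     if c = 2 then - fst p else if c = 1 then snd p - fst p else snd p)"

lemma fst_corner: "fst (corner w K m) = - int (card {k. k < m \<and> key w k < K \<and> w ! k \<noteq> 2})"
proof -
  have "fst (corner w K m) = (\<Sum>k | k < m \<and> key w k < K. if w ! k \<noteq> 2 then - 1 else 0)"
    unfolding corner_def fst_sum by (intro sum.cong) (auto simp: step_def)
  also have "\<dots> = (\<Sum>k | k \<in> {k. k < m \<and> key w k < K} \<and> w ! k \<noteq> 2. - 1)"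
    by (subst sum.inter_filter[symmetric]) auto
  finally show ?thesis by (simp add: conj_ac)
qed

lemma snd_corner:
  assumes "is_word w" "m \<le> length w"
  shows "snd (corner w K m) = - int (card {k. k < m \<and> key w k < K \<and> w ! k \<noteq> 0})"
proof -
  have "w ! k \<in> {0,1,2}" if "k < m" for k
    using assms that letter_cases[of w k] by auto
  then have "snd (corner w K m) = (\<Sum>k | k < m \<and> key w k < K. if w ! k \<noteq> 0 then - 1 else 0)"
    unfolding corner_def snd_sum by (intro sum.cong) (auto simp: step_def)
  also have "\<dots> = (\<Sum>k | k \<in> {k. k < m \<and> key w k < K} \<and> w ! k \<noteq> 0. - 1)"
    by (subst sum.inter_filter[symmetric]) auto
  finally show ?thesis by (simp add: conj_ac)
qed

lemma card_psubset_neq: "finite B \<Longrightarrow> A \<subseteq> B \<Longrightarrow> x \<in> B \<Longrightarrow> x \<notin> A \<Longrightarrow> card A = card B \<Longrightarrow> False"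
  by (metis card_subset_eq)

text \<open>If an edge belonged to two strips, comparing the numbers of letters below its corner would make a
  set equinumerous with a proper subset.\<close>

lemma strip_edges_disjoint_less:
  assumes "is_word w" "j < length w" "i < j" and e: "e \<in> strip_edges w i" "e \<in> strip_edges w j"
  shows False
proof -
  note letters = letter_cases[OF assms(1)]
  obtain K m L l where h: "(K, m) \<in> hook w i" "(L, l) \<in> hook w j"
    and eq: "Edge (corner w K m) (w ! i) = Edge (corner w L l) (w ! j)"
    using e unfolding strip_edges_def by auto
  have ml: "m \<le> length w" "l \<le> length w" "i \<le> m" "j \<le> l"
    using h assms by (auto simp: hook_def)
  have wij: "w ! i = w ! j" using eq by simp
  define X where "X K m = {k. k < m \<and> key w k < K \<and> w ! k \<noteq> 2}" for K m
  define Y where "Y K m = {k. k < m \<and> key w k < K \<and> w ! k \<noteq> 0}" for K m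
  have cX: "card (X K m) = card (X L l)" and cY: "card (Y K m) = card (Y L l)"
    using eq fst_corner[of w K m] fst_corner[of w L l] snd_corner[OF assms(1) ml(1), of K]
      snd_corner[OF assms(1) ml(2), of L] by (simp_all add: X_def Y_def)
  have fin: "finite (X K m)" "finite (Y K m)" for K m by (auto simp: X_def Y_def)
  have i: "i < length w" using assms by simp
  note kl = key_less_iff[of _ w]
  consider "w ! i = 2" | "w ! i = 1" | "w ! i = 0" using letters[OF i] by metis
  then show False
  proof cases
    case 1
    have K: "key w k < K \<longleftrightarrow> w ! k \<noteq> 2 \<or> k < i" if "k < m" for k
      using h(1) 1 that ml i letters[of k] kl[of k i] by (auto simp: hook_def)
    have L: "key w k < L \<longleftrightarrow> w ! k \<noteq> 2 \<or> k < j" if "k < l" for k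
      using h(2) 1 wij that ml assms(2) letters[of k] kl[of k j] by (auto simp: hook_def)
    have Yi: "i \<in> Y L l" "i \<notin> Y K m" using 1 K L ml assms by (auto simp: Y_def)
    have "k < l" if "k < m" "w ! k \<noteq> 2" for k
    proof (cases "m \<le> l")
      case False
      then have "X L l \<subseteq> X K m" using K L by (auto simp: X_def)
      then have "X L l = X K m" using cX fin by (intro card_subset_eq) auto
      moreover have "k \<in> X K m" using that K by (auto simp: X_def)
      ultimately show ?thesis by (auto simp: X_def)
    qed (use that in auto)
    then have "Y K m \<subseteq> Y L l" using K L ml assms by (force simp: Y_def)
    then show False using card_psubset_neq[OF fin(2) _ Yi cY] by blast
  next
    case 2
    have K0: "key w k < K" if "k < i" "w ! k \<noteq> 2" for k
      using h(1) 2 that ml i letters[of k] kl[of k i] by (auto simp: hook_def)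
    have L0: "key w k < L" if "k < j" "w ! k \<noteq> 2" for k
      using h(2) 2 wij that ml assms(2) letters[of k] kl[of k j] by (auto simp: hook_def)
    show False
    \<comment> \<open>On the vertical leg of the hook of \<open>i\<close> the letters other than 2
      are compared, on the horizontal leg the letters other than 0. In both cases \<open>i\<close>
      itself makes the inclusion proper.\<close>
    proof (cases "m = i")
      case True
      then have "X K m \<subseteq> X L l" using L0 ml assms by (auto simp: X_def)
      moreover have "i \<in> X L l" "i \<notin> X K m" using 2 L0 ml assms True by (auto simp: X_def)
      ultimately show False using card_psubset_neq[OF fin(1) _ _ _ cX] by blast
    next
      case False
      then have "K = key w i" using h by (auto simp: hook_def)
      then have "Y K m \<subseteq> {k. k < i \<and> w ! k = 1}"
        using 2 ml i letters kl by (force simp: Y_def)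
      also have "\<dots> \<subseteq> Y L l" using L0 ml assms by (auto simp: Y_def)
      finally have "Y K m \<subseteq> Y L l" .
      moreover have "i \<in> Y L l" "i \<notin> Y K m" using 2 L0 ml assms \<open>K = key w i\<close> by (auto simp: Y_def)
      ultimately show False using card_psubset_neq[OF fin(2) _ _ _ cY] by blast
    qed
  next
    case 3
    have K: "k < m \<and> key w k < K \<longleftrightarrow> k < i \<and> key w k < K" for k
      using h(1) 3 ml i kl[of k i] by (auto simp: hook_def)
    have L: "k < l \<and> key w k < L \<longleftrightarrow> k < j \<and> key w k < L" for k
      using h(2) 3 wij ml assms(2) kl[of k j] by (auto simp: hook_def)
    have KL: "key w i \<le> K" "key w j \<le> L" using h by (auto simp: hook_def)
    have L0: "key w k < L" if "k < j" "w ! k = 0" for k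
      using KL(2) that 3 wij assms kl[of k j] by auto
    have iX: "i \<in> X L l" "i \<notin> X K m" using 3 L0 L[of i] K[of i] assms by (auto simp: X_def)
    show False
    \<comment> \<open>If such a diagonal letter exists, no 2 contributes to the corner on the side
      of \<open>j\<close>, so its height counts 1's only. The additional 0's before \<open>j\<close>
      force fewer 1's there, because the horizontal coordinates agree, and this contradicts the
      equality of the heights.\<close>
    proof (cases "\<exists>k0<i. w ! k0 = 1 \<and> L \<le> key w k0")
      case False
      have "X K m \<subseteq> X L l"
      proof
        fix k assume k: "k \<in> X K m"
        then have "k < i" "w ! k \<noteq> 2" using K[of k] by (auto simp: X_def)
        then have "key w k < L" using False L0[of k] letters[of k] assms by force
        then show "k \<in> X L l" using L[of k] \<open>k < i\<close> assms k by (auto simp: X_def)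
      qed
      then show False using card_psubset_neq[OF fin(1) _ iX cX] by blast
    next
      case True
      then obtain k0 where k0: "k0 < i" "w ! k0 = 1" "L \<le> key w k0" by blast
      define Z where "Z j = {k. k < j \<and> w ! k = 0}" for j
      define P where "P K m = {k. k < m \<and> key w k < K \<and> w ! k = 1}" for K m
      have fin': "finite (Z j)" "finite (P K m)" for j K m by (auto simp: Z_def P_def)
      have K0: "key w k < K" if "k < i" "w ! k = 0" for k
        using KL(1) that 3 i kl[of k i] by auto
      have X1: "X K m = Z i \<union> P K m"
      proof (intro set_eqI iffI)
        fix k assume "k \<in> X K m"
        then show "k \<in> Z i \<union> P K m"
          using K[of k] letters[of k] i by (auto simp: X_def Z_def P_def)
      qed (use K K0 i in \<open>auto simp: X_def Z_def P_def\<close>)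
      have X2: "X L l = Z j \<union> P L l"
      proof (intro set_eqI iffI)
        fix k assume "k \<in> X L l"
        then show "k \<in> Z j \<union> P L l"
          using L[of k] letters[of k] assms by (auto simp: X_def Z_def P_def)
      qed (use L L0 in \<open>auto simp: X_def Z_def P_def\<close>)
      have "card (X K m) = card (Z i) + card (P K m)" "card (X L l) = card (Z j) + card (P L l)"
        unfolding X1 X2 by (intro card_Un_disjoint fin'; auto simp: Z_def P_def)+
      moreover have "card (Z i) < card (Z j)"
        using 3 assms(3) by (intro psubset_card_mono fin') (auto simp: Z_def)
      ultimately have "card (P L l) < card (P K m)" using cX by linarith
      moreover have "Y L l \<subseteq> P L l"
      proof
        fix k assume k: "k \<in> Y L l"
        then have "key w k < key w k0" "k < j" using k0 L[of k] by (auto simp: Y_def)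
        then have "w ! k \<le> 1" using kl[of k k0] k0 assms by auto
        then show "k \<in> P L l" using k by (auto simp: Y_def P_def)
      qed
      moreover have "P K m \<subseteq> Y K m" by (auto simp: Y_def P_def)
      ultimately show False
        using cY card_mono[OF fin'(2), of "Y L l" L l] card_mono[OF fin(2), of "P K m" K m] by linarith
    qed
  qed
qed

lemma strip_edges_unique:
  assumes "is_word w" "i < length w" "j < length w" "e \<in> strip_edges w i" "e \<in> strip_edges w j"
  shows "i = j"
  using strip_edges_disjoint_less[of w i j e] strip_edges_disjoint_less[of w j i e] assms
  by (cases i j rule: linorder_cases) auto

section \<open>Following strips through the tiling\<close>

lemma corner_row_step:
  assumes "i < m" "m < length w" "w ! m < w ! i"
  shows "corner w (key w i) (Suc m) = corner w (key w i) m + step (w ! m)"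
proof -
  have "{k. k < Suc m \<and> key w k < key w i} = insert m {k. k < m \<and> key w k < key w i}"
    using assms by (auto simp: less_Suc_eq key_less_iff)
  then show ?thesis by (simp add: corner_def add.commute)
qed

lemma key_eq_iff: "i < length w \<Longrightarrow> j < length w \<Longrightarrow> key w i = key w j \<longleftrightarrow> i = j"
  using key_less_iff[of i w j] key_less_iff[of j w i] by (cases i j rule: linorder_cases) auto

lemma corner_column_step:
  assumes "i < m" "m \<le> length w"
  shows "corner w (Suc (key w i)) m = corner w (key w i) m + step (w ! i)"
proof -
  have "k = i" if "k < m" "key w k = key w i" for k
    using that assms key_eq_iff[of k w i] by simp
  then have "{k. k < m \<and> key w k < Suc (key w i)} = insert i {k. k < m \<and> key w k < key w i}"
    using assms by (auto simp: less_Suc_eq)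
  then show ?thesis by (simp add: corner_def add.commute)
qed

lemma corner_row_skip:
  assumes "i \<le> m" "m < length w" "\<not> w ! m < w ! i"
  shows "corner w (key w i) (Suc m) = corner w (key w i) m"
proof -
  have "{k. k < Suc m \<and> key w k < key w i} = {k. k < m \<and> key w k < key w i}"
    using assms by (auto simp: less_Suc_eq key_less_iff)
  then show ?thesis by (simp add: corner_def)
qed

lemma corner_column_skip:
  assumes "\<nexists>k. k < m \<and> key w k = K"
  shows "corner w (Suc K) m = corner w K m"
proof -
  have "{k. k < m \<and> key w k < Suc K} = {k. k < m \<and> key w k < K}"
    using assms by (auto simp: less_Suc_eq)
  then show ?thesis by (simp add: corner_def)
qed

lemma cell_sides:
  assumes "(i, m) \<in> inversions w"
  shows "east (cell w (i, m)) = Edge (corner w (key w i) m) (w ! i)"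
    and "west (cell w (i, m)) = Edge (corner w (key w i) (Suc m)) (w ! i)"
    and "north (cell w (i, m)) = Edge (corner w (key w i) m) (w ! m)"
    and "south (cell w (i, m)) = Edge (corner w (Suc (key w i)) m) (w ! m)"
  using assms corner_row_step[of i m w] corner_column_step[of i m w]
  by (auto simp: cell_def inversions_def)

lemma cell_sides_strip:
  assumes "(i, m) \<in> inversions w"
  shows "east (cell w (i, m)) \<in> strip_edges w i" "west (cell w (i, m)) \<in> strip_edges w i"
    "north (cell w (i, m)) \<in> strip_edges w m" "south (cell w (i, m)) \<in> strip_edges w m"
proof -
  have im: "i < m" "m < length w" "w ! m < w ! i" using assms by (auto simp: inversions_def)
  have k: "key w m \<le> key w i" using im by (simp add: key_le_iff)
  have "(key w i, m) \<in> hook w i" "(key w i, Suc m) \<in> hook w i"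
    "(key w i, m) \<in> hook w m" "(Suc (key w i), m) \<in> hook w m"
    using im k by (auto simp: hook_def)
  then show "east (cell w (i, m)) \<in> strip_edges w i" "west (cell w (i, m)) \<in> strip_edges w i"
    "north (cell w (i, m)) \<in> strip_edges w m" "south (cell w (i, m)) \<in> strip_edges w m"
    unfolding cell_sides[OF assms] strip_edges_def by force+
qed

lemma cell_progress:
  assumes "is_word w" "(i, m) \<in> inversions w"
  shows "progress (east (cell w (i, m))) < progress (west (cell w (i, m)))"
    "progress (south (cell w (i, m))) < progress (north (cell w (i, m)))"
proof -
  have "i < length w" "m < length w" "w ! m < w ! i" using assms(2) by (auto simp: inversions_def)
  moreover from this have "w ! i \<in> {0,1,2}" "w ! m \<in> {0,1,2}"
    using letter_cases[OF assms(1), of i] letter_cases[OF assms(1), of m] by auto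
  ultimately have "(w ! i, w ! m) \<in> {(2,1), (2,0), (1,0)}" by auto
  then show "progress (east (cell w (i, m))) < progress (west (cell w (i, m)))"
    "progress (south (cell w (i, m))) < progress (north (cell w (i, m)))"
    by (auto simp: cell_def progress_def step_def)
qed

lemma crosses_cases:
  assumes "is_word w" "(e, e') \<in> crosses (maximal_tiling w)"
  obtains i where "i < length w" "e \<in> strip_edges w i" "e' \<in> strip_edges w i" "progress e < progress e'"
proof -
  obtain i m where im: "(i, m) \<in> inversions w" and
    "e = east (cell w (i, m)) \<and> e' = west (cell w (i, m)) \<or>
     e = south (cell w (i, m)) \<and> e' = north (cell w (i, m))"
    using assms(2) unfolding crosses_def maximal_tiling_eq by auto
  moreover have "i < length w" "m < length w" using im by (auto simp: inversions_def)
  ultimately show ?thesis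
    using that cell_sides_strip[OF im] cell_progress[OF assms(1) im] by auto
qed

text \<open>Each crossing stays within some strip, and by \<open>strip_edges_unique\<close> within
  the one it started in. Hence strips are closed under crossing and are traversed
  monotonically.\<close>

lemma crosses_rtrancl:
  assumes "is_word w" "i < length w" "e \<in> strip_edges w i"
    and "(e, e') \<in> (crosses (maximal_tiling w))\<^sup>*"
  shows "e' \<in> strip_edges w i \<and> progress e \<le> progress e'"
  using assms(4)
proof (induction rule: rtrancl_induct)
  case base
  then show ?case using assms by simp
next
  case (step f g)
  then show ?case
    using crosses_cases[OF assms(1) step(2)] strip_edges_unique[OF assms(1)] assms(2)
    by (metis less_le_not_le order.trans)
qed

text \<open>Where there is no inversion the corner does not move, so the edge is repeated. This
  allows the chain to run over all positions.\<close>

lemma row_chain: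
  assumes "i < length w" "i \<le> m" "m \<le> m'" "m' \<le> length w"
  shows "(Edge (corner w (key w i) m) (w ! i), Edge (corner w (key w i) m') (w ! i))
    \<in> (crosses (maximal_tiling w))\<^sup>*"
  using assms(3,4)
proof (induction m' rule: dec_induct)
  case (step k)
  have "(Edge (corner w (key w i) k) (w ! i), Edge (corner w (key w i) (Suc k)) (w ! i))
    \<in> (crosses (maximal_tiling w))\<^sup>*"
  proof (cases "w ! k < w ! i")
    case True
    then have "i \<noteq> k" by auto
    then have c: "(i, k) \<in> inversions w" using True step assms by (auto simp: inversions_def)
    then have "(east (cell w (i, k)), west (cell w (i, k))) \<in> crosses (maximal_tiling w)"
      unfolding crosses_def maximal_tiling_eq by blast
    then show ?thesis unfolding cell_sides[OF c] by blast
  next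
    case False
    then show ?thesis using step assms by (simp add: corner_row_skip)
  qed
  then show ?case using step by (meson Suc_leD rtrancl_trans)
qed simp

lemma column_chain:
  assumes "m < length w" "key w m \<le> K" "K \<le> K'"
  shows "(Edge (corner w K' m) (w ! m), Edge (corner w K m) (w ! m))
    \<in> (crosses (maximal_tiling w))\<^sup>*"
  using assms(3)
proof (induction K' rule: dec_induct)
  case (step k)
  have "(Edge (corner w (Suc k) m) (w ! m), Edge (corner w k m) (w ! m))
    \<in> (crosses (maximal_tiling w))\<^sup>*"
  proof (cases "\<exists>i. i < m \<and> key w i = k")
    case True
    then obtain i where i: "i < m" "key w i = k" by blast
    then have c: "(i, m) \<in> inversions w"
      using step assms key_le_iff[of m w i] by (auto simp: inversions_def)
    then have "(south (cell w (i, m)), north (cell w (i, m))) \<in> crosses (maximal_tiling w)"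
      unfolding crosses_def maximal_tiling_eq by blast
    then show ?thesis unfolding cell_sides[OF c] i(2) by blast
  next
    case False
    then show ?thesis by (simp add: corner_column_skip)
  qed
  then show ?case using step by (meson rtrancl_trans)
qed simp

text \<open>With letters at most 2, the number \<open>3 * length w\<close> exceeds every key; as
  first coordinate of a hook it marks the starting edge on the border.\<close>

lemma key_bound:
  assumes "is_word w" "i < length w"
  shows "key w i < 3 * length w"
proof -
  have "w ! i * length w \<le> 2 * length w"
    using letter_cases[OF assms] by (intro mult_le_mono1) auto
  then show ?thesis using assms(2) unfolding key_def by linarith
qed

lemma border_edge_eq:
  assumes "is_word w" "i < length w"
  shows "border_edge w i = Edge (corner w (3 * length w) i) (w ! i)"
proof -
  have "{k. k < i \<and> key w k < 3 * length w} = {..<i}"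
    using assms(2) key_bound[OF assms(1)] by auto
  then show ?thesis using assms by (simp add: border_edge_def vertex_eq_sum corner_def)
qed

text \<open>A tile reveals its two strips through its east and south sides, since different strips
  share no edge.\<close>

lemma cell_inj: 
  assumes "is_word w"
  shows "inj_on (cell w) (inversions w)"
proof (rule inj_onI)
  fix c d assume c: "c \<in> inversions w" and d: "d \<in> inversions w" and e: "cell w c = cell w d"
  obtain i m where cc: "c = (i, m)" by fastforce
  obtain j l where dd: "d = (j, l)" by fastforce
  have "i < length w" "m < length w" "j < length w" "l < length w"
    using c d by (auto simp: cc dd inversions_def)
  then have "i = j" "m = l"
    using strip_edges_unique[OF assms] cell_sides_strip[of i m w] cell_sides_strip[of j l w] c d e
    by (auto simp: cc dd)
  then show "c = d" by (simp add: cc dd)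
qed

text \<open>From the border the strip descends its vertical leg down to its own key, crossing the
  cells \<open>(a, i)\<close>, and then follows the horizontal leg through the cells
  \<open>(i, b)\<close>. Nothing else is reached, by \<open>crosses_rtrancl\<close>.\<close>

lemma strip_eq:
  assumes "is_word w" "i < length w"
  shows "strip w i = cell w ` {c \<in> inversions w. fst c = i \<or> snd c = i}"
proof
  have bs: "border_edge w i \<in> strip_edges w i"
    unfolding border_edge_eq[OF assms] strip_edges_def hook_def
    using key_bound[OF assms] less_imp_le by fastforce
  show "strip w i \<subseteq> cell w ` {c \<in> inversions w. fst c = i \<or> snd c = i}"
  proof
    fix t assume "t \<in> strip w i"
    then obtain a b where ab: "(a, b) \<in> inversions w" "t = cell w (a, b)" and
      r: "(border_edge w i, east t) \<in> (crosses (maximal_tiling w))\<^sup>* \<or>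
          (border_edge w i, south t) \<in> (crosses (maximal_tiling w))\<^sup>*"
      unfolding strip_def onward_def by (auto simp: maximal_tiling_eq)
    have "east t \<in> strip_edges w i \<or> south t \<in> strip_edges w i"
      using r crosses_rtrancl[OF assms bs] by blast
    moreover have "a < length w" "b < length w" using ab by (auto simp: inversions_def)
    ultimately have "a = i \<or> b = i"
      using cell_sides_strip[OF ab(1)] strip_edges_unique[OF assms(1)] assms(2) ab by metis
    then show "t \<in> cell w ` {c \<in> inversions w. fst c = i \<or> snd c = i}" using ab by auto
  qed
  show "cell w ` {c \<in> inversions w. fst c = i \<or> snd c = i} \<subseteq> strip w i"
  proof
    fix t assume "t \<in> cell w ` {c \<in> inversions w. fst c = i \<or> snd c = i}"
    then obtain a b where ab: "(a, b) \<in> inversions w" "t = cell w (a, b)" "a = i \<or> b = i" by auto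
    have k: "key w a < 3 * length w" using ab by (intro key_bound assms) (auto simp: inversions_def)
    have "(border_edge w i, east t) \<in> (crosses (maximal_tiling w))\<^sup>* \<or>
          (border_edge w i, south t) \<in> (crosses (maximal_tiling w))\<^sup>*"
    proof (cases "a = i")
      case True
      have "(border_edge w i, Edge (corner w (key w i) i) (w ! i)) \<in> (crosses (maximal_tiling w))\<^sup>*"
        unfolding border_edge_eq[OF assms] using k True assms by (intro column_chain) auto
      also have "(Edge (corner w (key w i) i) (w ! i), Edge (corner w (key w i) b) (w ! i)) \<in> (crosses (maximal_tiling w))\<^sup>*"
        using ab True assms by (intro row_chain) (auto simp: inversions_def)
      finally show ?thesis using ab True by (simp add: cell_sides)
    next
      case False
      then have b: "b = i" using ab by simp
      have "key w i \<le> key w a" using ab b by (subst key_le_iff) (auto simp: inversions_def)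
      then have "(border_edge w i, Edge (corner w (Suc (key w a)) i) (w ! i)) \<in> (crosses (maximal_tiling w))\<^sup>*"
        unfolding border_edge_eq[OF assms] using k assms by (intro column_chain) auto
      then show ?thesis using ab b by (simp add: cell_sides)
    qed
    then show "t \<in> strip w i" using ab unfolding strip_def onward_def by (auto simp: maximal_tiling_eq)
  qed
qed

text \<open>A row consists of a horizontal leg only, because no letter exceeds 2. Cells that come
  earlier in the row are excluded by \<open>progress\<close>, which would have to decrease.\<close>

lemma onward_west:
  assumes "is_word w" "(i, m) \<in> inversions w" "w ! i = 2"
  shows "onward (maximal_tiling w) (west (cell w (i, m))) = cell w ` {c \<in> inversions w. fst c = i \<and> m < snd c}"
    (is "?L = ?R")
proof
  have im: "i < m" "m < length w" using assms(2) by (auto simp: inversions_def)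
  have i: "i < length w" using im by simp
  note s = cell_sides_strip[OF assms(2)]
  show "?L \<subseteq> ?R"
  proof
    fix t assume "t \<in> ?L"
    then obtain a b where ab: "(a, b) \<in> inversions w" "t = cell w (a, b)" and
      r: "(west (cell w (i, m)), east t) \<in> (crosses (maximal_tiling w))\<^sup>* \<or>
          (west (cell w (i, m)), south t) \<in> (crosses (maximal_tiling w))\<^sup>*"
      unfolding onward_def by (auto simp: maximal_tiling_eq)
    have abl: "a < b" "b < length w" "w ! b < w ! a" using ab by (auto simp: inversions_def)
    have "w ! a \<le> 2" using letter_cases[OF assms(1), of a] abl by auto
    then have "b \<noteq> i" using abl assms(3) by auto
    have "\<not> (west (cell w (i, m)), south t) \<in> (crosses (maximal_tiling w))\<^sup>*"
      using crosses_rtrancl[OF assms(1) i s(2)] strip_edges_unique[OF assms(1) i abl(2)]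
        cell_sides_strip(4)[OF ab(1)] ab(2) \<open>b \<noteq> i\<close> by blast
    then have r: "(west (cell w (i, m)), east t) \<in> (crosses (maximal_tiling w))\<^sup>*" using r by blast
    then have e: "east t \<in> strip_edges w i" "progress (west (cell w (i, m))) \<le> progress (east t)"
      using crosses_rtrancl[OF assms(1) i s(2)] by blast+
    then have ai: "a = i"
      using strip_edges_unique[OF assms(1) _ i, of a "east t"] abl cell_sides_strip(1)[OF ab(1)] ab(2) by auto
    have "m < b"
    proof (rule ccontr)
      assume "\<not> m < b"
      then have "(Edge (corner w (key w i) b) (w ! i), Edge (corner w (key w i) m) (w ! i)) \<in> (crosses (maximal_tiling w))\<^sup>*"
        using abl im i ai by (intro row_chain) auto
      then have "(east t, east (cell w (i, m))) \<in> (crosses (maximal_tiling w))\<^sup>*"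
        using ab ai by (simp add: cell_sides assms(2))
      then have "progress (east t) \<le> progress (east (cell w (i, m)))"
        using crosses_rtrancl[OF assms(1) i e(1)] by blast
      then show False using e(2) cell_progress[OF assms(1,2)] by linarith
    qed
    then show "t \<in> ?R" using ab ai by auto
  qed
  show "?R \<subseteq> ?L"
  proof
    fix t assume "t \<in> ?R"
    then obtain b where b: "(i, b) \<in> inversions w" "t = cell w (i, b)" "m < b" by auto
    then have "(Edge (corner w (key w i) (Suc m)) (w ! i), Edge (corner w (key w i) b) (w ! i)) \<in> (crosses (maximal_tiling w))\<^sup>*"
      using im by (intro row_chain) (auto simp: inversions_def)
    then show "t \<in> ?L" using b unfolding onward_def by (auto simp: maximal_tiling_eq cell_sides assms(2))
  qed
qed

text \<open>The counterpart for columns: no letter is below 0, so only the vertical leg has cells,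
  and they are ordered by key instead of by position.\<close>

lemma onward_north:
  assumes "is_word w" "(i, m) \<in> inversions w" "w ! m = 0"
  shows "onward (maximal_tiling w) (north (cell w (i, m))) =
     cell w ` {c \<in> inversions w. snd c = m \<and> key w (fst c) < key w i}"
    (is "?L = ?R")
proof
  have im: "i < m" "m < length w" using assms(2) by (auto simp: inversions_def)
  have i: "i < length w" using im by simp
  note s = cell_sides_strip[OF assms(2)]
  show "?L \<subseteq> ?R"
  proof
    fix t assume "t \<in> ?L"
    then obtain a b where ab: "(a, b) \<in> inversions w" "t = cell w (a, b)" and
      r: "(north (cell w (i, m)), east t) \<in> (crosses (maximal_tiling w))\<^sup>* \<or>
          (north (cell w (i, m)), south t) \<in> (crosses (maximal_tiling w))\<^sup>*"
      unfolding onward_def by (auto simp: maximal_tiling_eq)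
    have abl: "a < b" "b < length w" "w ! b < w ! a" using ab by (auto simp: inversions_def)
    then have "a \<noteq> m" using assms(3) by auto
    have al: "a < length w" using abl by simp
    have "\<not> (north (cell w (i, m)), east t) \<in> (crosses (maximal_tiling w))\<^sup>*"
      using crosses_rtrancl[OF assms(1) im(2) s(3)] strip_edges_unique[OF assms(1) im(2) al]
        cell_sides_strip(1)[OF ab(1)] ab(2) \<open>a \<noteq> m\<close> by blast
    then have r: "(north (cell w (i, m)), south t) \<in> (crosses (maximal_tiling w))\<^sup>*" using r by blast
    then have e: "south t \<in> strip_edges w m" "progress (north (cell w (i, m))) \<le> progress (south t)"
      using crosses_rtrancl[OF assms(1) im(2) s(3)] by blast+
    then have bm: "b = m"
      using strip_edges_unique[OF assms(1) abl(2) im(2), of "south t"] cell_sides_strip(4)[OF ab(1)] ab(2) by auto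
    have "key w a < key w i"
    proof (rule ccontr)
      assume "\<not> key w a < key w i"
      moreover have "key w m \<le> key w i" using im assms(2) by (subst key_le_iff) (auto simp: inversions_def)
      ultimately have "(Edge (corner w (Suc (key w a)) m) (w ! m), Edge (corner w (Suc (key w i)) m) (w ! m)) \<in> (crosses (maximal_tiling w))\<^sup>*"
        using abl im i bm by (intro column_chain) auto
      then have "(south t, south (cell w (i, m))) \<in> (crosses (maximal_tiling w))\<^sup>*"
        using ab bm by (simp add: cell_sides assms(2))
      then have "progress (south t) \<le> progress (south (cell w (i, m)))"
        using crosses_rtrancl[OF assms(1) im(2) e(1)] by blast
      then show False using e(2) cell_progress[OF assms(1,2)] by linarith
    qed
    then show "t \<in> ?R" using ab bm by auto
  qed
  show "?R \<subseteq> ?L"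
  proof
    fix t assume "t \<in> ?R"
    then obtain a where a: "(a, m) \<in> inversions w" "t = cell w (a, m)" "key w a < key w i" by auto
    have "key w m \<le> key w a" using a by (subst key_le_iff) (auto simp: inversions_def)
    then have "(Edge (corner w (key w i) m) (w ! m), Edge (corner w (Suc (key w a)) m) (w ! m)) \<in> (crosses (maximal_tiling w))\<^sup>*"
      using im a by (intro column_chain) auto
    then show "t \<in> ?L" using a unfolding onward_def by (auto simp: maximal_tiling_eq cell_sides assms(2))
  qed
qed

section \<open>Counting tableaux column by column\<close>

text \<open>\<open>above w i j\<close>: in each column that meets the strips \<open>i\<close> and \<open>j\<close>, the former is nearer to the
  northwest border.\<close>

definition above :: "word \<Rightarrow> nat \<Rightarrow> nat \<Rightarrow> bool" where
  "above w i j \<longleftrightarrow> w ! i < w ! j \<or> w ! i = w ! j \<and> i < j"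

definition live :: "word \<Rightarrow> (nat \<times> nat) set \<Rightarrow> nat set" where
  "live w L = {i. i < length w \<and> w ! i = 2 \<and> (\<forall>m. (i, m) \<notin> L)}"

text \<open>A tableau is encoded by the sets \<open>L\<close> and \<open>U\<close> of inversions whose cells contain left-arrows and
  up-arrows.\<close>

definition fillings :: "word \<Rightarrow> ((nat \<times> nat) set \<times> (nat \<times> nat) set) set" where
  "fillings w = {(L, U). L \<subseteq> {(i, m) \<in> inversions w. w ! i = 2} \<and>
     U \<subseteq> {(i, m) \<in> inversions w. w ! m = 0} \<and> L \<inter> U = {} \<and>
     (\<forall>i m m'. (i, m) \<in> L \<longrightarrow> m < m' \<longrightarrow> (i, m') \<notin> L \<union> U) \<and>
     (\<forall>i m i'. (i, m) \<in> U \<longrightarrow> above w i' i \<longrightarrow> (i', m) \<notin> L \<union> U) \<and>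
     (\<forall>m<length w. w ! m = 0 \<longrightarrow> (\<exists>i. (i, m) \<in> U))}"

definition free_cells :: "word \<Rightarrow> (nat \<times> nat) set \<Rightarrow> (nat \<times> nat) set \<Rightarrow> (nat \<times> nat) set" where
  "free_cells w L U = {(i, m). (i, m) \<in> inversions w \<and> (i, m) \<notin> L \<union> U \<and>
     (\<forall>m'<m. (i, m') \<notin> L) \<and> (\<forall>i'. above w i i' \<longrightarrow> (i', m) \<notin> U)}"

text \<open>The contents of the strip appended by the letter \<open>x\<close>: \<open>K\<close> and
  \<open>W\<close> are the earlier strips meeting it in a left-arrow and in an up-arrow. Rows that
  already have a left-arrow are blocked. For \<open>x = 2\<close> both sets are empty, as a row
  placed last has no cells yet; for \<open>x = 1\<close> only left-arrows are possible.\<close>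

definition column_fillings :: "word \<Rightarrow> nat \<Rightarrow> (nat \<times> nat) set \<Rightarrow> (nat set \<times> nat set) set" where
  "column_fillings w x L = {(K, W). K \<subseteq> {i \<in> live w L. x < 2} \<and>
     W \<subseteq> {i. i < length w \<and> x = 0 \<and> 0 < w ! i \<and> (\<forall>m. (i, m) \<notin> L)} \<and> K \<inter> W = {} \<and>
     (\<forall>i\<in>W. \<forall>i'. above w i' i \<longrightarrow> i' \<notin> K \<union> W) \<and> (x = 0 \<longrightarrow> W \<noteq> {})}"

lemma finite_inversions [simp]: "finite (inversions w)"
  by (rule finite_subset[of _ "{..<length w} \<times> {..<length w}"]) (auto simp: inversions_def)

lemma finite_live [simp]: "finite (live w L)"
  by (simp add: live_def)

lemma finite_fillings [simp]: "finite (fillings w)"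
  by (rule finite_subset[of _ "Pow (inversions w) \<times> Pow (inversions w)"])
    (auto simp: fillings_def)

lemma fillingsD:
  assumes "(L, U) \<in> fillings w"
  shows "(i, j) \<in> L \<Longrightarrow> i < j \<and> j < length w \<and> w ! i = 2"
    and "(i, j) \<in> U \<Longrightarrow> i < j \<and> j < length w \<and> w ! j = 0"
proof -
  have "L \<subseteq> {(i, m) \<in> inversions w. w ! i = 2}" "U \<subseteq> {(i, m) \<in> inversions w. w ! m = 0}"
    using assms by (simp_all add: fillings_def)
  then show "(i, j) \<in> L \<Longrightarrow> i < j \<and> j < length w \<and> w ! i = 2"
    and "(i, j) \<in> U \<Longrightarrow> i < j \<and> j < length w \<and> w ! j = 0"
    by (auto simp: inversions_def)
qed

lemma finite_column_fillings [simp]: "finite (column_fillings w x L)"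
  by (rule finite_subset[of _ "Pow {..<length w} \<times> Pow {..<length w}"])
    (auto simp: column_fillings_def live_def)

lemma count_list_card: "count_list w c = card {i. i < length w \<and> w ! i = c}"
  unfolding count_list_eq_length_filter length_filter_conv_card
  by (rule arg_cong[where f = card]) auto

lemma inversions_snoc:
  "(i, j) \<in> inversions (w @ [x]) \<longleftrightarrow>
     (i, j) \<in> inversions w \<or> j = length w \<and> i < length w \<and> x < w ! i"
  by (auto simp: inversions_def nth_append less_Suc_eq)

lemma above_snoc: "i < length w \<Longrightarrow> j < length w \<Longrightarrow> above (w @ [x]) i j = above w i j"
  by (simp add: above_def nth_append)

text \<open>Appending a letter adds cells in the last strip only and keeps \<open>above\<close> on
  the old strips, so every condition splits into one for the old part and one for the new strip. The
  only interaction is that old left-arrows block their rows.\<close>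

lemma fillings_snoc:
  assumes L: "L \<subseteq> {(i, j). j < length w}" and U: "U \<subseteq> {(i, j). j < length w}"
  shows "(L \<union> K \<times> {length w}, U \<union> W \<times> {length w}) \<in> fillings (w @ [x]) \<longleftrightarrow>
    (L, U) \<in> fillings w \<and> (K, W) \<in> column_fillings w x L"
proof -
  let ?m = "length w" and ?w = "w @ [x]"
  let ?L = "L \<union> K \<times> {?m}" and ?U = "U \<union> W \<times> {?m}"
  have m: "(i, ?m) \<notin> L" "(i, ?m) \<notin> U" "(i, j) \<in> L \<Longrightarrow> j < ?m" "(i, j) \<in> U \<Longrightarrow> j < ?m" for i j
    using L U by auto
  have 1: "?L \<subseteq> {(i, m) \<in> inversions ?w. ?w ! i = 2} \<longleftrightarrow>
      L \<subseteq> {(i, m) \<in> inversions w. w ! i = 2} \<and> K \<subseteq> {i. i < ?m \<and> w ! i = 2 \<and> x < 2}"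
  proof -
    have "(i, j) \<in> inversions ?w \<and> ?w ! i = 2 \<longleftrightarrow> (i, j) \<in> inversions w \<and> w ! i = 2"
      if "(i, j) \<in> L" for i j
      using m(3)[OF that] by (auto simp: inversions_def nth_append)
    moreover have "(i, ?m) \<in> inversions ?w \<and> ?w ! i = 2 \<longleftrightarrow> i < ?m \<and> w ! i = 2 \<and> x < 2" for i
      by (auto simp: inversions_def nth_append)
    ultimately show ?thesis by (auto simp: subset_iff)
  qed
  have 2: "?U \<subseteq> {(i, m) \<in> inversions ?w. ?w ! m = 0} \<longleftrightarrow>
      U \<subseteq> {(i, m) \<in> inversions w. w ! m = 0} \<and> W \<subseteq> {i. i < ?m \<and> x = 0 \<and> 0 < w ! i}"
  proof -
    have "(i, j) \<in> inversions ?w \<and> ?w ! j = 0 \<longleftrightarrow> (i, j) \<in> inversions w \<and> w ! j = 0"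
      if "(i, j) \<in> U" for i j
      using m(4)[OF that] by (auto simp: inversions_def nth_append)
    moreover have "(i, ?m) \<in> inversions ?w \<and> ?w ! ?m = 0 \<longleftrightarrow> i < ?m \<and> x = 0 \<and> 0 < w ! i" for i
      by (auto simp: inversions_def nth_append)
    ultimately show ?thesis by (auto simp: subset_iff)
  qed
  have 3: "?L \<inter> ?U = {} \<longleftrightarrow> L \<inter> U = {} \<and> K \<inter> W = {}"
    using m by auto
  have 4: "(\<forall>i m m'. (i, m) \<in> ?L \<longrightarrow> m < m' \<longrightarrow> (i, m') \<notin> ?L \<union> ?U) \<longleftrightarrow>
      (\<forall>i m m'. (i, m) \<in> L \<longrightarrow> m < m' \<longrightarrow> (i, m') \<notin> L \<union> U) \<and> (\<forall>i\<in>K \<union> W. \<forall>m. (i, m) \<notin> L)"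
    (is "?A \<longleftrightarrow> ?B \<and> ?C")
  proof
    assume A: ?A
    have ?B using A by blast
    moreover have ?C using A m(3) by blast
    ultimately show "?B \<and> ?C" by blast
  next
    assume BC: "?B \<and> ?C"
    show ?A
    proof (intro allI impI notI)
      fix i j j' assume a: "(i, j) \<in> ?L" "j < j'" "(i, j') \<in> ?L \<union> ?U"
      then have "j' \<le> ?m" using m(3,4) less_imp_le by blast
      then have "(i, j) \<in> L" using a by auto
      then show False using BC a by blast
    qed
  qed
  have 5: "(\<forall>i m i'. (i, m) \<in> ?U \<longrightarrow> above ?w i' i \<longrightarrow> (i', m) \<notin> ?L \<union> ?U) \<longleftrightarrow>
      (\<forall>i m i'. (i, m) \<in> U \<longrightarrow> above w i' i \<longrightarrow> (i', m) \<notin> L \<union> U) \<and>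
      (\<forall>i\<in>W. \<forall>i'. above w i' i \<longrightarrow> i' \<notin> K \<union> W)" (is "?A \<longleftrightarrow> ?B \<and> ?C")
    if bnd: "L \<subseteq> {(i, m) \<in> inversions w. w ! i = 2}" "U \<subseteq> {(i, m) \<in> inversions w. w ! m = 0}"
      "K \<subseteq> {i. i < ?m \<and> w ! i = 2 \<and> x < 2}" "W \<subseteq> {i. i < ?m \<and> x = 0 \<and> 0 < w ! i}"
  proof -
    have b: "(i, j) \<in> L \<union> U \<Longrightarrow> i < ?m" "i \<in> K \<union> W \<Longrightarrow> i < ?m" for i j
      using bnd by (auto simp: inversions_def)
    have ab: "above ?w i' i \<longleftrightarrow> above w i' i" if "(i, j) \<in> ?L \<union> ?U" "(i', j') \<in> ?L \<union> ?U" for i i' j j'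
      using that b by (intro above_snoc) auto
    show ?thesis
    proof
      assume A: ?A
      have ?B
      proof (intro allI impI notI)
        fix i j i' assume i: "(i, j) \<in> U" "above w i' i" "(i', j) \<in> L \<union> U"
        then have i': "(i, j) \<in> ?U" "(i', j) \<in> ?L \<union> ?U" by auto
        then have "above ?w i' i" using ab[of i j i' j] i(2) by simp
        then show False using A i' by blast
      qed
      moreover have ?C
      proof (intro ballI allI impI notI)
        fix i i' assume i: "i \<in> W" "above w i' i" "i' \<in> K \<union> W"
        then have i': "(i, ?m) \<in> ?U" "(i', ?m) \<in> ?L \<union> ?U" by auto
        then have "above ?w i' i" using ab[of i ?m i' ?m] i(2) by simp
        then show False using A i' by blast
      qed
      ultimately show "?B \<and> ?C" by blast
    next
      assume BC: "?B \<and> ?C"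
      show ?A
      proof (intro allI impI notI)
        fix i j i' assume a: "(i, j) \<in> ?U" "above ?w i' i" "(i', j) \<in> ?L \<union> ?U"
        then have "above w i' i" using ab[of i j i' j] by blast
        then show False using a BC m by auto
      qed
    qed
  qed
  have 6: "(\<forall>j<length ?w. ?w ! j = 0 \<longrightarrow> (\<exists>i. (i, j) \<in> ?U)) \<longleftrightarrow>
      (\<forall>j<?m. w ! j = 0 \<longrightarrow> (\<exists>i. (i, j) \<in> U)) \<and> (x = 0 \<longrightarrow> W \<noteq> {})"
    using m by (auto simp: less_Suc_eq nth_append)
  have 7: "K \<subseteq> {i. i < ?m \<and> w ! i = 2 \<and> x < 2} \<and> W \<subseteq> {i. i < ?m \<and> x = 0 \<and> 0 < w ! i} \<and>
      (\<forall>i\<in>K \<union> W. \<forall>m. (i, m) \<notin> L) \<longleftrightarrow> K \<subseteq> {i \<in> live w L. x < 2} \<and>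
      W \<subseteq> {i. i < ?m \<and> x = 0 \<and> 0 < w ! i \<and> (\<forall>m. (i, m) \<notin> L)}"
    by (auto simp: live_def)
  show ?thesis
    unfolding fillings_def column_fillings_def mem_Collect_eq prod.case 1 2 3 4 6
    using 5 7 by argo
qed

lemma sum_fillings_snoc:
  fixes g :: "(nat \<times> nat) set \<times> (nat \<times> nat) set \<Rightarrow> 'a::comm_monoid_add"
  shows "(\<Sum>T\<in>fillings (w @ [x]). g T) =
    (\<Sum>(L, U)\<in>fillings w. \<Sum>(K, W)\<in>column_fillings w x L.
       g (L \<union> K \<times> {length w}, U \<union> W \<times> {length w}))"
proof -
  let ?m = "length w"
  let ?S = "SIGMA T:fillings w. column_fillings w x (fst T)"
  let ?f = "\<lambda>((L, U), (K, W)). (L \<union> K \<times> {?m}, U \<union> W \<times> {?m})"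
  let ?g = "\<lambda>(L, U). ((L \<inter> {(i, j). j < ?m}, U \<inter> {(i, j). j < ?m}), ({i. (i, ?m) \<in> L}, {i. (i, ?m) \<in> U}))"
  have bound: "L \<subseteq> {(i, j). j < length w'}" "U \<subseteq> {(i, j). j < length w'}" if "(L, U) \<in> fillings w'" for L U w'
    using fillingsD[OF that] by auto
  have fg: "?f (?g T) = T" if "T \<in> fillings (w @ [x])" for T
  proof -
    obtain L U where T: "T = (L, U)" by fastforce
    have "A \<inter> {(i, j). j < ?m} \<union> {i. (i, ?m) \<in> A} \<times> {?m} = A"
      if "A \<subseteq> {(i, j). j < length (w @ [x])}" for A :: "(nat \<times> nat) set"
      using that by (auto simp: less_Suc_eq)
    then show ?thesis using bound[of L U "w @ [x]"] that unfolding T by simp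
  qed
  have "(\<Sum>T\<in>fillings (w @ [x]). g T) = (\<Sum>p\<in>?S. g (?f p))"
  proof (rule sum.reindex_bij_witness[of _ ?f ?g])
    fix T assume T: "T \<in> fillings (w @ [x])"
    show "?f (?g T) = T" by (rule fg[OF T])
    show "?g T \<in> ?S"
    proof -
      obtain L U where LU: "T = (L, U)" by fastforce
      have "?f (?g T) \<in> fillings (w @ [x])" using fg T by simp
      then show ?thesis
        unfolding LU using fillings_snoc[of "L \<inter> {(i, j). j < ?m}" w "U \<inter> {(i, j). j < ?m}"] by simp
    qed
    show "g (?f (?g T)) = g T" by (simp only: fg[OF T])
  next
    fix p assume p: "p \<in> ?S"
    obtain L U K W where P: "p = ((L, U), (K, W))" by (metis surj_pair)
    have LU: "(L, U) \<in> fillings w" using p P by auto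
    show "?f p \<in> fillings (w @ [x])"
      using p bound[OF LU] fillings_snoc[of L w U] by (auto simp: P)
    show "?g (?f p) = p"
      using bound[OF LU] unfolding P by auto
  qed
  also have "\<dots> = (\<Sum>T\<in>fillings w. \<Sum>C\<in>column_fillings w x (fst T). g (?f (T, C)))"
    by (subst sum.Sigma) (auto intro!: sum.cong)
  finally show ?thesis by (simp add: case_prod_unfold)
qed

section \<open>Sums over the choices within a single strip\<close>

lemma sum_Pow_insert:
  assumes "finite A" "a \<notin> A"
  shows "(\<Sum>K\<in>Pow (insert a A). f K) = (\<Sum>K\<in>Pow A. f K) + (\<Sum>K\<in>Pow A. f (insert a K))"
proof -
  have "inj_on (insert a) (Pow A)"
    using assms(2) by (intro inj_onI) (metis PowD insert_ident subset_iff)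
  then show ?thesis
    using assms unfolding Pow_insert
    by (subst sum.union_disjoint) (auto simp: sum.reindex)
qed

context weights
begin

lemma sum_card_greater:
  fixes \<alpha> :: "'b \<Rightarrow> 'c::linorder"
  assumes "finite A" "inj_on \<alpha> A"
  shows "(\<Sum>i\<in>A. q ^ card {k \<in> A. \<alpha> i < \<alpha> k}) = (\<Sum>j<card A. q ^ j)"
  using assms
proof (induction rule: finite_ranking_induct[where f = \<alpha>])
  case (insert x S)
  show ?case
  proof (cases "x \<in> S")
    case True
    then show ?thesis using insert by (simp add: insert_absorb)
  next
    case False
    have less: "\<alpha> y < \<alpha> x" if "y \<in> S" for y
      using that insert.hyps(2)[OF that] insert.prems False by (auto simp: inj_on_def order.strict_iff_order)
    have "{k \<in> insert x S. \<alpha> i < \<alpha> k} = insert x {k \<in> S. \<alpha> i < \<alpha> k}" if "i \<in> S" for i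
      using that less by auto
    then have c: "card {k \<in> insert x S. \<alpha> i < \<alpha> k} = Suc (card {k \<in> S. \<alpha> i < \<alpha> k})" if "i \<in> S" for i
      using that False insert.hyps(1) by simp
    have "{k \<in> insert x S. \<alpha> x < \<alpha> k} = {}"
      using less by (auto dest: less_asym)
    then have m: "card {k \<in> insert x S. \<alpha> x < \<alpha> k} = 0" by (simp only: card.empty)
    have "(\<Sum>i\<in>insert x S. q ^ card {k \<in> insert x S. \<alpha> i < \<alpha> k}) =
        q ^ card {k \<in> insert x S. \<alpha> x < \<alpha> k} + (\<Sum>i\<in>S. q ^ card {k \<in> insert x S. \<alpha> i < \<alpha> k})"
      using False insert.hyps(1) by (rule sum.insert[rotated])
    also have "\<dots> = 1 + (\<Sum>i\<in>S. q * q ^ card {k \<in> S. \<alpha> i < \<alpha> k})"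
      unfolding m power_0 by (intro arg_cong2[where f = "(+)"] sum.cong refl) (simp only: c power_Suc)
    also have "\<dots> = 1 + q * (\<Sum>i\<in>S. q ^ card {k \<in> S. \<alpha> i < \<alpha> k})"
      by (simp only: sum_distrib_left)
    also have "\<dots> = 1 + q * (\<Sum>j<card S. q ^ j)"
      using insert by simp
    also have "\<dots> = (\<Sum>j<card (insert x S). q ^ j)"
      using False insert.hyps(1) by (simp add: sum.lessThan_Suc_shift sum_distrib_left del: sum.lessThan_Suc)
    finally show ?thesis .
  qed
qed simp

text \<open>The least element alone has exponent \<open>card A - 1\<close> and carries the mark
  \<open>t\<close>; the others form a geometric sum. It serves both for the up-arrow among the
  diagonal strips and for the choice of an arc to be closed.\<close>

lemma sum_bracket:
  fixes \<alpha> :: "'b \<Rightarrow> 'c::linorder"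
  assumes "finite A" "inj_on \<alpha> A"
  shows "(\<Sum>i\<in>A. q ^ card {k \<in> A. \<alpha> i < \<alpha> k} * (if \<exists>k\<in>A. \<alpha> k < \<alpha> i then 1 else t)) = bracket t (int (card A))"
proof (cases "A = {}")
  case False
  obtain a where "is_arg_min \<alpha> (\<lambda>x. x \<in> A) a"
    using ex_is_arg_min_if_finite[OF assms(1) False] by blast
  then have a: "a \<in> A" "\<And>k. k \<in> A \<Longrightarrow> \<not> \<alpha> k < \<alpha> a"
    by (auto simp: is_arg_min_def)
  have less: "\<alpha> a < \<alpha> k" if "k \<in> A" "k \<noteq> a" for k
    using a(2)[OF that(1)] inj_onD[OF assms(2), of k a] that a(1) by (cases "\<alpha> k = \<alpha> a") auto
  have "{k \<in> A. \<alpha> a < \<alpha> k} = A - {a}" using less by auto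
  then have 1: "card {k \<in> A. \<alpha> a < \<alpha> k} = card A - 1" using a by simp
  have 2: "{k \<in> A. \<alpha> i < \<alpha> k} = {k \<in> A - {a}. \<alpha> i < \<alpha> k}" if "i \<in> A - {a}" for i
    using that less by (auto dest: less_asym)
  have "(\<Sum>i\<in>A. q ^ card {k \<in> A. \<alpha> i < \<alpha> k} * (if \<exists>k\<in>A. \<alpha> k < \<alpha> i then 1 else t)) =
      q ^ (card A - 1) * t + (\<Sum>i\<in>A - {a}. q ^ card {k \<in> A. \<alpha> i < \<alpha> k} * (if \<exists>k\<in>A. \<alpha> k < \<alpha> i then 1 else t))"
    using a assms(1) 1 by (subst sum.remove[of _ a]) auto
  also have "(\<Sum>i\<in>A - {a}. q ^ card {k \<in> A. \<alpha> i < \<alpha> k} * (if \<exists>k\<in>A. \<alpha> k < \<alpha> i then 1 else t)) =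
      (\<Sum>i\<in>A - {a}. q ^ card {k \<in> A - {a}. \<alpha> i < \<alpha> k})"
  proof (rule sum.cong[OF refl])
    fix i assume i: "i \<in> A - {a}"
    then have "\<exists>k\<in>A. \<alpha> k < \<alpha> i" using less a by blast
    then show "q ^ card {k \<in> A. \<alpha> i < \<alpha> k} * (if \<exists>k\<in>A. \<alpha> k < \<alpha> i then 1 else t) =
        q ^ card {k \<in> A - {a}. \<alpha> i < \<alpha> k}"
      using 2[OF i] by simp
  qed
  also have "\<dots> = (\<Sum>j<card A - 1. q ^ j)"
    using assms a by (subst sum_card_greater) (auto intro: inj_on_subset)
  finally show ?thesis
    using False assms(1) by (simp add: bracket_def add.commute)
qed simp

text \<open>\<open>K\<close> is the set of live rows receiving a left-arrow; \<open>S - K\<close>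
  gives both the free cells and the rows that remain live.\<close>

lemma sum_Pow_diag_op:
  assumes "finite S"
  shows "(\<Sum>K\<in>Pow S. q ^ card (S - K) * V (card (S - K))) = diag_op V (card S)"
  using assms
proof (induction S arbitrary: V)
  case (insert a S)
  have "card (insert a S - K) = Suc (card (S - K))" if "K \<in> Pow S" for K
  proof -
    have "insert a S - K = insert a (S - K)" using that insert by auto
    then show ?thesis using insert by simp
  qed
  moreover have "insert a S - insert a K = S - K" if "K \<in> Pow S" for K
    using that insert by auto
  ultimately have "(\<Sum>K\<in>Pow (insert a S). q ^ card (insert a S - K) * V (card (insert a S - K))) =
     q * (\<Sum>K\<in>Pow S. q ^ card (S - K) * V (Suc (card (S - K)))) + (\<Sum>K\<in>Pow S. q ^ card (S - K) * V (card (S - K)))"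
    using insert by (simp add: sum_Pow_insert sum_distrib_left mult.assoc)
  also have "\<dots> = diag_op V (card (insert a S))"
    using insert.hyps insert.IH[of V] insert.IH[of "\<lambda>j. V (Suc j)"] by simp
  finally show ?case .
qed simp

text \<open>Here \<open>i\<close> is the row of the up-arrow and \<open>K\<close> the set of
  left-arrows, which lie south of it; the rows north of \<open>i\<close> are pointed to and stay
  live. The other summand has the up-arrow in a diagonal strip, north of all rows. Adding a
  southernmost row \<open>M\<close> yields the three terms of \<open>col_op\<close>.\<close>

lemma sum_Pow_col_op:
  fixes S :: "nat set"
  assumes "finite S"
  shows "(\<Sum>i\<in>S. \<Sum>K\<in>Pow {k \<in> S. i < k}. q ^ card ({k \<in> S. i < k} - K) * V (card (S - K)))
     + c * diag_op V (card S) = col_op c V (card S)"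
  using assms
proof (induction S arbitrary: V rule: finite_linorder_max_induct)
  case (insert M S)
  have M: "M \<notin> S" using insert by auto
  have s: "{k \<in> insert M S. i < k} = insert M {k \<in> S. i < k}" if "i \<in> S" for i
    using that insert by auto
  have c: "(\<Sum>K\<in>Pow {k \<in> insert M S. i < k}. q ^ card ({k \<in> insert M S. i < k} - K) * V (card (insert M S - K)))
     = q * (\<Sum>K\<in>Pow {k \<in> S. i < k}. q ^ card ({k \<in> S. i < k} - K) * V (Suc (card (S - K))))
      + (\<Sum>K\<in>Pow {k \<in> S. i < k}. q ^ card ({k \<in> S. i < k} - K) * V (card (S - K)))" if i: "i \<in> S" for i
  proof -
    have "card (insert M S - K) = Suc (card (S - K))"
      "card (insert M {k \<in> S. i < k} - K) = Suc (card ({k \<in> S. i < k} - K))"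
      if "K \<in> Pow {k \<in> S. i < k}" for K
    proof -
      have "insert M S - K = insert M (S - K)" "insert M {k \<in> S. i < k} - K = insert M ({k \<in> S. i < k} - K)"
        using that M by auto
      then show "card (insert M S - K) = Suc (card (S - K))"
        "card (insert M {k \<in> S. i < k} - K) = Suc (card ({k \<in> S. i < k} - K))"
        using insert(1) M by simp_all
    qed
    moreover have "insert M S - insert M K = S - K"
      "insert M {k \<in> S. i < k} - insert M K = {k \<in> S. i < k} - K" if "K \<in> Pow {k \<in> S. i < k}" for K
      using M by auto
    ultimately show ?thesis
      using insert(1) M unfolding s[OF i] by (subst sum_Pow_insert) (simp_all add: sum_distrib_left mult.assoc)
  qed
  have "{k \<in> insert M S. M < k} = {}" using insert by auto
  then have m: "(\<Sum>K\<in>Pow {k \<in> insert M S. M < k}. q ^ card ({k \<in> insert M S. M < k} - K) * V (card (insert M S - K))) = V (Suc (card S))"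
    using insert(1) M by (simp only: Pow_empty) simp
  have "(\<Sum>i\<in>insert M S. \<Sum>K\<in>Pow {k \<in> insert M S. i < k}. q ^ card ({k \<in> insert M S. i < k} - K) * V (card (insert M S - K)))
    = V (Suc (card S)) + (\<Sum>i\<in>S. \<Sum>K\<in>Pow {k \<in> insert M S. i < k}. q ^ card ({k \<in> insert M S. i < k} - K) * V (card (insert M S - K)))"
    by (subst sum.insert[OF insert(1) M]) (simp only: m)
  also have "\<dots> = V (Suc (card S)) + (q * (\<Sum>i\<in>S. \<Sum>K\<in>Pow {k \<in> S. i < k}. q ^ card ({k \<in> S. i < k} - K) * V (Suc (card (S - K))))
      + (\<Sum>i\<in>S. \<Sum>K\<in>Pow {k \<in> S. i < k}. q ^ card ({k \<in> S. i < k} - K) * V (card (S - K))))"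
    by (simp only: c sum.distrib sum_distrib_left cong: sum.cong)
  finally have e: "(\<Sum>i\<in>insert M S. \<Sum>K\<in>Pow {k \<in> insert M S. i < k}. q ^ card ({k \<in> insert M S. i < k} - K) * V (card (insert M S - K)))
    = V (Suc (card S)) + (q * (\<Sum>i\<in>S. \<Sum>K\<in>Pow {k \<in> S. i < k}. q ^ card ({k \<in> S. i < k} - K) * V (Suc (card (S - K))))
      + (\<Sum>i\<in>S. \<Sum>K\<in>Pow {k \<in> S. i < k}. q ^ card ({k \<in> S. i < k} - K) * V (card (S - K))))" .
  show ?case
    unfolding e using insert(1) M
    by (simp add: algebra_simps flip: insert.IH)
qed simp

text \<open>The variable \<open>z\<close> is absent because a live row may still die: live rows are
  weighted at the end, through \<open>live_value _ []\<close>.\<close>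

definition filling_weight :: "word \<Rightarrow> (nat \<times> nat) set \<times> (nat \<times> nat) set \<Rightarrow> 'a" where
  "filling_weight w T = q ^ card (free_cells w (fst T) (snd T)) * y ^ card {m. (0, m) \<in> snd T}"

definition column_free :: "word \<Rightarrow> nat \<Rightarrow> (nat \<times> nat) set \<Rightarrow> nat set \<Rightarrow> nat set \<Rightarrow> nat set" where
  "column_free w x L K W = {i. i < length w \<and> x < w ! i \<and> i \<notin> K \<union> W \<and> (\<forall>j. (i, j) \<notin> L) \<and>
     (\<forall>i'\<in>W. \<not> above w i i')}"

text \<open>The last strip is the westernmost one in each row, so its left-arrows point to no cell,
  and its up-arrow points within the strip. Free cells of the old part therefore remain
  free.\<close>

lemma filling_weight_snoc:
  assumes "(L, U) \<in> fillings w" "(K, W) \<in> column_fillings w x L"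
  shows "filling_weight (w @ [x]) (L \<union> K \<times> {length w}, U \<union> W \<times> {length w}) =
    filling_weight w (L, U) * (q ^ card (column_free w x L K W) * (if 0 \<in> W then y else 1))"
proof -
  let ?m = "length w"
  have bd: "(i, j) \<in> L \<Longrightarrow> i < j \<and> j < ?m" "(i, j) \<in> U \<Longrightarrow> i < j \<and> j < ?m" for i j
    using fillingsD[OF assms(1)] by auto
  have W: "W \<subseteq> {..<?m}" using assms(2) by (auto simp: column_fillings_def)
  have "(i, j) \<in> free_cells (w @ [x]) (L \<union> K \<times> {?m}) (U \<union> W \<times> {?m}) \<longleftrightarrow>
      (i, j) \<in> free_cells w L U \<union> column_free w x L K W \<times> {?m}" for i j
  proof (cases "j = ?m")
    case True
    have n: "(i, ?m) \<notin> inversions w" "(i, ?m) \<notin> L" "(i, ?m) \<notin> U"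
      using bd by (auto simp: inversions_def)
    have "(i, ?m) \<in> inversions (w @ [x]) \<longleftrightarrow> i < ?m \<and> x < w ! i"
      using n by (simp add: inversions_snoc)
    moreover have "(i, ?m) \<notin> (L \<union> K \<times> {?m}) \<union> (U \<union> W \<times> {?m}) \<longleftrightarrow> i \<notin> K \<union> W"
      using n by simp
    moreover have "(\<forall>m'<?m. (i, m') \<notin> L \<union> K \<times> {?m}) \<longleftrightarrow> (\<forall>j. (i, j) \<notin> L)"
      using bd by blast
    moreover have "i < ?m \<Longrightarrow> (\<forall>i'. above (w @ [x]) i i' \<longrightarrow> (i', ?m) \<notin> U \<union> W \<times> {?m}) \<longleftrightarrow>
        (\<forall>i'\<in>W. \<not> above w i i')"
      using W bd(2) above_snoc[of i w _ x] by blast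
    ultimately have "(i, ?m) \<in> free_cells (w @ [x]) (L \<union> K \<times> {?m}) (U \<union> W \<times> {?m}) \<longleftrightarrow>
        i \<in> column_free w x L K W"
      unfolding free_cells_def column_free_def mem_Collect_eq prod.case by argo
    then show ?thesis using n True by (simp add: free_cells_def)
  next
    case False
    have "above (w @ [x]) i i' = above w i i'" if "(i, j) \<in> inversions w" "(i', j) \<in> U" for i'
      using that bd(2)[OF that(2)] by (intro above_snoc) (auto simp: inversions_def)
    then have "(\<forall>i'. above (w @ [x]) i i' \<longrightarrow> (i', j) \<notin> U) \<longleftrightarrow> (\<forall>i'. above w i i' \<longrightarrow> (i', j) \<notin> U)"
      if "(i, j) \<in> inversions w" using that by blast
    moreover have "(\<forall>m'<j. (i, m') \<notin> L \<union> K \<times> {?m}) \<longleftrightarrow> (\<forall>m'<j. (i, m') \<notin> L)"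
      if "(i, j) \<in> inversions w" using that by (auto simp: inversions_def)
    ultimately show ?thesis
      using False unfolding free_cells_def by (auto simp: inversions_snoc)
  qed
  then have "free_cells (w @ [x]) (L \<union> K \<times> {?m}) (U \<union> W \<times> {?m}) =
      free_cells w L U \<union> column_free w x L K W \<times> {?m}" by auto
  moreover have "free_cells w L U \<inter> column_free w x L K W \<times> {?m} = {}"
    by (auto simp: free_cells_def inversions_def)
  moreover have "finite (free_cells w L U)" "finite (column_free w x L K W)"
    by (rule finite_subset[OF _ finite_inversions[of w]], auto simp: free_cells_def)
      (auto simp: column_free_def)
  ultimately have "card (free_cells (w @ [x]) (L \<union> K \<times> {?m}) (U \<union> W \<times> {?m})) =
      card (free_cells w L U) + card (column_free w x L K W)"
    by (simp add: card_Un_disjoint card_cartesian_product)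
  moreover have "{j. (0, j) \<in> U \<union> W \<times> {?m}} = (if 0 \<in> W then insert ?m {j. (0, j) \<in> U} else {j. (0, j) \<in> U})"
    by auto
  moreover have "?m \<notin> {j. (0, j) \<in> U}" "finite {j. (0, j) \<in> U}"
    using bd by (auto intro: finite_subset[of _ "{..<?m}"])
  ultimately show ?thesis
    by (simp add: filling_weight_def power_add)
qed

lemma live_snoc:
  assumes "(L, U) \<in> fillings w" "(K, W) \<in> column_fillings w x L"
  shows "live (w @ [x]) (L \<union> K \<times> {length w}) =
    (if x = 2 then insert (length w) (live w L) else live w L - K)"
proof -
  have "(length w, j) \<notin> L" for j using fillingsD(1)[OF assms(1), of "length w" j] by auto
  moreover have "K \<subseteq> {..<length w}" "x = 2 \<Longrightarrow> K = {}"
    using assms(2) by (auto simp: column_fillings_def live_def)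
  ultimately show ?thesis
    by (auto simp: live_def nth_append less_Suc_eq)
qed

text \<open>Summing out the last strip reproduces the operator of its letter. Because position 0 is
  diagonal, it is the topmost diagonal strip of every column, so the mark \<open>y\<close> falls on
  the extreme term of the bracket.\<close>

lemma live_weight_snoc:
  assumes LU: "(L, U) \<in> fillings w" and w: "set w \<subseteq> {0, 1, 2}" and x: "x \<in> {0, 1, 2}"
    and hd: "w \<noteq> [] \<Longrightarrow> w ! 0 = 1"
  shows "(\<Sum>(K, W)\<in>column_fillings w x L.
      q ^ card (column_free w x L K W) * (if 0 \<in> W then y else 1) *
      live_value (count_list (w @ [x]) 1) v (card (live (w @ [x]) (L \<union> K \<times> {length w})))) =
    live_value (count_list w 1) (x # v) (card (live w L))" (is "?lhs = ?rhs")
proof -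
  let ?S = "live w L"
  have letters: "w ! k \<in> {0, 1, 2}" if "k < length w" for k
    using w that by (meson nth_mem subsetD)
  define N where "N = {i. i < length w \<and> w ! i = 1}"
  have N: "card N = count_list w 1"
    by (simp add: N_def count_list_card)
  have noL: "(i, j) \<notin> L" if "w ! i \<noteq> 2" for i j
    using fillingsD(1)[OF LU, of i j] that by blast
  consider "x = 2" | "x = 1" | "x = 0" using x by auto
  then show ?thesis
  proof cases
    case 1
    have "column_fillings w x L = {({}, {})}"
      using 1 by (auto simp: column_fillings_def)
    moreover have "column_free w x L {} {} = {}"
      using 1 letters unfolding column_free_def by fastforce
    moreover have "length w \<notin> ?S" by (simp add: live_def)
    ultimately show ?thesis
      using 1 live_snoc[OF LU, of "{}" "{}" x] by simp
  next
    case 2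
    have c: "column_fillings w x L = (\<lambda>K. (K, {})) ` Pow ?S"
      using 2 by (auto simp: column_fillings_def)
    have f: "column_free w x L K {} = ?S - K" for K
    proof -
      have "i < length w \<and> 1 < w ! i \<longleftrightarrow> i < length w \<and> w ! i = 2" for i
        using letters[of i] by auto
      then show ?thesis
        using 2 unfolding column_free_def live_def by auto
    qed
    have l: "live (w @ [x]) (L \<union> K \<times> {length w}) = ?S - K" if "K \<in> Pow ?S" for K
      using that c 2 by (subst live_snoc[OF LU, of K "{}"]) auto
    have "?lhs = (\<Sum>K\<in>Pow ?S. q ^ card (?S - K) * live_value (count_list w 1 + 1) v (card (?S - K)))"
      unfolding c using 2 by (subst sum.reindex) (auto simp: inj_on_def f[unfolded 2] l[unfolded 2] simp del: One_nat_def intro!: sum.cong)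
    then show ?thesis using 2 by (simp add: sum_Pow_diag_op)
  next
    case 3
    let ?V = "live_value (count_list w 1) v"
    let ?A = "\<lambda>i. {k \<in> ?S. i < k}"
    let ?s = "\<lambda>i. \<Sum>K\<in>Pow {k \<in> ?S. above w i k}.
      q ^ card ({k \<in> ?S \<union> N. above w i k} - K) * (if i = 0 then y else 1) * ?V (card (?S - K))"
    have SO: "?S \<inter> N = {}" "finite N" by (auto simp: live_def N_def)
    have S2: "w ! i = 2" "i < length w" if "i \<in> ?S" for i using that by (auto simp: live_def)
    have O1: "w ! i = 1" "i < length w" if "i \<in> N" for i using that by (auto simp: N_def)
    have up: "i < length w \<and> 0 < w ! i \<and> (\<forall>m. (i, m) \<notin> L) \<longleftrightarrow> i \<in> ?S \<union> N" for i
      using letters[of i] noL[of i] by (auto simp: live_def N_def)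
    have cf: "column_free w x L K {i} = {k \<in> ?S \<union> N. above w i k} - K"
      if "i \<in> ?S \<union> N" for K i
    proof -
      have "\<not> above w k i \<and> k \<noteq> i \<longleftrightarrow> above w i k" for k
        by (auto simp: above_def)
      then show ?thesis
        using 3 up by (auto simp: column_free_def)
    qed
    \<comment> \<open>As \<open>above\<close> is a strict linear order, two up-arrows in one column
      would exclude each other, and the left-arrows have to lie below the only up-arrow.\<close>
    have c: "(K, W) \<in> column_fillings w x L \<longleftrightarrow>
        (\<exists>i \<in> ?S \<union> N. W = {i} \<and> K \<subseteq> {k \<in> ?S. above w i k})" for K W
    proof
      assume a: "(K, W) \<in> column_fillings w x L"
      then obtain i where i: "i \<in> W" using 3 by (auto simp: column_fillings_def)
      have W: "W \<subseteq> ?S \<union> N" "K \<subseteq> ?S" using a up by (auto simp: column_fillings_def)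
      have "\<forall>j\<in>W. \<forall>k. above w k j \<longrightarrow> k \<notin> K \<union> W" "K \<inter> W = {}"
        using a by (simp_all add: column_fillings_def)
      then have n: "\<not> above w k j" if "k \<in> K \<union> W" "j \<in> W" for k j
        using that by blast
      have "k = i" if "k \<in> W" for k
        using n[of k i] n[of i k] that i by (auto simp: above_def)
      then have "W = {i}" using i by blast
      moreover have "above w i k" if "k \<in> K" for k
      proof -
        have "k \<noteq> i" using \<open>K \<inter> W = {}\<close> that i by blast
        then show ?thesis using n[of k i] that i by (auto simp: above_def)
      qed
      ultimately show "\<exists>i \<in> ?S \<union> N. W = {i} \<and> K \<subseteq> {k \<in> ?S. above w i k}" using W i by blast
    next
      assume "\<exists>i \<in> ?S \<union> N. W = {i} \<and> K \<subseteq> {k \<in> ?S. above w i k}"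
      then obtain i where i: "i \<in> ?S \<union> N" "W = {i}" "K \<subseteq> {k \<in> ?S. above w i k}" by blast
      have asym: "\<not> above w a a" "above w a b \<Longrightarrow> \<not> above w b a" for a b
        by (auto simp: above_def)
      have "K \<subseteq> {i \<in> ?S. x < 2}" using i 3 by auto
      moreover have "W \<subseteq> {i. i < length w \<and> x = 0 \<and> 0 < w ! i \<and> (\<forall>m. (i, m) \<notin> L)}"
        using i up[of i] 3 by simp
      moreover have "K \<inter> W = {}" using i asym by blast
      moreover have "\<forall>i\<in>W. \<forall>i'. above w i' i \<longrightarrow> i' \<notin> K \<union> W"
        using i asym by blast
      moreover have "W \<noteq> {}" using i by simp
      ultimately show "(K, W) \<in> column_fillings w x L"
        by (simp add: column_fillings_def)
    qed
    have cs: "column_fillings w x L = (\<lambda>(i, K). (K, {i})) ` (SIGMA i:?S \<union> N. Pow {k \<in> ?S. above w i k})"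
      using c by (auto simp: image_iff)
    have l: "live (w @ [x]) (L \<union> K \<times> {length w}) = ?S - K"
      if "i \<in> ?S \<union> N" "K \<subseteq> {k \<in> ?S. above w i k}" for i K
      using that c[of K "{i}"] 3 by (subst live_snoc[OF LU, of K "{i}"]) auto
    have "?lhs = (\<Sum>(i, K)\<in>(SIGMA i:?S \<union> N. Pow {k \<in> ?S. above w i k}).
        q ^ card ({k \<in> ?S \<union> N. above w i k} - K) * (if i = 0 then y else 1) * ?V (card (?S - K)))"
    proof -
      have "?lhs = (\<Sum>(i, K)\<in>(SIGMA i:?S \<union> N. Pow {k \<in> ?S. above w i k}).
          q ^ card (column_free w x L K {i}) * (if 0 \<in> {i} then y else 1) *
          live_value (count_list (w @ [x]) 1) v (card (live (w @ [x]) (L \<union> K \<times> {length w}))))"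
        unfolding cs by (subst sum.reindex) (auto simp: inj_on_def case_prod_unfold)
      also have "\<dots> = (\<Sum>(i, K)\<in>(SIGMA i:?S \<union> N. Pow {k \<in> ?S. above w i k}).
        q ^ card ({k \<in> ?S \<union> N. above w i k} - K) * (if i = 0 then y else 1) * ?V (card (?S - K)))"
      proof (rule sum.cong[OF refl], clarify, goal_cases)
        case (1 i K)
        then have "i \<in> ?S \<union> N" by blast
        then show ?case using cf[of i K] l[of i K] 1 3 by auto
      qed
      finally show ?thesis .
    qed
    also have "\<dots> = (\<Sum>i\<in>?S \<union> N. ?s i)"
      using SO by (subst sum.Sigma) auto
    also have "\<dots> = (\<Sum>i\<in>?S. ?s i) +
        (\<Sum>i\<in>N. ?s i)"
      using SO by (intro sum.union_disjoint) auto
    also have "(\<Sum>i\<in>?S. ?s i) =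
        (\<Sum>i\<in>?S. \<Sum>K\<in>Pow (?A i). q ^ card (?A i - K) * ?V (card (?S - K)))"
    proof (rule sum.cong[OF refl])
      fix i assume i: "i \<in> ?S"
      then have "i \<noteq> 0" using hd S2[OF i] by (cases i) auto
      moreover have "{k \<in> ?S. above w i k} = ?A i" "{k \<in> ?S \<union> N. above w i k} = ?A i"
        using S2 O1 i by (auto simp: above_def)
      ultimately show "(?s i) =
        (\<Sum>K\<in>Pow (?A i). q ^ card (?A i - K) * ?V (card (?S - K)))" by simp
    qed
    also have "(\<Sum>i\<in>N. ?s i) =
        (\<Sum>i\<in>N. q ^ card {k \<in> N. i < k} * (if \<exists>k\<in>N. k < i then 1 else y) * diag_op ?V (card ?S))"
    proof (rule sum.cong[OF refl])
      fix i assume i: "i \<in> N"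
      then have "w \<noteq> []" using O1[OF i] by auto
      then have "0 \<in> N" using hd by (auto simp: N_def)
      then have z: "i = 0 \<longleftrightarrow> \<not> (\<exists>k\<in>N. k < i)" by (metis neq0_conv not_less0)
      have S: "{k \<in> ?S. above w i k} = ?S"
        using S2 O1[OF i] by (auto simp: above_def)
      have "{k \<in> ?S \<union> N. above w i k} - K = {k \<in> N. i < k} \<union> (?S - K)" if "K \<in> Pow ?S" for K
        using that S2 O1 i SO by (auto simp: above_def)
      moreover have "{k \<in> N. i < k} \<inter> (?S - K) = {}" for K using SO by auto
      ultimately have "card ({k \<in> ?S \<union> N. above w i k} - K) = card {k \<in> N. i < k} + card (?S - K)"
        if "K \<in> Pow ?S" for K
        using that SO by (simp add: card_Un_disjoint)
      then have "(?s i) =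
        (\<Sum>K\<in>Pow ?S. q ^ card {k \<in> N. i < k} * (if i = 0 then y else 1) * (q ^ card (?S - K) * ?V (card (?S - K))))"
        unfolding S by (intro sum.cong refl) (simp add: power_add mult_ac)
      also have "\<dots> = q ^ card {k \<in> N. i < k} * (if i = 0 then y else 1) * diag_op ?V (card ?S)"
        by (simp add: sum_Pow_diag_op flip: sum_distrib_left)
      finally show "(?s i) =
        q ^ card {k \<in> N. i < k} * (if \<exists>k\<in>N. k < i then 1 else y) * diag_op ?V (card ?S)"
        using z by simp
    qed
    also have "\<dots> = bracket y (int (count_list w 1)) * diag_op ?V (card ?S)"
      using sum_bracket[of N "\<lambda>i. i" y] SO by (simp add: N flip: sum_distrib_right)
    also have "(\<Sum>i\<in>?S. \<Sum>K\<in>Pow (?A i). q ^ card (?A i - K) * ?V (card (?S - K))) +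
        bracket y (int (count_list w 1)) * diag_op ?V (card ?S) = ?rhs"
      using 3 by (subst sum_Pow_col_op) auto
    finally show ?thesis .
  qed
qed

text \<open>A sweep: the prefix \<open>w\<close> is summed over actual tableaux and the suffix
  \<open>v\<close> is evaluated by operators. The total does not depend on where the word is cut,
  and the empty prefix gives the right side.\<close>

lemma sum_fillings_live_value:
  assumes "set (w @ v) \<subseteq> {0, 1, 2}" "w @ v \<noteq> []" "hd (w @ v) = 1"
  shows "(\<Sum>T\<in>fillings w. filling_weight w T * live_value (count_list w 1) v (card (live w (fst T)))) =
    live_value 0 (w @ v) 0"
  using assms
proof (induction w arbitrary: v rule: rev_induct)
  case Nil
  have "fillings [] = {({}, {})}" by (auto simp: fillings_def inversions_def)
  then show ?case by (simp add: filling_weight_def free_cells_def inversions_def live_def)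
next
  case (snoc x w)
  have "(\<Sum>T\<in>fillings (w @ [x]). filling_weight (w @ [x]) T *
      live_value (count_list (w @ [x]) 1) v (card (live (w @ [x]) (fst T)))) =
    (\<Sum>(L, U)\<in>fillings w. \<Sum>(K, W)\<in>column_fillings w x L.
      filling_weight (w @ [x]) (L \<union> K \<times> {length w}, U \<union> W \<times> {length w}) *
      live_value (count_list (w @ [x]) 1) v (card (live (w @ [x]) (L \<union> K \<times> {length w}))))"
    by (subst sum_fillings_snoc) simp
  also have "\<dots> = (\<Sum>(L, U)\<in>fillings w. filling_weight w (L, U) * (\<Sum>(K, W)\<in>column_fillings w x L.
      q ^ card (column_free w x L K W) * (if 0 \<in> W then y else 1) *
      live_value (count_list (w @ [x]) 1) v (card (live (w @ [x]) (L \<union> K \<times> {length w})))))"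
    by (auto intro!: sum.cong simp: filling_weight_snoc sum_distrib_left mult.assoc)
  also have "\<dots> = (\<Sum>(L, U)\<in>fillings w. filling_weight w (L, U) * live_value (count_list w 1) (x # v) (card (live w L)))"
  proof (rule sum.cong[OF refl], clarify)
    fix L U assume "(L, U) \<in> fillings w"
    moreover have "w ! 0 = 1" if "w \<noteq> []" using that snoc.prems by (cases w) auto
    ultimately show "filling_weight w (L, U) * (\<Sum>(K, W)\<in>column_fillings w x L.
      q ^ card (column_free w x L K W) * (if 0 \<in> W then y else 1) *
      live_value (count_list (w @ [x]) 1) v (card (live (w @ [x]) (L \<union> K \<times> {length w})))) =
      filling_weight w (L, U) * live_value (count_list w 1) (x # v) (card (live w L))"
      using snoc.prems by (subst live_weight_snoc) auto
  qed
  also have "\<dots> = live_value 0 (w @ x # v) 0"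
    using snoc.IH[of "x # v"] snoc.prems by (simp add: case_prod_unfold)
  finally show ?case by simp
qed

theorem sum_fillings:
  assumes "set w \<subseteq> {0, 1, 2}" "w \<noteq> []" "hd w = 1"
  shows "(\<Sum>T\<in>fillings w. filling_weight w T * z ^ card (live w (fst T))) = live_value 1 (tl w) 0"
proof -
  have "live_value 0 w 0 = live_value 1 (tl w) 0" using assms by (cases w) auto
  then show ?thesis using sum_fillings_live_value[of w "[]"] assms by simp
qed

end

section \<open>Counting matchings by crossings and records\<close>

definition matchings :: "('i \<Rightarrow> int) \<Rightarrow> ('b \<Rightarrow> int) \<Rightarrow> 'i set \<Rightarrow> 'b set \<Rightarrow> ('i \<Rightarrow> 'b) set" where
  "matchings \<alpha> \<beta> A B = {f \<in> A \<rightarrow>\<^sub>E B. bij_betw f A B \<and> (\<forall>i\<in>A. \<alpha> i < \<beta> (f i))}"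

definition matching_crossings :: "('i \<Rightarrow> int) \<Rightarrow> ('b \<Rightarrow> int) \<Rightarrow> 'i set \<Rightarrow> ('i \<Rightarrow> 'b) \<Rightarrow> ('i \<times> 'i) set" where
  "matching_crossings \<alpha> \<beta> A f =
     {(i, k) \<in> A \<times> A. \<alpha> i < \<alpha> k \<and> \<alpha> k < \<beta> (f i) \<and> \<beta> (f i) < \<beta> (f k)}"

text \<open>The set \<open>Z\<close> confines the marked records to certain values; it will consist
  of the points after, or before, all ends of negative upper arcs.\<close>

definition records :: "('i \<Rightarrow> int) \<Rightarrow> ('b \<Rightarrow> int) \<Rightarrow> 'i set \<Rightarrow> 'b set \<Rightarrow> ('i \<Rightarrow> 'b) \<Rightarrow> 'i set" where
  "records \<alpha> \<beta> A Z f = {i \<in> A. f i \<in> Z \<and> (\<forall>k\<in>A. \<alpha> k < \<alpha> i \<longrightarrow> \<beta> (f k) < \<beta> (f i))}"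

lemma finite_matchings [simp]: "finite A \<Longrightarrow> finite B \<Longrightarrow> finite (matchings \<alpha> \<beta> A B)"
  unfolding matchings_def by (rule finite_subset[OF _ finite_PiE[of A "\<lambda>_. B"]]) auto

lemma matchings_insert:
  assumes "i \<in> A" "b \<in> B" "f \<in> matchings \<alpha> \<beta> (A - {i}) (B - {b})" "\<alpha> i < \<beta> b"
  shows "f(i := b) \<in> matchings \<alpha> \<beta> A B"
proof -
  have f: "f \<in> (A - {i}) \<rightarrow>\<^sub>E (B - {b})" "bij_betw f (A - {i}) (B - {b})"
    "\<forall>a\<in>A - {i}. \<alpha> a < \<beta> (f a)"
    using assms(3) by (auto simp: matchings_def)
  have "bij_betw (f(i := b)) (A - {i}) (B - {b})"
    using f(2) by (rule bij_betw_cong[THEN iffD1, rotated]) auto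
  then have "bij_betw (f(i := b)) (A - {i} \<union> {i}) (B - {b} \<union> {(f(i := b)) i})"
    by (intro notIn_Un_bij_betw) auto
  then have "bij_betw (f(i := b)) A B"
    using assms by (simp add: insert_absorb)
  moreover have "f(i := b) \<in> A \<rightarrow>\<^sub>E B"
    using f(1) assms by (auto simp: PiE_iff extensional_def)
  ultimately show ?thesis using f(3) assms by (auto simp: matchings_def)
qed

lemma matchings_remove:
  assumes "f \<in> matchings \<alpha> \<beta> A B" "i \<in> A"
  shows "restrict f (A - {i}) \<in> matchings \<alpha> \<beta> (A - {i}) (B - {f i})"
proof -
  have f: "f \<in> A \<rightarrow>\<^sub>E B" "bij_betw f A B" "\<forall>a\<in>A. \<alpha> a < \<beta> (f a)"
    using assms(1) by (auto simp: matchings_def)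
  have "bij_betw f (A - {i}) (B - {f i})"
    using f(2) assms(2) by (auto simp: bij_betw_def inj_on_def)
  then have "bij_betw (restrict f (A - {i})) (A - {i}) (B - {f i})"
    by (rule bij_betw_cong[THEN iffD1, rotated]) auto
  then show ?thesis
    using f by (auto simp: matchings_def bij_betw_def)
qed

definition words :: "nat \<Rightarrow> word set" where
  "words n = {u. set u \<subseteq> {0, 1, 2} \<and> length u = n}"

lemma finite_words [simp]: "finite (words n)"
  unfolding words_def by (rule finite_lists_length_eq) simp

lemma sum_words_Suc:
  "(\<Sum>u\<in>words (Suc n). f u) = (\<Sum>u\<in>words n. f (2 # u)) + (\<Sum>u\<in>words n. f (1 # u)) + (\<Sum>u\<in>words n. f (0 # u))"
  for f :: "word \<Rightarrow> 'b::comm_monoid_add"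
proof -
  let ?c = "\<lambda>d. (#) d ` words n"
  have e: "words (Suc n) = (?c 2 \<union> ?c 1) \<union> ?c 0"
    by (auto simp: words_def length_Suc_conv image_iff)
  have fin: "finite (?c d)" for d by simp
  have "sum f (words (Suc n)) = sum f (?c 2) + sum f (?c 1) + sum f (?c 0)"
    unfolding e by (subst sum.union_disjoint, (auto simp: fin)[3])+ simp
  then show ?thesis by (simp add: sum.reindex)
qed

context weights
begin

text \<open>The least element \<open>b\<close> of \<open>B\<close> is matched first: the choice of its partner contributes a bracket, and
  it changes none of the remaining factors, since both cardinalities in them drop by one.\<close>

lemma sum_matchings:
  fixes \<alpha> :: "'i \<Rightarrow> int" and \<beta> :: "'b \<Rightarrow> int"
  assumes "finite A" "finite B" "card A = card B" "inj_on \<alpha> A" "inj_on \<beta> B"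
  shows "(\<Sum>f\<in>matchings \<alpha> \<beta> A B.
      q ^ card (matching_crossings \<alpha> \<beta> A f) * t ^ card (records \<alpha> \<beta> A Z f)) =
    (\<Prod>b\<in>B. bracket (if b \<in> Z then t else 1)
      (int (card {i \<in> A. \<alpha> i < \<beta> b}) - int (card {b' \<in> B. \<beta> b' < \<beta> b})))"
  using assms
proof (induction "card B" arbitrary: A B)
  case 0
  then have "A = {}" "B = {}" by auto
  moreover have "matchings \<alpha> \<beta> {} ({} :: 'b set) = {\<lambda>_. undefined}"
    by (auto simp: matchings_def bij_betw_def)
  ultimately show ?case by (simp add: matching_crossings_def records_def)
next
  case (Suc m)
  let ?W = "\<lambda>A f. q ^ card (matching_crossings \<alpha> \<beta> A f) * t ^ card (records \<alpha> \<beta> A Z f)"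
  let ?t = "\<lambda>b. if b \<in> Z then t else 1"
  let ?w = "\<lambda>b. bracket (?t b) (int (card {i \<in> A. \<alpha> i < \<beta> b}) - int (card {b' \<in> B. \<beta> b' < \<beta> b}))"
  have "B \<noteq> {}" using Suc.hyps(2) by auto
  then obtain b where "is_arg_min \<beta> (\<lambda>x. x \<in> B) b"
    using ex_is_arg_min_if_finite[OF \<open>finite B\<close>] by blast
  then have b: "b \<in> B" "\<And>k. k \<in> B \<Longrightarrow> \<not> \<beta> k < \<beta> b"
    by (auto simp: is_arg_min_def)
  have b_less: "\<beta> b < \<beta> k" if "k \<in> B" "k \<noteq> b" for k
    using b(2)[OF that(1)] inj_onD[OF Suc.prems(5), of k b] that b(1) by (cases "\<beta> k = \<beta> b") auto
  define Ab where "Ab = {i \<in> A. \<alpha> i < \<beta> b}"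
  have Ab: "finite Ab" "Ab \<subseteq> A" using Suc.prems by (auto simp: Ab_def)
  let ?I = "SIGMA i:Ab. matchings \<alpha> \<beta> (A - {i}) (B - {b})"
  let ?pre = "\<lambda>f. inv_into A f b"
  have pre: "?pre f \<in> A" "f (?pre f) = b" if "f \<in> matchings \<alpha> \<beta> A B" for f
  proof -
    have "b \<in> f ` A" using that b by (auto simp: matchings_def bij_betw_def)
    then show "?pre f \<in> A" "f (?pre f) = b" by (auto intro: inv_into_into f_inv_into_f)
  qed
  \<comment> \<open>As \<open>b\<close> is the least value, the arc from \<open>i\<close> to
    \<open>b\<close> crosses exactly the arcs starting after \<open>i\<close> and before
    \<open>b\<close>. For \<open>b \<in> Z\<close> it is a record iff no arc starts before
    \<open>i\<close>.\<close>
  have stats: "?W A (f(i := b)) = q ^ card {k \<in> Ab. \<alpha> i < \<alpha> k} *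
      (if \<exists>k\<in>Ab. \<alpha> k < \<alpha> i then 1 else ?t b) * ?W (A - {i}) f"
    if i: "i \<in> Ab" and f: "f \<in> matchings \<alpha> \<beta> (A - {i}) (B - {b})" for i f
  proof -
    have iA: "i \<in> A" "\<alpha> i < \<beta> b" using i by (auto simp: Ab_def)
    have fk: "\<beta> b < \<beta> (f k)" if "k \<in> A" "k \<noteq> i" for k
      using f that b_less by (auto simp: matchings_def PiE_iff)
    have nb: "\<not> \<beta> (f k) < \<beta> b" if "k \<in> A" "k \<noteq> i" for k using fk[OF that] by simp
    have "matching_crossings \<alpha> \<beta> A (f(i := b)) =
        matching_crossings \<alpha> \<beta> (A - {i}) f \<union> Pair i ` {k \<in> Ab. \<alpha> i < \<alpha> k}"
    proof (intro set_eqI)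
      fix p :: "'i \<times> 'i"
      obtain a c where p: "p = (a, c)" by fastforce
      show "p \<in> matching_crossings \<alpha> \<beta> A (f(i := b)) \<longleftrightarrow>
          p \<in> matching_crossings \<alpha> \<beta> (A - {i}) f \<union> Pair i ` {k \<in> Ab. \<alpha> i < \<alpha> k}"
      proof (cases "a = i")
        case True
        then show ?thesis
          using iA fk[of c] by (cases "c = i") (auto simp: p matching_crossings_def Ab_def)
      next
        case False
        then show ?thesis
          using nb[of a] by (cases "c = i") (auto simp: p matching_crossings_def)
      qed
    qed
    moreover have "matching_crossings \<alpha> \<beta> (A - {i}) f \<inter> Pair i ` {k \<in> Ab. \<alpha> i < \<alpha> k} = {}"
      by (auto simp: matching_crossings_def)
    moreover have "finite (matching_crossings \<alpha> \<beta> (A - {i}) f)"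
      using Suc.prems(1) by (auto intro: finite_subset[of _ "A \<times> A"] simp: matching_crossings_def)
    ultimately have 1: "card (matching_crossings \<alpha> \<beta> A (f(i := b))) =
        card (matching_crossings \<alpha> \<beta> (A - {i}) f) + card {k \<in> Ab. \<alpha> i < \<alpha> k}"
      using Ab by (simp add: card_Un_disjoint card_image inj_on_def)
    have ex: "(\<exists>k\<in>Ab. \<alpha> k < \<alpha> i) \<longleftrightarrow> (\<exists>k\<in>A. \<alpha> k < \<alpha> i)"
      using iA by (auto simp: Ab_def)
    have "records \<alpha> \<beta> A Z (f(i := b)) = records \<alpha> \<beta> (A - {i}) Z f \<union>
        (if b \<in> Z \<and> \<not> (\<exists>k\<in>A. \<alpha> k < \<alpha> i) then {i} else {})"
    proof (intro set_eqI)
      fix a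
      show "a \<in> records \<alpha> \<beta> A Z (f(i := b)) \<longleftrightarrow> a \<in> records \<alpha> \<beta> (A - {i}) Z f \<union>
        (if b \<in> Z \<and> \<not> (\<exists>k\<in>A. \<alpha> k < \<alpha> i) then {i} else {})"
      proof (cases "a = i")
        case True
        have "(\<forall>k\<in>A. \<alpha> k < \<alpha> i \<longrightarrow> \<beta> ((f(i := b)) k) < \<beta> b) \<longleftrightarrow> \<not> (\<exists>k\<in>A. \<alpha> k < \<alpha> i)"
          using nb by auto
        then show ?thesis using True iA by (auto simp: records_def)
      next
        case False
        have "(\<forall>k\<in>A. \<alpha> k < \<alpha> a \<longrightarrow> \<beta> ((f(i := b)) k) < \<beta> (f a)) \<longleftrightarrow>
            (\<forall>k\<in>A - {i}. \<alpha> k < \<alpha> a \<longrightarrow> \<beta> (f k) < \<beta> (f a))" if "a \<in> A"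
          using fk[OF that False] by auto
        then show ?thesis
          using False fk[of a] by (cases "a \<in> A") (auto simp: records_def)
      qed
    qed
    moreover have "finite (records \<alpha> \<beta> (A - {i}) Z f)" "i \<notin> records \<alpha> \<beta> (A - {i}) Z f"
      using Suc.prems(1) by (auto simp: records_def)
    ultimately have 2: "card (records \<alpha> \<beta> A Z (f(i := b))) = card (records \<alpha> \<beta> (A - {i}) Z f) +
        (if b \<in> Z \<and> \<not> (\<exists>k\<in>Ab. \<alpha> k < \<alpha> i) then 1 else 0)"
      unfolding ex by simp
    show ?thesis unfolding 1 2 by (auto simp: power_add mult_ac)
  qed
  have "(\<Sum>f\<in>matchings \<alpha> \<beta> A B. ?W A f) = (\<Sum>(i, f)\<in>?I. ?W A (f(i := b)))"
  proof (rule sum.reindex_bij_witness[of _ "\<lambda>(i, f). f(i := b)" "\<lambda>f. (?pre f, restrict f (A - {?pre f}))"])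
    fix f assume f: "f \<in> matchings \<alpha> \<beta> A B"
    have ext: "f x = undefined" if "x \<notin> A" for x
      using f that by (auto simp: matchings_def PiE_iff extensional_def)
    have e: "(restrict f (A - {?pre f}))(?pre f := b) = f"
      using pre[OF f] ext by (auto simp: fun_eq_iff)
    then show "(case (?pre f, restrict f (A - {?pre f})) of (i, f) \<Rightarrow> f(i := b)) = f" by simp
    have "\<alpha> (?pre f) < \<beta> b" using f pre[OF f] by (auto simp: matchings_def)
    then show "(?pre f, restrict f (A - {?pre f})) \<in> ?I"
      using matchings_remove[OF f pre(1)[OF f]] pre[OF f] by (simp add: Ab_def)
    show "(case (?pre f, restrict f (A - {?pre f})) of (i, f) \<Rightarrow> ?W A (f(i := b))) = ?W A f"
      using e by simp
  next
    fix p assume "p \<in> ?I"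
    then obtain i f where p: "p = (i, f)" and i: "i \<in> Ab" and f: "f \<in> matchings \<alpha> \<beta> (A - {i}) (B - {b})"
      by auto
    have m: "f(i := b) \<in> matchings \<alpha> \<beta> A B"
      using i f b by (intro matchings_insert) (auto simp: Ab_def)
    then show "(case p of (i, f) \<Rightarrow> f(i := b)) \<in> matchings \<alpha> \<beta> A B" by (simp add: p)
    have "inj_on (f(i := b)) A" using m by (auto simp: matchings_def bij_betw_def)
    then have pi: "?pre (f(i := b)) = i"
      using inv_into_f_f[of "f(i := b)" A i] i Ab by auto
    have "restrict (f(i := b)) (A - {i}) = f"
      using f by (auto simp: fun_eq_iff matchings_def PiE_iff extensional_def)
    then show "(?pre (case p of (i, f) \<Rightarrow> f(i := b)),
        restrict (case p of (i, f) \<Rightarrow> f(i := b)) (A - {?pre (case p of (i, f) \<Rightarrow> f(i := b))})) = p"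
      by (simp add: p pi)
  qed
  also have "\<dots> = (\<Sum>i\<in>Ab. \<Sum>f\<in>matchings \<alpha> \<beta> (A - {i}) (B - {b}). ?W A (f(i := b)))"
    using Ab Suc.prems by (subst sum.Sigma) auto
  also have "\<dots> = (\<Sum>i\<in>Ab. \<Sum>f\<in>matchings \<alpha> \<beta> (A - {i}) (B - {b}).
      q ^ card {k \<in> Ab. \<alpha> i < \<alpha> k} * (if \<exists>k\<in>Ab. \<alpha> k < \<alpha> i then 1 else ?t b) * ?W (A - {i}) f)"
    by (intro sum.cong refl stats) auto
  also have "\<dots> = (\<Sum>i\<in>Ab. q ^ card {k \<in> Ab. \<alpha> i < \<alpha> k} * (if \<exists>k\<in>Ab. \<alpha> k < \<alpha> i then 1 else ?t b) *
      (\<Prod>b'\<in>B - {b}. ?w b'))"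
  proof (rule sum.cong[OF refl])
    fix i assume i: "i \<in> Ab"
    then have iA: "i \<in> A" "\<alpha> i < \<beta> b" by (auto simp: Ab_def)
    have "int (card {a \<in> A - {i}. \<alpha> a < \<beta> b'}) - int (card {b'' \<in> B - {b}. \<beta> b'' < \<beta> b'}) =
        int (card {i \<in> A. \<alpha> i < \<beta> b'}) - int (card {b'' \<in> B. \<beta> b'' < \<beta> b'})" if b': "b' \<in> B - {b}" for b'
    proof -
      have "\<beta> b < \<beta> b'" using b_less b' by auto
      then have 1: "{a \<in> A - {i}. \<alpha> a < \<beta> b'} = {a \<in> A. \<alpha> a < \<beta> b'} - {i}" "i \<in> {a \<in> A. \<alpha> a < \<beta> b'}"
        "{b'' \<in> B - {b}. \<beta> b'' < \<beta> b'} = {b'' \<in> B. \<beta> b'' < \<beta> b'} - {b}" "b \<in> {b'' \<in> B. \<beta> b'' < \<beta> b'}"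
        using iA b by auto
      have "0 < card {a \<in> A. \<alpha> a < \<beta> b'}" "0 < card {b'' \<in> B. \<beta> b'' < \<beta> b'}"
        using 1 Suc.prems(1,2) by (auto simp: card_gt_0_iff)
      then show ?thesis
        unfolding 1 card_Diff_singleton[OF 1(2)] card_Diff_singleton[OF 1(4)] by linarith
    qed
    moreover have "(\<Sum>f\<in>matchings \<alpha> \<beta> (A - {i}) (B - {b}). ?W (A - {i}) f) =
      (\<Prod>b'\<in>B - {b}. bracket (?t b')
        (int (card {a \<in> A - {i}. \<alpha> a < \<beta> b'}) - int (card {b'' \<in> B - {b}. \<beta> b'' < \<beta> b'})))"
      using Suc.prems Suc.hyps(2) iA b by (intro Suc.hyps(1)) (auto intro: inj_on_diff)
    ultimately show "(\<Sum>f\<in>matchings \<alpha> \<beta> (A - {i}) (B - {b}).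
      q ^ card {k \<in> Ab. \<alpha> i < \<alpha> k} * (if \<exists>k\<in>Ab. \<alpha> k < \<alpha> i then 1 else ?t b) * ?W (A - {i}) f) =
      q ^ card {k \<in> Ab. \<alpha> i < \<alpha> k} * (if \<exists>k\<in>Ab. \<alpha> k < \<alpha> i then 1 else ?t b) *
      (\<Prod>b'\<in>B - {b}. ?w b')"
      by (simp add: sum_distrib_left[symmetric])
  qed
  also have "\<dots> = bracket (?t b) (int (card Ab)) * (\<Prod>b'\<in>B - {b}. ?w b')"
    using Ab Suc.prems(4) sum_bracket[of Ab \<alpha> "?t b"]
    by (simp only: sum_distrib_right[symmetric] inj_on_subset)
  also have "\<dots> = (\<Prod>b\<in>B. bracket (?t b)
        (int (card {i \<in> A. \<alpha> i < \<beta> b}) - int (card {b'' \<in> B. \<beta> b'' < \<beta> b})))"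
  proof -
    have "{b'' \<in> B. \<beta> b'' < \<beta> b} = {}" using b by auto
    then have e: "int (card Ab) = int (card {i \<in> A. \<alpha> i < \<beta> b}) - int (card {b'' \<in> B. \<beta> b'' < \<beta> b})"
      by (simp only: Ab_def card.empty)
    show ?thesis
      unfolding e using Suc.prems(2) b(1) by (rule prod.remove[symmetric])
  qed
  finally show ?case .
qed

section \<open>Expanding the arc operators over words of values\<close>

definition step_weight :: "int \<Rightarrow> nat \<Rightarrow> nat \<Rightarrow> int \<Rightarrow> int \<Rightarrow> int \<Rightarrow> 'a" where
  "step_weight r c d p n l = (if c = 1 then q ^ nat l else 1) *
     (if d = 2 then bracket (if n = 0 then z else 1) p
      else if d = 1 then q ^ nat p
      else bracket (if n = r then y else 1) (l + 1))"

text \<open>A point acts as an argument before it acts as a value, hence \<open>Suc i\<close> for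
  \<open>w\<close> but \<open>i\<close> for \<open>u\<close>. In \<open>u\<close>, the letter 2
  closes a positive upper arc, 1 closes a negative one, and 0 opens a lower arc.\<close>

definition local_weight :: "int \<Rightarrow> word \<Rightarrow> word \<Rightarrow> int \<Rightarrow> int \<Rightarrow> int \<Rightarrow> nat \<Rightarrow> 'a" where
  "local_weight r w u p n l i = step_weight r (w ! i) (u ! i)
     (p + int (count_list (take (Suc i) w) 2) - int (count_list (take i u) 2))
     (n - int (count_list (take i u) 1))
     (l + int (count_list (take i u) 0) - int (count_list (take (Suc i) w) 0))"

text \<open>Choosing one summand of \<open>arc_op\<close> at each point spells a word
  \<open>u\<close>. The indicator expresses that finally no arc is left open.\<close>

lemma arc_value_eq_sum:
  assumes "set w \<subseteq> {0, 1, 2}"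
  shows "arc_value r w p n l = (\<Sum>u\<in>words (length w).
    (if p + int (count_list w 2) = int (count_list u 2) \<and> n = int (count_list u 1) \<and>
        l + int (count_list u 0) = int (count_list w 0) then 1 else 0) *
    (\<Prod>i<length w. local_weight r w u p n l i))"
  using assms
proof (induction w arbitrary: p n l)
  case Nil
  have "words 0 = {[]}" by (auto simp: words_def)
  then show ?case by simp
next
  case (Cons c w)
  define fin where "fin w u p n l = (if p + int (count_list w 2) = int (count_list u 2) \<and> n = int (count_list u 1) \<and>
        l + int (count_list u 0) = int (count_list w 0) then 1 else 0 :: 'a)" for w u :: word and p n l
  define p' l' where "p' = p + (if c = 2 then 1 else 0)" and "l' = l - (if c = 0 then 1 else 0)"
  define k where "k = (if c = 1 then q ^ nat l else 1)"
  have lw_Suc: "local_weight r (c # w) (d # u) p n l (Suc i) =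
      local_weight r w u (p' - (if d = 2 then 1 else 0)) (n - (if d = 1 then 1 else 0)) (l' + (if d = 0 then 1 else 0)) i"
    for d u i
  proof -
    have P: "p + int (count_list (take (Suc (Suc i)) (c # w)) 2) - int (count_list (take (Suc i) (d # u)) 2) =
        p' - (if d = 2 then 1 else 0) + int (count_list (take (Suc i) w) 2) - int (count_list (take i u) 2)"
      by (simp add: p'_def)
    have N: "n - int (count_list (take (Suc i) (d # u)) 1) =
        n - (if d = 1 then 1 else 0) - int (count_list (take i u) 1)"
      by simp
    have L: "l + int (count_list (take (Suc i) (d # u)) 0) - int (count_list (take (Suc (Suc i)) (c # w)) 0) =
        l' + (if d = 0 then 1 else 0) + int (count_list (take i u) 0) - int (count_list (take (Suc i) w) 0)"
      by (simp add: l'_def)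
    show ?thesis unfolding local_weight_def P N L nth_Cons_Suc ..
  qed
  have lw_0: "local_weight r (c # w) (d # u) p n l 0 = step_weight r c d p' n l'" for d u
  proof -
    have "p + int (count_list (take (Suc 0) (c # w)) 2) - int (count_list (take 0 (d # u)) 2) = p'"
      "l + int (count_list (take 0 (d # u)) 0) - int (count_list (take (Suc 0) (c # w)) 0) = l'"
      by (simp_all add: p'_def l'_def)
    then show ?thesis unfolding local_weight_def by simp
  qed
  have k: "step_weight r c d p' n l' = k * (if d = 2 then bracket (if n = 0 then z else 1) p'
         else if d = 1 then q ^ nat p' else bracket (if n = r then y else 1) (l' + 1))" for d
    unfolding step_weight_def k_def l'_def by simp
  have fin: "fin (c # w) (d # u) p n l = fin w u (p' - (if d = 2 then 1 else 0)) (n - (if d = 1 then 1 else 0)) (l' + (if d = 0 then 1 else 0))" for d u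
    unfolding fin_def p'_def l'_def by auto
  have IH: "arc_value r w p n l = (\<Sum>u\<in>words (length w). fin w u p n l * (\<Prod>i<length w. local_weight r w u p n l i))" for p n l
    using Cons unfolding fin_def by simp
  have "arc_value r (c # w) p n l = k * arc_op r (arc_value r w) p' n l'"
    using Cons.prems unfolding p'_def l'_def k_def by auto
  also have "\<dots> = (\<Sum>u\<in>words (length (c # w)). fin (c # w) u p n l *
      (\<Prod>i<length (c # w). local_weight r (c # w) u p n l i))"
  proof -
    let ?t = "\<lambda>u. fin (c # w) u p n l * (\<Prod>i<length (c # w). local_weight r (c # w) u p n l i)"
    have t: "?t (d # u) = step_weight r c d p' n l' * (fin w u (p' - (if d = 2 then 1 else 0)) (n - (if d = 1 then 1 else 0)) (l' + (if d = 0 then 1 else 0)) *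
        (\<Prod>i<length w. local_weight r w u (p' - (if d = 2 then 1 else 0)) (n - (if d = 1 then 1 else 0)) (l' + (if d = 0 then 1 else 0)) i))" for d u
      unfolding fin list.size(4) add_0_right add_Suc_right prod.lessThan_Suc_shift lw_Suc lw_0
      by (simp only: mult.left_commute)
    have "(\<Sum>u\<in>words (length w). ?t (d # u)) = step_weight r c d p' n l' *
        arc_value r w (p' - (if d = 2 then 1 else 0)) (n - (if d = 1 then 1 else 0)) (l' + (if d = 0 then 1 else 0))" for d
      unfolding t IH by (rule sum_distrib_left[symmetric])
    then have "(\<Sum>u\<in>words (length (c # w)). ?t u) =
      step_weight r c 2 p' n l' * arc_value r w (p' - 1) n l' +
      step_weight r c 1 p' n l' * arc_value r w p' (n - 1) l' +
      step_weight r c 0 p' n l' * arc_value r w p' n (l' + 1)"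
      unfolding list.size(4) add_0_right add_Suc_right sum_words_Suc by simp
    then show ?thesis
      unfolding arc_op_def k by (simp add: algebra_simps)
  qed
  finally show ?case unfolding fin_def .
qed

end

section \<open>Splitting arrangements into matchings\<close>

definition positions :: "word \<Rightarrow> nat \<Rightarrow> nat set" where
  "positions w c = {i. i < length w \<and> w ! i = c}"

lemma finite_positions [simp]: "finite (positions w c)"
  by (simp add: positions_def)

lemma card_positions: "card (positions w c) = count_list w c"
  by (simp add: positions_def count_list_card)

lemma positions_Un:
  assumes "set w \<subseteq> {0, 1, 2}"
  shows "positions w 2 \<union> positions w 0 \<union> positions w 1 = {..<length w}"
proof (rule set_eqI)
  fix x
  have "x < length w \<Longrightarrow> w ! x \<in> {0, 1, 2}" using assms nth_mem by blast
  then show "x \<in> positions w 2 \<union> positions w 0 \<union> positions w 1 \<longleftrightarrow> x \<in> {..<length w}"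
    by (auto simp: positions_def)
qed

lemma positions_disjoint: "c \<noteq> d \<Longrightarrow> positions w c \<inter> positions w d = {}"
  by (auto simp: positions_def)

lemma count_list_take:
  "i \<le> length w \<Longrightarrow> count_list (take i w) c = card {k \<in> positions w c. k < i}"
  unfolding count_list_card by (rule arg_cong[where f = card]) (auto simp: positions_def)

text \<open>Absolute values of a signed permutation, in terms of positions; the signs are recorded
  by the 1's of \<open>w\<close>. Monotonicity on the 1's is the condition defining
  \<open>AS\<close>.\<close>

definition arrangements :: "word \<Rightarrow> (nat \<Rightarrow> nat) set" where
  "arrangements w = {\<pi> \<in> {..<length w} \<rightarrow>\<^sub>E {..<length w}.
     bij_betw \<pi> {..<length w} {..<length w} \<and>
     (\<forall>i\<in>positions w 2. i \<le> \<pi> i) \<and> (\<forall>i\<in>positions w 0. \<pi> i < i) \<and>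
     strict_mono_on (positions w 1) \<pi>}"

text \<open>The arc of \<open>k\<close>, which starts further right, is never negative: negative
  arcs start left of all points of \<open>X\<close> and are nested among themselves.\<close>

definition upper_crossings :: "word \<Rightarrow> (nat \<Rightarrow> nat) \<Rightarrow> (nat \<times> nat) set" where
  "upper_crossings w \<pi> = {(i, k). i < length w \<and> k \<in> positions w 2 \<and> k \<le> \<pi> i \<and> \<pi> i < \<pi> k \<and>
     (w ! i = 2 \<and> i < k \<or> w ! i = 1)}"

definition lower_crossings :: "word \<Rightarrow> (nat \<Rightarrow> nat) \<Rightarrow> (nat \<times> nat) set" where
  "lower_crossings w \<pi> = {(i, k). i < length w \<and> k \<in> positions w 0 \<and> \<pi> k < i \<and> i < k \<and>
     (w ! i = 0 \<and> \<pi> i < \<pi> k \<or> w ! i = 1)}"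

definition lr_maxima :: "word \<Rightarrow> (nat \<Rightarrow> nat) \<Rightarrow> nat set" where
  "lr_maxima w \<pi> = {k \<in> positions w 2. \<forall>i<length w. i < k \<or> w ! i = 1 \<longrightarrow> \<pi> i < \<pi> k}"

definition rl_minima :: "word \<Rightarrow> (nat \<Rightarrow> nat) \<Rightarrow> nat set" where
  "rl_minima w \<pi> = {k \<in> positions w 0. \<forall>i<length w. k < i \<or> w ! i = 1 \<longrightarrow> \<pi> k < \<pi> i}"

text \<open>This removes all freedom from the negative arcs: the set of their end points determines
  the matching.\<close>

lemma strict_mono_on_bij_unique:
  fixes f g :: "nat \<Rightarrow> nat"
  assumes "finite A" "strict_mono_on A f" "strict_mono_on A g" "f ` A = g ` A" "i \<in> A"
  shows "f i = g i"
proof -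
  have m: "sorted_wrt (<) (map h (sorted_list_of_set A))" if "strict_mono_on A h" for h :: "nat \<Rightarrow> nat"
    unfolding sorted_wrt_map
    by (rule sorted_wrt_mono_rel[OF _ strict_sorted_list_of_set])
      (use that assms(1) in \<open>auto simp: strict_mono_on_def\<close>)
  have "map f (sorted_list_of_set A) = map g (sorted_list_of_set A)"
    using m[OF assms(2)] m[OF assms(3)] assms(1,4) by (intro strict_sorted_equal) auto
  then show ?thesis using assms(1,5) by simp
qed

lemma ex_strict_mono_on_bij:
  fixes A B :: "nat set"
  assumes "finite A" "finite B" "card A = card B"
  obtains h where "bij_betw h A B" "strict_mono_on A h"
proof -
  obtain f where f: "bij_betw f {..<card A} A" "strict_mono_on {..<card A} f"
    by (rule ex_bij_betw_strict_mono_card[OF assms(1)])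
  obtain g where g: "bij_betw g {..<card B} B" "strict_mono_on {..<card B} g"
    by (rule ex_bij_betw_strict_mono_card[OF assms(2)])
  define f' where "f' = inv_into {..<card A} f"
  have f': "bij_betw f' A {..<card A}" unfolding f'_def by (rule bij_betw_inv_into[OF f(1)])
  have "strict_mono_on A f'"
  proof (rule strict_mono_onI)
    fix a b assume ab: "a \<in> A" "b \<in> A" "a < b"
    have "f (f' a) = a" "f (f' b) = b"
      using ab f(1) by (auto simp: f'_def bij_betw_def f_inv_into_f)
    moreover have "f' a \<in> {..<card A}" "f' b \<in> {..<card A}"
      using f' ab by (auto dest: bij_betwE)
    ultimately show "f' a < f' b"
      using ab f(2) strict_mono_on_less[of "{..<card A}" f "f' a" "f' b"] by metis
  qed
  then have "strict_mono_on A (g \<circ> f')"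
    using g(2) bij_betwE[OF f'] assms(3) by (simp add: strict_mono_on_def)
  moreover have "bij_betw (g \<circ> f') A B"
    using f' g(1) assms(3) by (intro bij_betw_trans) auto
  ultimately show ?thesis using that by blast
qed

text \<open>The word \<open>u\<close> gives each point, as a value, the letter of its
  preimage.\<close>

definition arrangements_to :: "word \<Rightarrow> word \<Rightarrow> (nat \<Rightarrow> nat) set" where
  "arrangements_to w u = {\<pi> \<in> arrangements w. \<forall>i<length w. u ! \<pi> i = w ! i}"

lemma finite_arrangements [simp]: "finite (arrangements w)"
  unfolding arrangements_def
  by (rule finite_subset[OF _ finite_PiE[of "{..<length w}" "\<lambda>_. {..<length w}"]]) auto

lemma arrangements_toD:
  assumes "\<pi> \<in> arrangements_to w u" "length u = length w"
  shows "bij_betw \<pi> (positions w c) (positions u c)"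
proof -
  have b: "bij_betw \<pi> {..<length w} {..<length w}" and u: "\<forall>i<length w. u ! \<pi> i = w ! i"
    using assms(1) by (auto simp: arrangements_to_def arrangements_def)
  have "\<pi> ` positions w c = positions u c"
  proof
    show "\<pi> ` positions w c \<subseteq> positions u c"
      using b u assms(2) by (auto simp: positions_def bij_betw_def)
    show "positions u c \<subseteq> \<pi> ` positions w c"
    proof
      fix b assume b': "b \<in> positions u c"
      then obtain i where "i < length w" "\<pi> i = b"
        using b assms(2) unfolding positions_def bij_betw_def by (metis (no_types, lifting) imageE lessThan_iff mem_Collect_eq)
      then show "b \<in> \<pi> ` positions w c" using u b' by (auto simp: positions_def)
    qed
  qed
  moreover have "inj_on \<pi> (positions w c)"
    using b by (auto simp: bij_betw_def positions_def inj_on_def)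
  ultimately show ?thesis by (simp add: bij_betw_def)
qed

lemma sum_arrangements_group:
  fixes h :: "(nat \<Rightarrow> nat) \<Rightarrow> 'a::comm_monoid_add"
  assumes "set w \<subseteq> {0, 1, 2}"
  shows "(\<Sum>\<pi>\<in>arrangements w. h \<pi>) = (\<Sum>u\<in>words (length w). \<Sum>\<pi>\<in>arrangements_to w u. h \<pi>)"
proof -
  let ?n = "length w"
  define U where "U \<pi> = map (\<lambda>b. w ! inv_into {..<?n} \<pi> b) [0..<?n]" for \<pi>
  have b: "bij_betw \<pi> {..<?n} {..<?n}" if "\<pi> \<in> arrangements w" for \<pi>
    using that by (simp add: arrangements_def)
  have inv: "inv_into {..<?n} \<pi> b < ?n" if "\<pi> \<in> arrangements w" "b < ?n" for \<pi> b
    using bij_betw_inv_into[OF b[OF that(1)]] that(2) by (auto dest: bij_betwE)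
  have 1: "U ` arrangements w \<subseteq> words ?n"
  proof
    fix u assume "u \<in> U ` arrangements w"
    then obtain \<pi> where "u = U \<pi>" "\<pi> \<in> arrangements w" by blast
    then have "set u \<subseteq> set w" using inv by (auto simp: U_def)
    then show "u \<in> words ?n" using assms \<open>u = U \<pi>\<close> by (auto simp: words_def U_def)
  qed
  have 2: "{\<pi> \<in> arrangements w. U \<pi> = u} = arrangements_to w u" if "u \<in> words ?n" for u
  proof -
    have "U \<pi> = u \<longleftrightarrow> (\<forall>i<?n. u ! \<pi> i = w ! i)" if p: "\<pi> \<in> arrangements w" for \<pi>
    proof
      assume U: "U \<pi> = u"
      show "\<forall>i<?n. u ! \<pi> i = w ! i"
      proof (intro allI impI)
        fix i assume i: "i < ?n"
        then have "\<pi> i < ?n" using b[OF p] by (auto dest: bij_betwE)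
        then show "u ! \<pi> i = w ! i"
          using b[OF p] i by (simp add: U[symmetric] U_def bij_betw_def inv_into_f_f)
      qed
    next
      assume a: "\<forall>i<?n. u ! \<pi> i = w ! i"
      show "U \<pi> = u"
      proof (rule nth_equalityI)
        show "length (U \<pi>) = length u" using \<open>u \<in> words ?n\<close> by (simp add: U_def words_def)
        fix i assume "i < length (U \<pi>)"
        then have i: "i < ?n" by (simp add: U_def)
        have "\<pi> (inv_into {..<?n} \<pi> i) = i"
          using b[OF p] i by (auto simp: bij_betw_def intro!: f_inv_into_f)
        then have "u ! i = w ! inv_into {..<?n} \<pi> i" using a inv[OF p i] by metis
        then show "U \<pi> ! i = u ! i" using i by (simp add: U_def)
      qed
    qed
    then show ?thesis by (auto simp: arrangements_to_def)
  qed
  show ?thesis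
    using sum.group[OF finite_arrangements finite_words 1, of h] by (simp add: 2 cong: sum.cong)
qed

text \<open>Doubling separates arguments from values, so that an upper arc may be a loop while a lower arc may
  not; the sign reverses the reading direction for lower arcs, whose closing points become openings.\<close>

abbreviation upper_key :: "nat \<Rightarrow> int" where "upper_key i \<equiv> 2 * int i"
abbreviation upper_key' :: "nat \<Rightarrow> int" where "upper_key' b \<equiv> 2 * int b + 1"
abbreviation lower_key :: "nat \<Rightarrow> int" where "lower_key i \<equiv> - (2 * int i)"
abbreviation lower_key' :: "nat \<Rightarrow> int" where "lower_key' b \<equiv> - (2 * int b + 1)"

context
  fixes w u :: word
  assumes w: "set w \<subseteq> {0, 1, 2}" and u: "u \<in> words (length w)"
begin

abbreviation (input) "M2 \<equiv> matchings upper_key upper_key' (positions w 2) (positions u 2)"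
abbreviation (input) "M0 \<equiv> matchings lower_key lower_key' (positions w 0) (positions u 0)"

lemma word_length: "length u = length w" using u by (simp add: words_def)

lemma word_letters: "k < length w \<Longrightarrow> w ! k = 0 \<or> w ! k = 1 \<or> w ! k = 2"
  "k < length w \<Longrightarrow> u ! k = 0 \<or> u ! k = 1 \<or> u ! k = 2"
  using letter_cases[of w k] letter_cases[of u k] w u by (auto simp: is_word_def words_def)

lemma split_arrangement:
  assumes "\<pi> \<in> arrangements_to w u"
  shows "restrict \<pi> (positions w 2) \<in> M2" "restrict \<pi> (positions w 0) \<in> M0"
proof -
  have "bij_betw (restrict \<pi> (positions w c)) (positions w c) (positions u c)" for c
    using arrangements_toD[OF assms word_length, of c] by (rule bij_betw_cong[THEN iffD1, rotated]) auto
  then show "restrict \<pi> (positions w 2) \<in> M2" "restrict \<pi> (positions w 0) \<in> M0"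
    using assms by (auto simp: matchings_def arrangements_to_def arrangements_def bij_betw_def)
qed

lemma join_arrangement:
  assumes f: "f \<in> M2" and g: "g \<in> M0"
    and h: "bij_betw h (positions w 1) (positions u 1)" "strict_mono_on (positions w 1) h"
  defines "\<pi> \<equiv> \<lambda>i. if i \<in> positions w 2 then f i else if i \<in> positions w 0 then g i
      else if i \<in> positions w 1 then h i else undefined"
  shows "\<pi> \<in> arrangements_to w u"
proof -
  let ?n = "length w"
  note d = positions_disjoint
  have un: "positions w 2 \<union> positions w 0 \<union> positions w 1 = {..<?n}"
    "positions u 2 \<union> positions u 0 \<union> positions u 1 = {..<?n}"
    using w u positions_Un[of w] positions_Un[of u] by (simp_all add: words_def)
  have f': "f \<in> positions w 2 \<rightarrow>\<^sub>E positions u 2" "bij_betw f (positions w 2) (positions u 2)"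
      "\<forall>i\<in>positions w 2. i \<le> f i"
    and g': "g \<in> positions w 0 \<rightarrow>\<^sub>E positions u 0" "bij_betw g (positions w 0) (positions u 0)"
      "\<forall>i\<in>positions w 0. g i < i"
    using f g by (auto simp: matchings_def)
  have \<pi>2: "\<pi> i = f i" if "i \<in> positions w 2" for i using that by (simp add: \<pi>_def)
  have \<pi>0: "\<pi> i = g i" if "i \<in> positions w 0" for i
    using that d[of 0 2 w] by (auto simp: \<pi>_def)
  have \<pi>1: "\<pi> i = h i" if "i \<in> positions w 1" for i
    using that d[of 1 2 w] d[of 1 0 w] by (auto simp: \<pi>_def)
  have b2: "bij_betw \<pi> (positions w 2) (positions u 2)"
    using f'(2) by (rule bij_betw_cong[THEN iffD1, rotated]) (simp add: \<pi>2)
  have b0: "bij_betw \<pi> (positions w 0) (positions u 0)"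
    using g'(2) by (rule bij_betw_cong[THEN iffD1, rotated]) (simp add: \<pi>0)
  have b1: "bij_betw \<pi> (positions w 1) (positions u 1)"
    using h(1) by (rule bij_betw_cong[THEN iffD1, rotated]) (simp add: \<pi>1)
  have "bij_betw \<pi> (positions w 2 \<union> positions w 0 \<union> positions w 1) (positions u 2 \<union> positions u 0 \<union> positions u 1)"
    using d[of 2 0 u] d[of 2 1 u] d[of 0 1 u] by (intro bij_betw_combine b2 b0 b1) auto
  then have b: "bij_betw \<pi> {..<?n} {..<?n}" unfolding un .
  have ext: "\<pi> i = undefined" if "\<not> i < ?n" for i
    using that un by (auto simp: \<pi>_def positions_def)
  have "\<pi> \<in> {..<?n} \<rightarrow>\<^sub>E {..<?n}"
    using b ext by (auto simp: PiE_iff extensional_def bij_betw_def)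
  moreover have "strict_mono_on (positions w 1) \<pi>"
    using h(2) by (simp add: strict_mono_on_def \<pi>1)
  ultimately have "\<pi> \<in> arrangements w"
    using b f'(3) g'(3) \<pi>2 \<pi>0 by (simp add: arrangements_def)
  moreover have "u ! \<pi> i = w ! i" if "i < ?n" for i
  proof -
    have "i \<in> positions w (w ! i)" using that by (simp add: positions_def)
    moreover have "w ! i = 2 \<or> w ! i = 0 \<or> w ! i = 1" using word_letters that by blast
    ultimately have "\<pi> i \<in> positions u (w ! i)" using b2 b0 b1 by (auto dest: bij_betwE)
    then show ?thesis by (simp add: positions_def)
  qed
  ultimately show ?thesis by (simp add: arrangements_to_def)
qed

text \<open>A negative arc ending at \<open>t\<close> crosses precisely the positive upper arcs open
  at \<open>t\<close>: those started at or before \<open>t\<close> less those ended before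
  \<open>t\<close>. This number depends on the two words only.\<close>

lemma card_upper_crossings:
  assumes \<pi>: "\<pi> \<in> arrangements_to w u"
  shows "card (upper_crossings w \<pi>) =
    card (matching_crossings upper_key upper_key' (positions w 2) (restrict \<pi> (positions w 2))) +
    (\<Sum>t\<in>positions u 1. nat (int (card {k \<in> positions w 2. k \<le> t}) - int (card {b \<in> positions u 2. b < t})))"
proof -
  let ?X = "matching_crossings upper_key upper_key' (positions w 2) (restrict \<pi> (positions w 2))"
  let ?Y = "SIGMA i:positions w 1. {k \<in> positions w 2. k \<le> \<pi> i \<and> \<pi> i < \<pi> k}"
  have "upper_crossings w \<pi> = ?X \<union> ?Y"
    by (auto simp: upper_crossings_def matching_crossings_def positions_def)
  moreover have "?X \<inter> ?Y = {}" by (auto simp: matching_crossings_def positions_def)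
  moreover have "finite ?X"
    by (rule finite_subset[of _ "positions w 2 \<times> positions w 2"]) (auto simp: matching_crossings_def)
  ultimately have "card (upper_crossings w \<pi>) = card ?X + card ?Y"
    by (simp add: card_Un_disjoint)
  also have "card ?Y = (\<Sum>i\<in>positions w 1. card {k \<in> positions w 2. k \<le> \<pi> i \<and> \<pi> i < \<pi> k})"
    by simp
  also have "\<dots> = (\<Sum>t\<in>positions u 1. card {k \<in> positions w 2. k \<le> t \<and> t < \<pi> k})"
    using arrangements_toD[OF \<pi> word_length, of 1] by (rule sum.reindex_bij_betw)
  also have "\<dots> = (\<Sum>t\<in>positions u 1. nat (int (card {k \<in> positions w 2. k \<le> t}) - int (card {b \<in> positions u 2. b < t})))"
  proof (rule sum.cong[OF refl])
    fix t assume t: "t \<in> positions u 1"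
    have b: "bij_betw \<pi> (positions w 2) (positions u 2)" by (rule arrangements_toD[OF \<pi> word_length])
    have le: "k \<le> \<pi> k" if "k \<in> positions w 2" for k
      using \<pi> that by (auto simp: arrangements_to_def arrangements_def)
    have ne: "b \<noteq> t" if "b \<in> positions u 2" for b using t that by (auto simp: positions_def)
    have im: "\<pi> ` {k \<in> positions w 2. \<pi> k < t} = {b \<in> positions u 2. b < t}"
      using b by (auto simp: bij_betw_def)
    have "inj_on \<pi> {k \<in> positions w 2. \<pi> k < t}"
      by (rule inj_on_subset[OF bij_betw_imp_inj_on[OF b]]) auto
    then have c: "card {k \<in> positions w 2. \<pi> k < t} = card {b \<in> positions u 2. b < t}"
      unfolding im[symmetric] by (rule card_image[symmetric])
    have "\<pi> k \<in> positions u 2" if "k \<in> positions w 2" for k using b that by (auto dest: bij_betwE)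
    then have "{k \<in> positions w 2. k \<le> t} = {k \<in> positions w 2. k \<le> t \<and> t < \<pi> k} \<union> {k \<in> positions w 2. \<pi> k < t}"
      using le ne by (force simp: not_less le_less)
    moreover have "card ({k \<in> positions w 2. k \<le> t \<and> t < \<pi> k} \<union> {k \<in> positions w 2. \<pi> k < t}) =
        card {k \<in> positions w 2. k \<le> t \<and> t < \<pi> k} + card {k \<in> positions w 2. \<pi> k < t}"
      by (intro card_Un_disjoint) auto
    ultimately show "card {k \<in> positions w 2. k \<le> t \<and> t < \<pi> k} =
        nat (int (card {k \<in> positions w 2. k \<le> t}) - int (card {b \<in> positions u 2. b < t}))"
      using c by simp
  qed
  finally show ?thesis .
qed

text \<open>Likewise a negative lower arc ending at \<open>i\<close> crosses the lower arcs that
  span \<open>i\<close>, whose number is determined by the words.\<close>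

lemma card_lower_crossings:
  assumes \<pi>: "\<pi> \<in> arrangements_to w u"
  shows "card (lower_crossings w \<pi>) =
    card (matching_crossings lower_key lower_key' (positions w 0) (restrict \<pi> (positions w 0))) +
    (\<Sum>i\<in>positions w 1. nat (int (card {b \<in> positions u 0. b < i}) - int (card {k \<in> positions w 0. k \<le> i})))"
proof -
  let ?X = "matching_crossings lower_key lower_key' (positions w 0) (restrict \<pi> (positions w 0))"
  let ?Y = "SIGMA i:positions w 1. {k \<in> positions w 0. \<pi> k < i \<and> i < k}"
  \<comment> \<open>Reading from right to left exchanges the two arcs of a crossing.\<close>
  have "lower_crossings w \<pi> = prod.swap ` ?X \<union> ?Y"
    by (auto simp: lower_crossings_def matching_crossings_def positions_def image_iff)
  moreover have "prod.swap ` ?X \<inter> ?Y = {}" by (auto simp: matching_crossings_def positions_def)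
  moreover have "finite ?X"
    by (rule finite_subset[of _ "positions w 0 \<times> positions w 0"]) (auto simp: matching_crossings_def)
  ultimately have "card (lower_crossings w \<pi>) = card (prod.swap ` ?X) + card ?Y"
    by (simp add: card_Un_disjoint)
  also have "card (prod.swap ` ?X) = card ?X" by (rule card_image) (auto simp: inj_on_def)
  also have "card ?Y = (\<Sum>i\<in>positions w 1. card {k \<in> positions w 0. \<pi> k < i \<and> i < k})"
    by simp
  also have "\<dots> = (\<Sum>i\<in>positions w 1. nat (int (card {b \<in> positions u 0. b < i}) - int (card {k \<in> positions w 0. k \<le> i})))"
  proof (rule sum.cong[OF refl])
    fix t assume t: "t \<in> positions w 1"
    have b: "bij_betw \<pi> (positions w 0) (positions u 0)" by (rule arrangements_toD[OF \<pi> word_length])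
    have le: "\<pi> k < k" if "k \<in> positions w 0" for k
      using \<pi> that by (auto simp: arrangements_to_def arrangements_def)
    have ne: "k \<noteq> t" if "k \<in> positions w 0" for k using t that by (auto simp: positions_def)
    have im: "\<pi> ` {k \<in> positions w 0. \<pi> k < t} = {b \<in> positions u 0. b < t}"
      using b by (auto simp: bij_betw_def)
    have "inj_on \<pi> {k \<in> positions w 0. \<pi> k < t}"
      by (rule inj_on_subset[OF bij_betw_imp_inj_on[OF b]]) auto
    then have c: "card {k \<in> positions w 0. \<pi> k < t} = card {b \<in> positions u 0. b < t}"
      unfolding im[symmetric] by (rule card_image[symmetric])
    have "{k \<in> positions w 0. \<pi> k < t} = {k \<in> positions w 0. \<pi> k < t \<and> t < k} \<union> {k \<in> positions w 0. k \<le> t}"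
      using le ne by force
    moreover have "card ({k \<in> positions w 0. \<pi> k < t \<and> t < k} \<union> {k \<in> positions w 0. k \<le> t}) =
        card {k \<in> positions w 0. \<pi> k < t \<and> t < k} + card {k \<in> positions w 0. k \<le> t}"
      by (intro card_Un_disjoint) auto
    ultimately show "card {k \<in> positions w 0. \<pi> k < t \<and> t < k} =
        nat (int (card {b \<in> positions u 0. b < t}) - int (card {k \<in> positions w 0. k \<le> t}))"
      using c by simp
  qed
  finally show ?thesis .
qed

text \<open>An earlier position \<open>i\<close> with letter 0 is no competitor, as \<pi> i < i < k
  \<le> \<pi> k. There remain the other 2's, compared by \<open>records\<close>, and the 1's, whose
  values define the set of admissible points.\<close>

lemma lr_maxima_eq:
  assumes \<pi>: "\<pi> \<in> arrangements_to w u"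
  shows "lr_maxima w \<pi> = records upper_key upper_key' (positions w 2) {b. \<forall>t\<in>positions u 1. t < b}
    (restrict \<pi> (positions w 2))"
proof -
  have b: "\<pi> ` positions w 1 = positions u 1"
    using arrangements_toD[OF \<pi> word_length, of 1] by (simp add: bij_betw_def)
  have 2: "k \<le> \<pi> k" if "k \<in> positions w 2" for k
    using \<pi> that by (auto simp: arrangements_to_def arrangements_def)
  have 0: "\<pi> k < k" if "k \<in> positions w 0" for k
    using \<pi> that by (auto simp: arrangements_to_def arrangements_def)
  have "(\<forall>i<length w. i < k \<or> w ! i = 1 \<longrightarrow> \<pi> i < \<pi> k) \<longleftrightarrow>
      (\<forall>t\<in>positions u 1. t < \<pi> k) \<and> (\<forall>i\<in>positions w 2. i < k \<longrightarrow> \<pi> i < \<pi> k)" if k: "k \<in> positions w 2" for k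
  proof -
    have "\<pi> i < \<pi> k" if "i < length w" "i < k" "w ! i = 0" for i
      using that 2[OF k] 0[of i] by (auto simp: positions_def)
    then have "(i < k \<or> w ! i = 1 \<longrightarrow> \<pi> i < \<pi> k) \<longleftrightarrow>
        (w ! i = 1 \<longrightarrow> \<pi> i < \<pi> k) \<and> (w ! i = 2 \<longrightarrow> i < k \<longrightarrow> \<pi> i < \<pi> k)" if "i < length w" for i
      using word_letters(1)[OF that] that by auto
    moreover have "(\<forall>t\<in>positions u 1. t < \<pi> k) \<longleftrightarrow> (\<forall>i<length w. w ! i = 1 \<longrightarrow> \<pi> i < \<pi> k)"
      unfolding b[symmetric] by (auto simp: positions_def)
    ultimately show ?thesis unfolding positions_def by auto
  qed
  then have "lr_maxima w \<pi> = {k \<in> positions w 2. (\<forall>t\<in>positions u 1. t < \<pi> k) \<and>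
      (\<forall>i\<in>positions w 2. i < k \<longrightarrow> \<pi> i < \<pi> k)}"
    unfolding lr_maxima_def by blast
  also have "\<dots> = records upper_key upper_key' (positions w 2) {b. \<forall>t\<in>positions u 1. t < b}
      (restrict \<pi> (positions w 2))"
  proof -
    have "upper_key a + 1 \<le> upper_key b \<longleftrightarrow> a < b" for a b by linarith
    then show ?thesis
      unfolding records_def by (intro Collect_cong) (simp cong: conj_cong ball_cong)
  qed
  finally show ?thesis .
qed

text \<open>Dually, a later position \<open>i\<close> with letter 2 satisfies \<pi> k < k < i \<le>
  \<pi> i.\<close>

lemma rl_minima_eq:
  assumes \<pi>: "\<pi> \<in> arrangements_to w u"
  shows "rl_minima w \<pi> = records lower_key lower_key' (positions w 0) {b. \<forall>t\<in>positions u 1. b < t}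
    (restrict \<pi> (positions w 0))"
proof -
  have b: "\<pi> ` positions w 1 = positions u 1"
    using arrangements_toD[OF \<pi> word_length, of 1] by (simp add: bij_betw_def)
  have 2: "k \<le> \<pi> k" if "k \<in> positions w 2" for k
    using \<pi> that by (auto simp: arrangements_to_def arrangements_def)
  have 0: "\<pi> k < k" if "k \<in> positions w 0" for k
    using \<pi> that by (auto simp: arrangements_to_def arrangements_def)
  have "(\<forall>i<length w. k < i \<or> w ! i = 1 \<longrightarrow> \<pi> k < \<pi> i) \<longleftrightarrow>
      (\<forall>t\<in>positions u 1. \<pi> k < t) \<and> (\<forall>i\<in>positions w 0. k < i \<longrightarrow> \<pi> k < \<pi> i)" if k: "k \<in> positions w 0" for k
  proof -
    have "\<pi> k < \<pi> i" if "i < length w" "k < i" "w ! i = 2" for i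
      using that 0[OF k] 2[of i] by (auto simp: positions_def)
    then have "(k < i \<or> w ! i = 1 \<longrightarrow> \<pi> k < \<pi> i) \<longleftrightarrow>
        (w ! i = 1 \<longrightarrow> \<pi> k < \<pi> i) \<and> (w ! i = 0 \<longrightarrow> k < i \<longrightarrow> \<pi> k < \<pi> i)" if "i < length w" for i
      using word_letters(1)[OF that] that by auto
    moreover have "(\<forall>t\<in>positions u 1. \<pi> k < t) \<longleftrightarrow> (\<forall>i<length w. w ! i = 1 \<longrightarrow> \<pi> k < \<pi> i)"
      unfolding b[symmetric] by (auto simp: positions_def)
    ultimately show ?thesis unfolding positions_def by auto
  qed
  then have "rl_minima w \<pi> = {k \<in> positions w 0. (\<forall>t\<in>positions u 1. \<pi> k < t) \<and>
      (\<forall>i\<in>positions w 0. k < i \<longrightarrow> \<pi> k < \<pi> i)}"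
    unfolding rl_minima_def by blast
  also have "\<dots> = records lower_key lower_key' (positions w 0) {b. \<forall>t\<in>positions u 1. b < t}
      (restrict \<pi> (positions w 0))"
  proof -
    have "upper_key a + 1 \<le> upper_key b \<longleftrightarrow> a < b" for a b by linarith
    then show ?thesis
      unfolding records_def by (intro Collect_cong) (simp cong: conj_cong ball_cong)
  qed
  finally show ?thesis .
qed

end

context weights
begin

text \<open>For fixed words an arrangement is a matching of the 2's together with one of the 0's;
  the 1's are forced and contribute the constant \<open>C\<close>. The products over 2's, 0's and
  1's are then regrouped point by point.\<close>

lemma sum_arrangements_to:
  assumes w: "set w \<subseteq> {0, 1, 2}" and u: "u \<in> words (length w)"
    and counts: "count_list w 0 = count_list u 0" "count_list w 1 = count_list u 1"
      "count_list w 2 = count_list u 2"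
    and r: "r = int (count_list w 1)"
  shows "(\<Sum>\<pi>\<in>arrangements_to w u.
      q ^ (card (upper_crossings w \<pi>) + card (lower_crossings w \<pi>)) *
      y ^ card (rl_minima w \<pi>) * z ^ card (lr_maxima w \<pi>)) =
    (\<Prod>i<length w. local_weight r w u 0 r 0 i)"
proof -
  let ?n = "length w"
  let ?stat = "\<lambda>\<pi>. q ^ (card (upper_crossings w \<pi>) + card (lower_crossings w \<pi>)) *
      y ^ card (rl_minima w \<pi>) * z ^ card (lr_maxima w \<pi>)"
  let ?A = "positions w" and ?B = "positions u"
  have len: "length u = ?n" using u by (simp add: words_def)
  have u': "set u \<subseteq> {0, 1, 2}" using u by (simp add: words_def)
  let ?M2 = "matchings upper_key upper_key' (?A 2) (?B 2)"
  let ?M0 = "matchings lower_key lower_key' (?A 0) (?B 0)"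
  let ?Z2 = "{b. \<forall>t\<in>?B 1. t < b}" and ?Z0 = "{b. \<forall>t\<in>?B 1. b < t}"
  define P where "P t = int (card {k \<in> ?A 2. k \<le> t}) - int (card {b \<in> ?B 2. b < t})" for t
  define L where "L i = int (card {b \<in> ?B 0. b < i}) - int (card {k \<in> ?A 0. k \<le> i})" for i
  define L' where "L' b = int (card {k \<in> ?A 0. b < k}) - int (card {b' \<in> ?B 0. b < b'})" for b
  define X where "X f = q ^ card (matching_crossings upper_key upper_key' (?A 2) f) *
      z ^ card (records upper_key upper_key' (?A 2) ?Z2 f)" for f
  define Y where "Y g = q ^ card (matching_crossings lower_key lower_key' (?A 0) g) *
      y ^ card (records lower_key lower_key' (?A 0) ?Z0 g)" for g
  define C where "C = (\<Prod>t\<in>?B 1. q ^ nat (P t)) * (\<Prod>i\<in>?A 1. q ^ nat (L i))"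
  have C: "C = q ^ ((\<Sum>t\<in>?B 1. nat (P t)) + (\<Sum>i\<in>?A 1. nat (L i)))"
    by (simp add: C_def power_add power_sum)
  have weight: "?stat \<pi> =
      X (restrict \<pi> (?A 2)) * Y (restrict \<pi> (?A 0)) * C" if "\<pi> \<in> arrangements_to w u" for \<pi>
    unfolding card_upper_crossings[OF w u that] card_lower_crossings[OF w u that]
      lr_maxima_eq[OF w u that] rl_minima_eq[OF w u that] C X_def Y_def P_def L_def
    by (simp add: power_add mult_ac)
  obtain h where h: "bij_betw h (?A 1) (?B 1)" "strict_mono_on (?A 1) h"
    using ex_strict_mono_on_bij[of "?A 1" "?B 1"] counts by (auto simp: card_positions)
  let ?join = "\<lambda>(f, g) i. if i \<in> ?A 2 then f i else if i \<in> ?A 0 then g i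
      else if i \<in> ?A 1 then h i else undefined"
  have "(\<Sum>\<pi>\<in>arrangements_to w u.
      ?stat \<pi>) =
      (\<Sum>(f, g)\<in>?M2 \<times> ?M0. X f * Y g * C)"
  proof (rule sum.reindex_bij_witness[of _ ?join "\<lambda>\<pi>. (restrict \<pi> (?A 2), restrict \<pi> (?A 0))"])
    fix \<pi> assume \<pi>: "\<pi> \<in> arrangements_to w u"
    show "(restrict \<pi> (?A 2), restrict \<pi> (?A 0)) \<in> ?M2 \<times> ?M0"
      using split_arrangement[OF w u \<pi>] by simp
    show "(case (restrict \<pi> (?A 2), restrict \<pi> (?A 0)) of (f, g) \<Rightarrow> X f * Y g * C) =
        ?stat \<pi>"
      using weight[OF \<pi>] by simp
    have "\<pi> i = h i" if "i \<in> ?A 1" for i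
    proof (rule strict_mono_on_bij_unique[of "?A 1" \<pi> h i])
      show "strict_mono_on (?A 1) \<pi>" using \<pi> by (simp add: arrangements_to_def arrangements_def)
      show "\<pi> ` ?A 1 = h ` ?A 1"
        using arrangements_toD[OF \<pi> len, of 1] h(1) by (simp add: bij_betw_def)
    qed (use h that in auto)
    moreover have "\<pi> i = undefined" if "i \<notin> ?A 2" "i \<notin> ?A 0" "i \<notin> ?A 1" for i
    proof -
      have "i \<notin> {..<?n}" using that positions_Un[OF w] by blast
      then show ?thesis
        using \<pi> by (auto simp: arrangements_to_def arrangements_def PiE_iff extensional_def)
    qed
    ultimately show "?join (restrict \<pi> (?A 2), restrict \<pi> (?A 0)) = \<pi>"
      by (auto simp: fun_eq_iff)
  next
    fix p assume "p \<in> ?M2 \<times> ?M0"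
    then obtain f g where p: "p = (f, g)" and f: "f \<in> ?M2" and g: "g \<in> ?M0" by auto
    show "?join p \<in> arrangements_to w u"
      using join_arrangement[OF w u f g h] by (simp add: p)
    have "i \<notin> ?A 2" if "i \<in> ?A 0" for i using that by (auto simp: positions_def)
    then show "(restrict (?join p) (?A 2), restrict (?join p) (?A 0)) = p"
      using f g by (auto simp: p fun_eq_iff matchings_def PiE_iff extensional_def)
  qed
  also have "\<dots> = (\<Sum>f\<in>?M2. X f) * (\<Sum>g\<in>?M0. Y g) * C"
  proof -
    have "(\<Sum>f\<in>?M2. X f) * (\<Sum>g\<in>?M0. Y g) = (\<Sum>p\<in>?M2 \<times> ?M0. X (fst p) * Y (snd p))"
      by (simp only: sum_product sum.cartesian_product case_prod_unfold)
    then show ?thesis by (simp only: sum_distrib_right case_prod_unfold)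
  qed
  also have "(\<Sum>f\<in>?M2. X f) = (\<Prod>b\<in>?B 2. bracket (if b \<in> ?Z2 then z else 1) (P b))"
  proof -
    have "{i \<in> ?A 2. upper_key i < upper_key' b} = {k \<in> ?A 2. k \<le> b}"
      "{b' \<in> ?B 2. upper_key' b' < upper_key' b} = {b' \<in> ?B 2. b' < b}" for b
      by auto
    then show ?thesis
      unfolding X_def P_def using counts
      by (subst sum_matchings) (simp_all add: card_positions inj_on_def)
  qed
  also have "(\<Sum>g\<in>?M0. Y g) = (\<Prod>b\<in>?B 0. bracket (if b \<in> ?Z0 then y else 1) (L' b))"
  proof -
    have "{i \<in> ?A 0. lower_key i < lower_key' b} = {k \<in> ?A 0. b < k}"
      "{b' \<in> ?B 0. lower_key' b' < lower_key' b} = {b' \<in> ?B 0. b < b'}" for b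
      by auto
    then show ?thesis
      unfolding Y_def L'_def using counts
      by (subst sum_matchings) (simp_all add: card_positions inj_on_def)
  qed
  finally have lhs: "(\<Sum>\<pi>\<in>arrangements_to w u.
      ?stat \<pi>) =
      (\<Prod>b\<in>?B 2. bracket (if b \<in> ?Z2 then z else 1) (P b)) *
      (\<Prod>b\<in>?B 0. bracket (if b \<in> ?Z0 then y else 1) (L' b)) * C" .
  define D where "D i = (if w ! i = 1 then q ^ nat (L i) else 1)" for i
  define E where "E i = (if u ! i = 2 then bracket (if i \<in> ?Z2 then z else 1) (P i)
      else if u ! i = 1 then q ^ nat (P i) else bracket (if i \<in> ?Z0 then y else 1) (L' i))" for i
  have "local_weight r w u 0 r 0 i = D i * E i" if i: "i < ?n" for i
  proof -
    have t: "count_list (take (Suc i) w) c = card {k \<in> ?A c. k \<le> i}"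
      "count_list (take i u) c = card {b \<in> ?B c. b < i}" for c
      using i len count_list_take[of "Suc i" w c] count_list_take[of i u c]
      by (simp_all add: less_Suc_eq_le)
    have B1: "int (card (?B 1)) = r" using r counts by (simp add: card_positions)
    \<comment> \<open>No negative arc is open any more iff all their end points lie before
      \<open>i\<close>: the condition for the weight \<open>z\<close>.\<close>
    have n0: "r - int (card {b \<in> ?B 1. b < i}) = 0 \<longleftrightarrow> i \<in> ?Z2"
    proof
      assume "r - int (card {b \<in> ?B 1. b < i}) = 0"
      then have "{b \<in> ?B 1. b < i} = ?B 1"
        using B1 by (intro card_subset_eq) auto
      then show "i \<in> ?Z2" by blast
    next
      assume "i \<in> ?Z2"
      then have "{b \<in> ?B 1. b < i} = ?B 1" by blast
      then show "r - int (card {b \<in> ?B 1. b < i}) = 0" using B1 by simp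
    qed
    have nr: "r - int (card {b \<in> ?B 1. b < i}) = r \<longleftrightarrow> i \<in> ?Z0" if "u ! i = 0"
    proof -
      have "b \<noteq> i" if "b \<in> ?B 1" for b using that \<open>u ! i = 0\<close> by (auto simp: positions_def)
      then have "{b \<in> ?B 1. b < i} = {} \<longleftrightarrow> i \<in> ?Z0" by (auto simp: not_less) (metis le_neq_implies_less)
      then show ?thesis by simp
    qed
    \<comment> \<open>The matching of the 0's counts from the right, \<open>local_weight\<close>
      from the left. As \<open>w\<close> and \<open>u\<close> have equally many 0's, the counts
      differ by one: the point \<open>i\<close> itself, which neither includes as an
      opening.\<close>
    have l: "L i + 1 = L' i" if "u ! i = 0"
    proof -
      have "?A 0 = {k \<in> ?A 0. k \<le> i} \<union> {k \<in> ?A 0. i < k}" by auto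
      then have a: "card (?A 0) = card {k \<in> ?A 0. k \<le> i} + card {k \<in> ?A 0. i < k}"
        using card_Un_disjoint[of "{k \<in> ?A 0. k \<le> i}" "{k \<in> ?A 0. i < k}"] by fastforce
      have "?B 0 = insert i ({b \<in> ?B 0. b < i} \<union> {b \<in> ?B 0. i < b})"
        using that i len by (auto simp: positions_def)
      moreover have "card (insert i ({b \<in> ?B 0. b < i} \<union> {b \<in> ?B 0. i < b})) =
          Suc (card ({b \<in> ?B 0. b < i} \<union> {b \<in> ?B 0. i < b}))"
        by (rule card_insert_disjoint) auto
      moreover have "card ({b \<in> ?B 0. b < i} \<union> {b \<in> ?B 0. i < b}) = card {b \<in> ?B 0. b < i} + card {b \<in> ?B 0. i < b}"
        by (rule card_Un_disjoint) auto
      ultimately have b: "card (?B 0) = Suc (card {b \<in> ?B 0. b < i} + card {b \<in> ?B 0. i < b})" by metis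
      have "card (?A 0) = card (?B 0)" using counts by (simp add: card_positions)
      then show ?thesis using a b unfolding L_def L'_def by linarith
    qed
    have "u ! i = 0 \<or> u ! i = 1 \<or> u ! i = 2"
      using letter_cases[of u i] u' i len by (simp add: is_word_def)
    then show ?thesis
      unfolding local_weight_def step_weight_def t D_def E_def
      using n0 nr l by (auto simp: P_def L_def)
  qed
  then have "(\<Prod>i<?n. local_weight r w u 0 r 0 i) = (\<Prod>i<?n. D i) * (\<Prod>i<?n. E i)"
    by (simp add: prod.distrib)
  also have "(\<Prod>i<?n. D i) = (\<Prod>i\<in>?A 1. q ^ nat (L i))"
    unfolding D_def positions_def by (subst prod.inter_filter[symmetric]) auto
  also have "(\<Prod>i<?n. E i) = (\<Prod>i\<in>?B 2. E i) * (\<Prod>i\<in>?B 0. E i) * (\<Prod>i\<in>?B 1. E i)"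
  proof -
    have "(\<Prod>i<?n. E i) = (\<Prod>i\<in>(?B 2 \<union> ?B 0) \<union> ?B 1. E i)"
      using positions_Un[OF u'] len by simp
    also have "\<dots> = (\<Prod>i\<in>?B 2 \<union> ?B 0. E i) * (\<Prod>i\<in>?B 1. E i)"
      by (rule prod.union_disjoint) (auto simp: positions_def)
    also have "(\<Prod>i\<in>?B 2 \<union> ?B 0. E i) = (\<Prod>i\<in>?B 2. E i) * (\<Prod>i\<in>?B 0. E i)"
      by (rule prod.union_disjoint) (auto simp: positions_def)
    finally show ?thesis .
  qed
  also have "(\<Prod>i\<in>?B 2. E i) = (\<Prod>b\<in>?B 2. bracket (if b \<in> ?Z2 then z else 1) (P b))"
    by (rule prod.cong) (auto simp: E_def positions_def)
  also have "(\<Prod>i\<in>?B 0. E i) = (\<Prod>b\<in>?B 0. bracket (if b \<in> ?Z0 then y else 1) (L' b))"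
    by (rule prod.cong) (auto simp: E_def positions_def)
  also have "(\<Prod>i\<in>?B 1. E i) = (\<Prod>t\<in>?B 1. q ^ nat (P t))"
    by (rule prod.cong) (auto simp: E_def positions_def)
  finally show ?thesis
    unfolding lhs C_def by (simp add: mult_ac)
qed

theorem sum_arrangements:
  assumes w: "set w \<subseteq> {0, 1, 2}" and r: "r = int (count_list w 1)"
  shows "(\<Sum>\<pi>\<in>arrangements w.
      q ^ (card (upper_crossings w \<pi>) + card (lower_crossings w \<pi>)) *
      y ^ card (rl_minima w \<pi>) * z ^ card (lr_maxima w \<pi>)) = arc_value r w 0 r 0"
  unfolding sum_arrangements_group[OF w] arc_value_eq_sum[OF w]
proof (rule sum.cong[OF refl])
  fix u assume u: "u \<in> words (length w)"
  then have len: "length u = length w" by (simp add: words_def)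
  let ?c = "count_list w 0 = count_list u 0 \<and> count_list w 1 = count_list u 1 \<and> count_list w 2 = count_list u 2"
  let ?s = "\<Sum>\<pi>\<in>arrangements_to w u.
      q ^ (card (upper_crossings w \<pi>) + card (lower_crossings w \<pi>)) *
      y ^ card (rl_minima w \<pi>) * z ^ card (lr_maxima w \<pi>)"
  have "?s = (if ?c then 1 else 0) * (\<Prod>i<length w. local_weight r w u 0 r 0 i)"
  proof (cases ?c)
    case True
    then show ?thesis using sum_arrangements_to[OF w u _ _ _ r] by simp
  next
    case False
    have "count_list w c = count_list u c" if "\<pi> \<in> arrangements_to w u" for \<pi> c
      using arrangements_toD[OF that len, of c] by (metis bij_betw_same_card card_positions)
    then have e: "arrangements_to w u = {}" using False by blast
    show ?thesis unfolding e if_not_P[OF False] by simp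
  qed
  moreover have "?c \<longleftrightarrow> 0 + int (count_list w 2) = int (count_list u 2) \<and> r = int (count_list u 1) \<and>
      0 + int (count_list u 0) = int (count_list w 0)"
    using r by auto
  ultimately show "?s = (if 0 + int (count_list w 2) = int (count_list u 2) \<and> r = int (count_list u 1) \<and>
      0 + int (count_list u 0) = int (count_list w 0) then 1 else 0) * (\<Prod>i<length w. local_weight r w u 0 r 0 i)"
    by simp
qed

end

section \<open>Signed permutations of assemblee type\<close>

definition elem :: "int set \<Rightarrow> nat \<Rightarrow> int" where
  "elem X i = sorted_list_of_set X ! i"

definition rank :: "int set \<Rightarrow> int \<Rightarrow> nat" where
  "rank X = inv_into {..<card X} (elem X)"

definition to_arrangement :: "int set \<Rightarrow> (int \<Rightarrow> int) \<Rightarrow> nat \<Rightarrow> nat" where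
  "to_arrangement X \<tau> = (\<lambda>i\<in>{..<card X}. rank X \<bar>\<tau> (elem X i)\<bar>)"

text \<open>\<open>to_arrangement\<close> forgets signs; the letters 1 of \<open>w\<close> restore
  them.\<close>

definition signed_value :: "int set \<Rightarrow> word \<Rightarrow> (nat \<Rightarrow> nat) \<Rightarrow> int \<Rightarrow> int" where
  "signed_value X w \<pi> x = (if w ! rank X x = 1 then - 1 else 1) * elem X (\<pi> (rank X x))"

definition from_arrangement :: "int set \<Rightarrow> word \<Rightarrow> (nat \<Rightarrow> nat) \<Rightarrow> int \<Rightarrow> int" where
  "from_arrangement X w \<pi> x = (if x \<in> X then signed_value X w \<pi> x
     else if - x \<in> X then - signed_value X w \<pi> (- x) else x)"

context
  fixes X :: "int set"
  assumes fin: "finite X" and ne: "X \<noteq> {}" and all_pos: "\<forall>x\<in>X. 0 < x"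
begin

lemma member_pos: "x \<in> X \<Longrightarrow> 0 < x"
  using all_pos by blast

lemma elem_bij: "bij_betw (elem X) {..<card X} X"
  unfolding elem_def using fin by (intro bij_betw_nth) auto

lemma elem_in: "i < card X \<Longrightarrow> elem X i \<in> X"
  using elem_bij by (auto dest: bij_betwE)

lemma elem_pos: "i < card X \<Longrightarrow> 0 < elem X i"
  by (rule member_pos[OF elem_in])

lemma elem_less: "i < card X \<Longrightarrow> j < card X \<Longrightarrow> elem X i < elem X j \<longleftrightarrow> i < j"
proof -
  have "elem X a < elem X b" if "a < b" "b < card X" for a b
    using that sorted_wrt_nth_less[OF strict_sorted_list_of_set[of X]] by (simp add: elem_def)
  then show "i < card X \<Longrightarrow> j < card X \<Longrightarrow> elem X i < elem X j \<longleftrightarrow> i < j"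
    by (metis less_asym linorder_neqE_nat less_irrefl)
qed

lemma elem_le: "i < card X \<Longrightarrow> j < card X \<Longrightarrow> elem X i \<le> elem X j \<longleftrightarrow> i \<le> j"
  by (metis elem_less not_less)

lemma elem_eq: "i < card X \<Longrightarrow> j < card X \<Longrightarrow> elem X i = elem X j \<longleftrightarrow> i = j"
  by (metis elem_less less_irrefl linorder_neqE_nat)

lemma rank_elem: "i < card X \<Longrightarrow> rank X (elem X i) = i"
  using elem_bij unfolding rank_def by (simp add: bij_betw_def inv_into_f_f)

lemma elem_rank: "x \<in> X \<Longrightarrow> elem X (rank X x) = x"
  using elem_bij unfolding rank_def by (auto simp: bij_betw_def intro: f_inv_into_f)

lemma rank_less: "x \<in> X \<Longrightarrow> rank X x < card X"
  using bij_betw_inv_into[OF elem_bij] unfolding rank_def by (auto dest: bij_betwE)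

lemma X_obtain: "x \<in> X \<Longrightarrow> (\<And>i. i < card X \<Longrightarrow> x = elem X i \<Longrightarrow> thesis) \<Longrightarrow> thesis"
  using rank_less elem_rank by metis

lemma card_X: "0 < card X"
  using fin ne by (simp add: card_gt_0_iff)

lemma Min_X: "Min X = elem X 0"
proof (rule Min_eqI[OF fin])
  fix y assume "y \<in> X"
  then obtain i where "i < card X" "y = elem X i" by (rule X_obtain)
  then show "elem X 0 \<le> y" using elem_le[of 0 i] by simp
qed (rule elem_in[OF card_X])

lemma perm_shape_length: "length (perm_shape X \<tau>) = card X"
  using fin by (simp add: perm_shape_def)

lemma perm_shape_nth:
  "i < card X \<Longrightarrow> perm_shape X \<tau> ! i = (if \<tau> (elem X i) \<ge> elem X i then 2 else if \<tau> (elem X i) < 0 then 1 else 0)"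
  using fin by (simp add: perm_shape_def elem_def)

lemma perm_shape_letters: "set (perm_shape X \<tau>) \<subseteq> {0, 1, 2}"
  by (auto simp: perm_shape_def)

lemma neg_eq: "neg X \<tau> = elem X ` positions (perm_shape X \<tau>) 1"
proof
  show "neg X \<tau> \<subseteq> elem X ` positions (perm_shape X \<tau>) 1"
  proof
    fix x assume "x \<in> neg X \<tau>"
    then have x: "x \<in> X" "\<tau> x < 0" by (auto simp: neg_def)
    then obtain i where i: "i < card X" "x = elem X i" by (rule_tac X_obtain)
    then have "i \<in> positions (perm_shape X \<tau>) 1"
      using x elem_pos[OF i(1)] by (simp add: positions_def perm_shape_length perm_shape_nth)
    then show "x \<in> elem X ` positions (perm_shape X \<tau>) 1" using i by blast
  qed
  show "elem X ` positions (perm_shape X \<tau>) 1 \<subseteq> neg X \<tau>"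
    by (auto simp: positions_def perm_shape_length perm_shape_nth neg_def elem_in split: if_splits)
qed

lemma AS_abs:
  assumes "\<tau> \<in> AS X"
  shows "bij_betw (\<lambda>x. \<bar>\<tau> x\<bar>) X X"
proof -
  have b: "bij_betw \<tau> (X \<union> uminus ` X) (X \<union> uminus ` X)"
    and m: "\<And>i. i \<in> X \<Longrightarrow> \<tau> (- i) = - \<tau> i"
    using assms by (auto simp: AS_def signed_perm_def)
  have "inj_on (\<lambda>x. \<bar>\<tau> x\<bar>) X"
  proof (rule inj_onI)
    fix x y assume xy: "x \<in> X" "y \<in> X" "\<bar>\<tau> x\<bar> = \<bar>\<tau> y\<bar>"
    then have "\<tau> x = \<tau> y \<or> \<tau> x = \<tau> (- y)" using m by (auto simp: abs_eq_iff)
    then have "x = y \<or> x = - y"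
      using xy bij_betw_imp_inj_on[OF b] by (auto dest: inj_onD)
    then show "x = y" using member_pos[OF xy(1)] member_pos[OF xy(2)] by auto
  qed
  moreover have "(\<lambda>x. \<bar>\<tau> x\<bar>) ` X \<subseteq> X"
  proof
    fix z assume "z \<in> (\<lambda>x. \<bar>\<tau> x\<bar>) ` X"
    then obtain x where x: "x \<in> X" "z = \<bar>\<tau> x\<bar>" by blast
    have "\<tau> x \<in> X \<union> uminus ` X" using bij_betwE[OF b] x by blast
    then show "z \<in> X" using x member_pos by force
  qed
  ultimately show ?thesis using fin by (simp add: bij_betw_def endo_inj_surj)
qed

section \<open>From a signed permutation to its arrangement\<close>

context
  fixes \<tau> w \<pi>
  assumes \<tau>: "\<tau> \<in> AS X" and w: "w = perm_shape X \<tau>" and \<pi>: "\<pi> = to_arrangement X \<tau>"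
begin

lemma len_w: "length w = card X"
  by (simp add: w perm_shape_length)

lemma abs_in: "x \<in> X \<Longrightarrow> \<bar>\<tau> x\<bar> \<in> X"
  using bij_betwE[OF AS_abs[OF \<tau>]] by blast

lemma pi_less: "i < card X \<Longrightarrow> \<pi> i < card X"
  using abs_in[OF elem_in] rank_less by (simp add: \<pi> to_arrangement_def)

lemma elem_pi: "i < card X \<Longrightarrow> elem X (\<pi> i) = \<bar>\<tau> (elem X i)\<bar>"
  using abs_in[OF elem_in] elem_rank by (simp add: \<pi> to_arrangement_def)

lemma tau_nonzero: "x \<in> X \<Longrightarrow> \<tau> x \<noteq> 0"
  using member_pos[OF abs_in] by force

lemma w_cases:
  assumes i: "i < card X"
  shows "(w ! i = 2 \<and> elem X i \<le> \<tau> (elem X i) \<and> \<tau> (elem X i) = elem X (\<pi> i)) \<or>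
   (w ! i = 1 \<and> \<tau> (elem X i) < 0 \<and> \<tau> (elem X i) = - elem X (\<pi> i)) \<or>
   (w ! i = 0 \<and> 0 < \<tau> (elem X i) \<and> \<tau> (elem X i) < elem X i \<and> \<tau> (elem X i) = elem X (\<pi> i))"
  unfolding elem_pi[OF i]
  using tau_nonzero[OF elem_in[OF i]] elem_pos[OF i]
    perm_shape_nth[OF i, of \<tau>, folded w]
  by (cases "\<tau> (elem X i) < 0"; cases "elem X i \<le> \<tau> (elem X i)") simp_all

lemma pi_bij: "bij_betw \<pi> {..<card X} {..<card X}"
proof -
  have "bij_betw (rank X \<circ> (\<lambda>x. \<bar>\<tau> x\<bar>) \<circ> elem X) {..<card X} {..<card X}"
    using elem_bij AS_abs[OF \<tau>] bij_betw_inv_into[OF elem_bij] unfolding rank_def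
    by (meson bij_betw_trans)
  then show ?thesis
    by (rule bij_betw_cong[THEN iffD1, rotated]) (simp add: \<pi> to_arrangement_def)
qed

lemma w_0: "w ! 0 = 1"
proof -
  have "elem X 0 \<in> neg X \<tau>" using \<tau> by (simp add: AS_def Min_X)
  then show ?thesis using w_cases[OF card_X] elem_pos[OF card_X] by (auto simp: neg_def)
qed

lemma pi_arrangement: "\<pi> \<in> arrangements w"
proof -
  have "\<pi> \<in> {..<card X} \<rightarrow>\<^sub>E {..<card X}"
    using pi_less by (auto simp: \<pi> to_arrangement_def PiE_iff)
  moreover have "i \<le> \<pi> i" if "i \<in> positions w 2" for i
  proof -
    have i: "i < card X" "w ! i = 2" using that by (auto simp: positions_def len_w)
    then have "elem X i \<le> elem X (\<pi> i)" using w_cases[of i] by auto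
    then show ?thesis using i pi_less elem_le by simp
  qed
  moreover have "\<pi> i < i" if "i \<in> positions w 0" for i
  proof -
    have i: "i < card X" "w ! i = 0" using that by (auto simp: positions_def len_w)
    then have "elem X (\<pi> i) < elem X i" using w_cases[of i] by auto
    then show ?thesis using i pi_less elem_less by simp
  qed
  moreover have "strict_mono_on (positions w 1) \<pi>"
  proof (rule strict_mono_onI)
    fix i j assume ij: "i \<in> positions w 1" "j \<in> positions w 1" "i < j"
    then have l: "i < card X" "j < card X" by (auto simp: positions_def len_w)
    have "elem X i \<in> neg X \<tau>" "elem X j \<in> neg X \<tau>" using ij by (auto simp: neg_eq w)
    moreover have "strict_mono_on (neg X \<tau>) (\<lambda>i. \<bar>\<tau> i\<bar>)" using \<tau> by (simp add: AS_def)
    ultimately have "\<bar>\<tau> (elem X i)\<bar> < \<bar>\<tau> (elem X j)\<bar>"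
      using ij l elem_less by (auto simp: strict_mono_on_def)
    then show "\<pi> i < \<pi> j" using l pi_less elem_less by (simp flip: elem_pi)
  qed
  ultimately show ?thesis using pi_bij by (simp add: arrangements_def len_w)
qed

lemma pi_2: "i < card X \<Longrightarrow> w ! i = 2 \<Longrightarrow> i \<le> \<pi> i"
  and pi_0: "i < card X \<Longrightarrow> w ! i = 0 \<Longrightarrow> \<pi> i < i"
  and pi_1: "i < card X \<Longrightarrow> j < card X \<Longrightarrow> w ! i = 1 \<Longrightarrow> w ! j = 1 \<Longrightarrow> i < j \<Longrightarrow> \<pi> i < \<pi> j"
  using pi_arrangement by (auto simp: arrangements_def positions_def len_w strict_mono_on_def)

text \<open>That a special LR-maximum has the letter 2 is not part of its definition and has to be
  derived. A letter 1 would give \<bar>\<tau> a\<bar> < \<tau> a, and a letter 0 is excluded by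
  counting.\<close>

lemma LRmax_eq: "LRmax X \<tau> = card (lr_maxima w \<pi>)"
proof -
  have "{a \<in> X. \<forall>k\<in>{b \<in> X. b < a} \<union> neg X \<tau>. \<tau> a > \<bar>\<tau> k\<bar>} = elem X ` lr_maxima w \<pi>"
  proof (intro set_eqI iffI)
    fix a assume "a \<in> {a \<in> X. \<forall>k\<in>{b \<in> X. b < a} \<union> neg X \<tau>. \<tau> a > \<bar>\<tau> k\<bar>}"
    then have a: "a \<in> X" "\<And>k. k \<in> X \<Longrightarrow> k < a \<Longrightarrow> \<bar>\<tau> k\<bar> < \<tau> a" "\<And>k. k \<in> neg X \<tau> \<Longrightarrow> \<bar>\<tau> k\<bar> < \<tau> a" by auto
    then obtain i where i: "i < card X" "a = elem X i" by (rule_tac X_obtain)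
    have n1: "w ! i \<noteq> 1"
    proof
      assume "w ! i = 1"
      then have "a \<in> neg X \<tau>" using i by (auto simp: neg_eq w positions_def perm_shape_length)
      then show False using a(3)[of a] by simp
    qed
    then have ta: "\<tau> a = elem X (\<pi> i)" using w_cases[OF i(1)] i by auto
    have c: "\<pi> j < \<pi> i" if "j < card X" "j < i \<or> w ! j = 1" for j
    proof -
      have "j < i \<Longrightarrow> elem X j < a" using i that elem_less by simp
      moreover have "w ! j = 1 \<Longrightarrow> elem X j \<in> neg X \<tau>"
        using that by (auto simp: neg_eq w positions_def perm_shape_length)
      ultimately have "\<bar>\<tau> (elem X j)\<bar> < \<tau> a" using a(2)[OF elem_in[OF that(1)]] a(3) that by auto
      then show ?thesis
        using that i pi_less ta elem_pi[OF that(1)] elem_less[of "\<pi> j" "\<pi> i"] by simp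
    qed
    have n0: "w ! i \<noteq> 0"
    proof
      assume "w ! i = 0"
      then have "\<pi> i < i" using pi_0 i by simp
      \<comment> \<open>Pigeonhole: the \<open>i + 1\<close> positions up to \<open>i\<close> would
        be mapped injectively to values below \<open>i\<close>.\<close>
      have "\<pi> ` {..i} \<subseteq> {..<i}"
      proof
        fix v assume "v \<in> \<pi> ` {..i}"
        then obtain j where j: "j \<le> i" "v = \<pi> j" by auto
        show "v \<in> {..<i}"
          using c[of j] j i \<open>\<pi> i < i\<close> by (cases "j = i") auto
      qed
      then have "card (\<pi> ` {..i}) \<le> i" using card_mono[of "{..<i}"] by fastforce
      moreover have "inj_on \<pi> {..i}"
        by (rule inj_on_subset[OF bij_betw_imp_inj_on[OF pi_bij]]) (use i in auto)
      then have "card (\<pi> ` {..i}) = Suc i" by (simp add: card_image)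
      ultimately show False by simp
    qed
    have "i \<in> lr_maxima w \<pi>"
      using i c n0 n1 w_cases[OF i(1)] by (auto simp: lr_maxima_def positions_def len_w)
    then show "a \<in> elem X ` lr_maxima w \<pi>" using i by blast
  next
    fix a assume "a \<in> elem X ` lr_maxima w \<pi>"
    then obtain i where a: "a = elem X i" and i: "i < card X" "w ! i = 2"
      "\<And>j. j < card X \<Longrightarrow> j < i \<or> w ! j = 1 \<Longrightarrow> \<pi> j < \<pi> i"
      by (auto simp: lr_maxima_def positions_def len_w)
    have ta: "\<tau> a = elem X (\<pi> i)" using w_cases[OF i(1)] i a by auto
    have "\<bar>\<tau> k\<bar> < \<tau> a" if "k \<in> {b \<in> X. b < a} \<union> neg X \<tau>" for k
    proof -
      have "k \<in> X" using that by (auto simp: neg_def)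
      then obtain j where j: "j < card X" "k = elem X j" by (rule X_obtain)
      have "j < i \<or> w ! j = 1"
        using that j i w_cases[OF j(1)] elem_pos[OF j(1)] elem_less a by (auto simp: neg_def)
      then have "elem X (\<pi> j) < elem X (\<pi> i)" using i j pi_less elem_less by simp
      then show ?thesis using j ta elem_pi by simp
    qed
    then show "a \<in> {a \<in> X. \<forall>k\<in>{b \<in> X. b < a} \<union> neg X \<tau>. \<tau> a > \<bar>\<tau> k\<bar>}"
      using a i elem_in by simp
  qed
  moreover have "inj_on (elem X) (lr_maxima w \<pi>)"
    by (rule inj_on_subset[OF bij_betw_imp_inj_on[OF elem_bij]]) (auto simp: lr_maxima_def positions_def len_w)
  ultimately show ?thesis unfolding LRmax_def by (simp add: card_image)
qed

lemma RLmin_eq: "RLmin X \<tau> = card (rl_minima w \<pi>)"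
proof -
  have "{a \<in> X. 0 < \<tau> a \<and> (\<forall>k\<in>{b \<in> X. a < b} \<union> neg X \<tau>. \<tau> a < \<bar>\<tau> k\<bar>)} = elem X ` rl_minima w \<pi>"
  proof (intro set_eqI iffI)
    fix a assume "a \<in> {a \<in> X. 0 < \<tau> a \<and> (\<forall>k\<in>{b \<in> X. a < b} \<union> neg X \<tau>. \<tau> a < \<bar>\<tau> k\<bar>)}"
    then have a: "a \<in> X" "0 < \<tau> a" "\<And>k. k \<in> X \<Longrightarrow> a < k \<Longrightarrow> \<tau> a < \<bar>\<tau> k\<bar>" "\<And>k. k \<in> neg X \<tau> \<Longrightarrow> \<tau> a < \<bar>\<tau> k\<bar>" by auto
    then obtain i where i: "i < card X" "a = elem X i" by (rule_tac X_obtain)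
    have n1: "w ! i \<noteq> 1" using a(2) w_cases[OF i(1)] i by auto
    then have ta: "\<tau> a = elem X (\<pi> i)" using w_cases[OF i(1)] i by auto
    have c: "\<pi> i < \<pi> j" if "j < card X" "i < j \<or> w ! j = 1" for j
    proof -
      have "i < j \<Longrightarrow> a < elem X j" using i that elem_less by simp
      moreover have "w ! j = 1 \<Longrightarrow> elem X j \<in> neg X \<tau>"
        using that by (auto simp: neg_eq w positions_def perm_shape_length)
      ultimately have "\<tau> a < \<bar>\<tau> (elem X j)\<bar>" using a(3)[OF elem_in[OF that(1)]] a(4) that by auto
      then show ?thesis
        using that i pi_less ta elem_pi[OF that(1)] elem_less[of "\<pi> i" "\<pi> j"] by simp
    qed
    have n2: "w ! i \<noteq> 2"
    proof
      assume "w ! i = 2"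
      then have "i \<le> \<pi> i" using pi_2 i by simp
      \<comment> \<open>A value up to \<open>\<pi> i\<close> is taken neither after \<open>i\<close>
        nor at a letter 1, hence not at position 0. The \<open>\<pi> i + 1 > i\<close> such values
        would have to come from the \<open>i\<close> positions \<open>1..i\<close>.\<close>
      have "{..\<pi> i} \<subseteq> \<pi> ` {1..i}"
      proof
        fix v assume v: "v \<in> {..\<pi> i}"
        then have "v \<in> {..<card X}" using pi_less[OF i(1)] by simp
        then obtain j where j: "j < card X" "\<pi> j = v"
          using pi_bij unfolding bij_betw_def by (metis imageE lessThan_iff)
        then have "\<not> (i < j \<or> w ! j = 1)" using c v by fastforce
        then have "j \<in> {1..i}" using w_0 by (cases j) auto
        then show "v \<in> \<pi> ` {1..i}" using j by blast
      qed
      then have "card {..\<pi> i} \<le> card {1..i}"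
        by (meson card_image_le card_mono finite_atLeastAtMost finite_imageI order.trans)
      then show False using \<open>i \<le> \<pi> i\<close> by simp
    qed
    have "i \<in> rl_minima w \<pi>"
      using i c n2 n1 w_cases[OF i(1)] by (auto simp: rl_minima_def positions_def len_w)
    then show "a \<in> elem X ` rl_minima w \<pi>" using i by blast
  next
    fix a assume "a \<in> elem X ` rl_minima w \<pi>"
    then obtain i where a: "a = elem X i" and i: "i < card X" "w ! i = 0"
      "\<And>j. j < card X \<Longrightarrow> i < j \<or> w ! j = 1 \<Longrightarrow> \<pi> i < \<pi> j"
      by (auto simp: rl_minima_def positions_def len_w)
    have ta: "\<tau> a = elem X (\<pi> i)" "0 < \<tau> a" using w_cases[OF i(1)] i a by auto
    have "\<tau> a < \<bar>\<tau> k\<bar>" if "k \<in> {b \<in> X. a < b} \<union> neg X \<tau>" for k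
    proof -
      have "k \<in> X" using that by (auto simp: neg_def)
      then obtain j where j: "j < card X" "k = elem X j" by (rule X_obtain)
      have "i < j \<or> w ! j = 1"
        using that j i w_cases[OF j(1)] elem_pos[OF j(1)] elem_less a by (auto simp: neg_def)
      then have "elem X (\<pi> i) < elem X (\<pi> j)" using i j pi_less elem_less by simp
      then show ?thesis using j ta elem_pi by simp
    qed
    then show "a \<in> {a \<in> X. 0 < \<tau> a \<and> (\<forall>k\<in>{b \<in> X. a < b} \<union> neg X \<tau>. \<tau> a < \<bar>\<tau> k\<bar>)}"
      using a i elem_in ta by simp
  qed
  moreover have "inj_on (elem X) (rl_minima w \<pi>)"
    by (rule inj_on_subset[OF bij_betw_imp_inj_on[OF elem_bij]]) (auto simp: rl_minima_def positions_def len_w)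
  ultimately show ?thesis unfolding RLmin_def by (simp add: card_image)
qed

text \<open>On \<open>neg X \<tau>\<close> arguments and absolute values increase together, so their
  minima increase strictly, and the special order of the arc diagram becomes the usual one.\<close>

lemma neg_less_iff:
  assumes "a \<in> neg X \<tau>" "b \<in> neg X \<tau>"
  shows "neg_less \<tau> a b \<longleftrightarrow> a < b"
proof -
  have m: "x < y \<Longrightarrow> \<bar>\<tau> x\<bar> < \<bar>\<tau> y\<bar>" if "x \<in> neg X \<tau>" "y \<in> neg X \<tau>" for x y
    using \<tau> that by (auto simp: AS_def strict_mono_on_def)
  show ?thesis
    using m[OF assms] m[OF assms(2,1)] unfolding neg_less_def
    by (cases a b rule: linorder_cases) (auto simp: min_def)
qed

lemma neg_index_less:
  assumes "a \<in> neg X \<tau>" "b \<in> neg X \<tau>" "a < b"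
  shows "neg_index X \<tau> a < neg_index X \<tau> b"
proof -
  have "{k \<in> neg X \<tau>. neg_less \<tau> k a} \<subset> {k \<in> neg X \<tau>. neg_less \<tau> k b}"
    using assms neg_less_iff by force
  moreover have "finite (neg X \<tau>)" using fin by (simp add: neg_def)
  ultimately show ?thesis by (simp add: neg_index_def psubset_card_mono)
qed

text \<open>Arcs are determined by their right ends, so pairs of arcs can be counted as pairs of
  indices.\<close>

lemma arc_crossings:
  fixes S :: "nat set" and a b :: "nat \<Rightarrow> int"
  assumes "inj_on b S"
  shows "card {((a1, b1), (a2, b2)) | a1 b1 a2 b2.
      (a1, b1) \<in> (\<lambda>i. (a i, b i)) ` S \<and> (a2, b2) \<in> (\<lambda>i. (a i, b i)) ` S \<and> R a1 b1 a2 b2} =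
    card {(i, k) \<in> S \<times> S. R (a i) (b i) (a k) (b k)}"
proof -
  have "{((a1, b1), (a2, b2)) | a1 b1 a2 b2.
      (a1, b1) \<in> (\<lambda>i. (a i, b i)) ` S \<and> (a2, b2) \<in> (\<lambda>i. (a i, b i)) ` S \<and> R a1 b1 a2 b2} =
      (\<lambda>(i, k). ((a i, b i), (a k, b k))) ` {(i, k) \<in> S \<times> S. R (a i) (b i) (a k) (b k)}"
    by (auto simp: image_iff)
  moreover have "inj_on (\<lambda>(i, k). ((a i, b i), (a k, b k))) {(i, k) \<in> S \<times> S. R (a i) (b i) (a k) (b k)}"
    using assms by (auto simp: inj_on_def)
  ultimately show ?thesis by (simp add: card_image)
qed

lemma cro_eq: "cro X \<tau> = card (upper_crossings w \<pi>) + card (lower_crossings w \<pi>)"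
proof -
  define \<nu> where "\<nu> i = int (neg_index X \<tau> (elem X i))" for i
  have \<nu>_pos: "0 < \<nu> i" for i by (simp add: \<nu>_def neg_index_def)
  have \<nu>_less: "\<nu> i < \<nu> j \<longleftrightarrow> i < j" if "i \<in> positions w 1" "j \<in> positions w 1" for i j
  proof -
    have n: "elem X i \<in> neg X \<tau>" "elem X j \<in> neg X \<tau>" using that by (auto simp: neg_eq w)
    have l: "i < card X" "j < card X" using that by (auto simp: positions_def len_w)
    show ?thesis
      using neg_index_less[OF n] neg_index_less[OF n(2,1)] elem_less[OF l] elem_less[OF l(2,1)]
      unfolding \<nu>_def by (cases i j rule: linorder_cases) auto
  qed
  define Sl where "Sl = positions w 0 \<union> positions w 1"
  define Su where "Su = positions w 2 \<union> positions w 1"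
  have S: "i < card X" if "i \<in> Sl \<union> Su" for i
    using that by (auto simp: Sl_def Su_def positions_def len_w)
  define ua where "ua i = (if w ! i = 2 then elem X i else - \<nu> i)" for i
  define ub where "ub i = elem X (\<pi> i)" for i
  define la where "la i = (if w ! i = 0 then elem X (\<pi> i) else - \<nu> i)" for i
  have X2: "{(i, \<tau> i) | i. i \<in> X \<and> \<tau> i \<ge> i} = (\<lambda>i. (ua i, ub i)) ` positions w 2"
  proof (intro set_eqI iffI)
    fix p assume "p \<in> {(i, \<tau> i) | i. i \<in> X \<and> \<tau> i \<ge> i}"
    then obtain x where x: "p = (x, \<tau> x)" "x \<in> X" "x \<le> \<tau> x" by blast
    then obtain i where i: "i < card X" "x = elem X i" by (rule_tac X_obtain)
    then have "i \<in> positions w 2" "p = (ua i, ub i)"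
      using x w_cases[OF i(1)] elem_pos[OF i(1)] by (auto simp: positions_def len_w ua_def ub_def)
    then show "p \<in> (\<lambda>i. (ua i, ub i)) ` positions w 2" by blast
  next
    fix p assume "p \<in> (\<lambda>i. (ua i, ub i)) ` positions w 2"
    then obtain i where i: "i < card X" "w ! i = 2" "p = (ua i, ub i)" by (auto simp: positions_def len_w)
    then have "p = (elem X i, \<tau> (elem X i))" "elem X i \<le> \<tau> (elem X i)"
      using w_cases[OF i(1)] by (auto simp: ua_def ub_def)
    then show "p \<in> {(i, \<tau> i) | i. i \<in> X \<and> \<tau> i \<ge> i}" using elem_in[OF i(1)] by blast
  qed
  have X0: "{(\<tau> i, i) | i. i \<in> X \<and> 0 < \<tau> i \<and> \<tau> i < i} = (\<lambda>i. (la i, elem X i)) ` positions w 0"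
  proof (intro set_eqI iffI)
    fix p assume "p \<in> {(\<tau> i, i) | i. i \<in> X \<and> 0 < \<tau> i \<and> \<tau> i < i}"
    then obtain x where x: "p = (\<tau> x, x)" "x \<in> X" "\<tau> x < x" "0 < \<tau> x" by blast
    then obtain i where i: "i < card X" "x = elem X i" by (rule_tac X_obtain)
    then have "i \<in> positions w 0" "p = (la i, elem X i)"
      using x w_cases[OF i(1)] by (auto simp: positions_def len_w la_def)
    then show "p \<in> (\<lambda>i. (la i, elem X i)) ` positions w 0" by blast
  next
    fix p assume "p \<in> (\<lambda>i. (la i, elem X i)) ` positions w 0"
    then obtain i where i: "i < card X" "w ! i = 0" "p = (la i, elem X i)" by (auto simp: positions_def len_w)
    then have "p = (\<tau> (elem X i), elem X i)" "\<tau> (elem X i) < elem X i" "0 < \<tau> (elem X i)"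
      using w_cases[OF i(1)] by (auto simp: la_def)
    then show "p \<in> {(\<tau> i, i) | i. i \<in> X \<and> 0 < \<tau> i \<and> \<tau> i < i}" using elem_in[OF i(1)] by blast
  qed
  have Xu: "{(- int (neg_index X \<tau> i), \<bar>\<tau> i\<bar>) | i. i \<in> neg X \<tau>} = (\<lambda>i. (ua i, ub i)) ` positions w 1"
  proof -
    have "(\<lambda>x. (- int (neg_index X \<tau> x), \<bar>\<tau> x\<bar>)) (elem X i) = (ua i, ub i)" if "i \<in> positions w 1" for i
      using that elem_pi[of i] by (auto simp: ua_def ub_def \<nu>_def positions_def len_w)
    then show ?thesis unfolding neg_eq w[symmetric] by (force simp: image_iff)
  qed
  have Xl: "{(- int (neg_index X \<tau> i), i) | i. i \<in> neg X \<tau>} = (\<lambda>i. (la i, elem X i)) ` positions w 1"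
  proof -
    have "(\<lambda>x. (- int (neg_index X \<tau> x), x)) (elem X i) = (la i, elem X i)" if "i \<in> positions w 1" for i
      using that by (auto simp: la_def \<nu>_def positions_def)
    then show ?thesis unfolding neg_eq w[symmetric] by (force simp: image_iff)
  qed
  have ua: "upper_arcs X \<tau> = (\<lambda>i. (ua i, ub i)) ` Su"
    unfolding upper_arcs_def X2 Xu Su_def by blast
  have la: "lower_arcs X \<tau> = (\<lambda>i. (la i, elem X i)) ` Sl"
    unfolding lower_arcs_def X0 Xl Sl_def by blast
  have inj_ub: "inj_on ub Su"
  proof (rule inj_onI)
    fix i j assume ij: "i \<in> Su" "j \<in> Su" "ub i = ub j"
    then have l: "i < card X" "j < card X" using S by auto
    then have "\<pi> i = \<pi> j" using ij(3) elem_eq pi_less by (simp add: ub_def)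
    then show "i = j" using bij_betw_imp_inj_on[OF pi_bij] l by (auto dest: inj_onD)
  qed
  have inj_l: "inj_on (elem X) Sl"
    by (rule inj_on_subset[OF bij_betw_imp_inj_on[OF elem_bij]]) (use S in auto)
  have 1: "{(i, k) \<in> Su \<times> Su. ua i < ua k \<and> ua k \<le> ub i \<and> ub i < ub k} = upper_crossings w \<pi>"
  proof (rule set_eqI)
    fix p :: "nat \<times> nat"
    obtain i k where p: "p = (i, k)" by fastforce
    show "p \<in> {(i, k) \<in> Su \<times> Su. ua i < ua k \<and> ua k \<le> ub i \<and> ub i < ub k} \<longleftrightarrow> p \<in> upper_crossings w \<pi>"
    proof (cases "i \<in> Su \<and> k \<in> Su")
      case True
      then have l: "i < card X" "k < card X" using S by auto
      have u: "ub i < ub k \<longleftrightarrow> \<pi> i < \<pi> k" using l elem_less pi_less by (simp add: ub_def)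
      have k: "elem X k \<le> ub i \<longleftrightarrow> k \<le> \<pi> i" using l elem_le pi_less by (simp add: ub_def)
      consider "w ! k = 2" "w ! i = 2" | "w ! k = 2" "w ! i = 1" | "w ! k = 1" "w ! i = 2" | "w ! k = 1" "w ! i = 1"
        using True by (auto simp: Su_def positions_def)
      then show ?thesis
      proof cases
        case 1
        then show ?thesis using True l u k elem_less[OF l]
          by (auto simp: p upper_crossings_def ua_def positions_def len_w)
      next
        case 2
        then show ?thesis using True l u k elem_pos[OF l(2)] \<nu>_pos[of i]
          by (auto simp: p upper_crossings_def ua_def positions_def len_w)
      next
        case 3
        then show ?thesis using True l u k elem_pos[OF l(1)] \<nu>_pos[of k]
          by (auto simp: p upper_crossings_def ua_def positions_def len_w)
      next
        case 4
        \<comment> \<open>Two negative arcs do not cross: the one with the larger argument starts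
          further left and ends further right, so they are nested.\<close>
        then have ik: "i \<in> positions w 1" "k \<in> positions w 1" using l by (auto simp: positions_def len_w)
        then show ?thesis using 4 True l u \<nu>_less[OF ik(2,1)] pi_1[OF l(2,1)]
          by (auto simp: p upper_crossings_def ua_def positions_def len_w)
      qed
    next
      case False
      then show ?thesis
        by (auto simp: p upper_crossings_def Su_def positions_def)
    qed
  qed
  have 2: "{(i, k) \<in> Sl \<times> Sl. la i < la k \<and> la k < elem X i \<and> elem X i < elem X k} = lower_crossings w \<pi>"
  proof (rule set_eqI)
    fix p :: "nat \<times> nat"
    obtain i k where p: "p = (i, k)" by fastforce
    show "p \<in> {(i, k) \<in> Sl \<times> Sl. la i < la k \<and> la k < elem X i \<and> elem X i < elem X k} \<longleftrightarrow> p \<in> lower_crossings w \<pi>"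
    proof (cases "i \<in> Sl \<and> k \<in> Sl")
      case True
      then have l: "i < card X" "k < card X" using S by auto
      have u: "elem X (\<pi> i) < elem X (\<pi> k) \<longleftrightarrow> \<pi> i < \<pi> k" using l elem_less pi_less by simp
      have k: "elem X (\<pi> k) < elem X i \<longleftrightarrow> \<pi> k < i" using l elem_less pi_less by simp
      consider "w ! k = 0" "w ! i = 0" | "w ! k = 0" "w ! i = 1" | "w ! k = 1" "w ! i = 0" | "w ! k = 1" "w ! i = 1"
        using True by (auto simp: Sl_def positions_def)
      then show ?thesis
      proof cases
        case 1
        then show ?thesis using True l u k elem_less[OF l]
          by (auto simp: p lower_crossings_def la_def positions_def len_w)
      next
        case 2
        then show ?thesis using True l u k elem_less[OF l] elem_pos[OF pi_less[OF l(2)]] \<nu>_pos[of i]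
          by (auto simp: p lower_crossings_def la_def positions_def len_w)
      next
        case 3
        then show ?thesis using True l u k elem_pos[OF pi_less[OF l(1)]] \<nu>_pos[of k]
          by (auto simp: p lower_crossings_def la_def positions_def len_w)
      next
        case 4
        then have ik: "i \<in> positions w 1" "k \<in> positions w 1" using l by (auto simp: positions_def len_w)
        then show ?thesis using 4 True l u \<nu>_less[OF ik(2,1)] elem_less[OF l]
          by (auto simp: p lower_crossings_def la_def positions_def len_w)
      qed
    next
      case False
      then show ?thesis
        by (auto simp: p lower_crossings_def Sl_def positions_def)
    qed
  qed
  show ?thesis
    unfolding cro_def ua la
    by (simp only: 1 2 arc_crossings[OF inj_ub, of ua "\<lambda>a b c d. a < c \<and> c \<le> b \<and> b < d"]
      arc_crossings[OF inj_l, of la "\<lambda>a b c d. a < c \<and> c < b \<and> b < d"])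
qed

lemma from_to_arrangement: "from_arrangement X w \<pi> = \<tau>"
proof
  have v: "signed_value X w \<pi> x = \<tau> x" if x: "x \<in> X" for x
  proof -
    obtain i where "i < card X" "x = elem X i" using x by (rule X_obtain)
    then show ?thesis using w_cases[of i] by (auto simp: signed_value_def rank_elem)
  qed
  fix x
  show "from_arrangement X w \<pi> x = \<tau> x"
  proof (cases "x \<in> X")
    case True
    then show ?thesis by (simp add: from_arrangement_def v)
  next
    case F: False
    show ?thesis
    proof (cases "- x \<in> X")
      case True
      then have "\<tau> (- (- x)) = - \<tau> (- x)" using \<tau> unfolding AS_def signed_perm_def by blast
      then show ?thesis using F True by (simp add: from_arrangement_def v)
    next
      case False
      then have "x \<notin> X \<union> uminus ` X" using F by force
      then show ?thesis using F False \<tau> by (auto simp: from_arrangement_def AS_def signed_perm_def)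
    qed
  qed
qed

end

section \<open>From an arrangement back to a signed permutation\<close>

context
  fixes w :: word and \<pi> :: "nat \<Rightarrow> nat" and \<tau> :: "int \<Rightarrow> int"
  assumes letters: "set w \<subseteq> {0, 1, 2}" and len: "length w = card X" and w0: "w ! 0 = 1"
    and \<pi>: "\<pi> \<in> arrangements w" and \<tau>: "\<tau> = from_arrangement X w \<pi>"
begin

lemma pi_less': "i < card X \<Longrightarrow> \<pi> i < card X"
  using \<pi> len by (auto simp: arrangements_def)

lemma tau_elem: "i < card X \<Longrightarrow> \<tau> (elem X i) = (if w ! i = 1 then - 1 else 1) * elem X (\<pi> i)"
  by (simp add: \<tau> from_arrangement_def elem_in signed_value_def rank_elem)

lemma abs_tau_elem: "i < card X \<Longrightarrow> \<bar>\<tau> (elem X i)\<bar> = elem X (\<pi> i)"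
  using elem_pos[OF pi_less', of i] by (simp add: tau_elem)

lemma tau_uminus: "x \<in> X \<Longrightarrow> \<tau> (- x) = - \<tau> x"
  using member_pos[of x] member_pos[of "- x"] by (auto simp: \<tau> from_arrangement_def)

lemma perm_shape_tau: "perm_shape X \<tau> = w"
proof (rule nth_equalityI)
  fix i assume "i < length (perm_shape X \<tau>)"
  then have i: "i < card X" by (simp add: perm_shape_length)
  have "w ! i = 0 \<or> w ! i = 1 \<or> w ! i = 2"
    using letter_cases[of w i] letters i len by (simp add: is_word_def)
  moreover have "w ! i = 2 \<Longrightarrow> i \<le> \<pi> i" "w ! i = 0 \<Longrightarrow> \<pi> i < i"
    using \<pi> i len by (auto simp: arrangements_def positions_def)
  ultimately show "perm_shape X \<tau> ! i = w ! i"
    using i elem_pos[OF i] elem_pos[OF pi_less'[OF i]] elem_le[OF i pi_less'[OF i]]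
    by (auto simp: perm_shape_nth tau_elem)
qed (simp add: perm_shape_length len)

lemma tau_AS: "\<tau> \<in> AS X"
proof -
  have b: "bij_betw \<pi> {..<card X} {..<card X}" using \<pi> len by (simp add: arrangements_def)
  have ab: "\<bar>\<tau> x\<bar> \<in> X" if x: "x \<in> X" for x
  proof -
    obtain i where "i < card X" "x = elem X i" using x by (rule X_obtain)
    then show ?thesis using abs_tau_elem elem_in pi_less' by simp
  qed
  have inj: "x = y" if xy: "x \<in> X" "y \<in> X" "\<bar>\<tau> x\<bar> = \<bar>\<tau> y\<bar>" for x y
  proof -
    obtain i where i: "i < card X" "x = elem X i" using xy(1) by (rule X_obtain)
    obtain j where j: "j < card X" "y = elem X j" using xy(2) by (rule X_obtain)
    have "\<pi> i = \<pi> j" using xy(3) i j elem_eq pi_less' by (simp add: abs_tau_elem)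
    then show ?thesis using i j bij_betw_imp_inj_on[OF b] by (auto dest: inj_onD)
  qed
  let ?Y = "X \<union> uminus ` X"
  have un: "\<tau> (- x) = - \<tau> x" if "x \<in> ?Y" for x using that tau_uminus by auto
  have abY: "\<bar>x\<bar> \<in> X" "\<bar>\<tau> x\<bar> = \<bar>\<tau> \<bar>x\<bar>\<bar>" if x: "x \<in> ?Y" for x
  proof -
    consider "x \<in> X" | y where "y \<in> X" "x = - y" using x by blast
    then have "\<bar>x\<bar> \<in> X \<and> \<bar>\<tau> x\<bar> = \<bar>\<tau> \<bar>x\<bar>\<bar>"
    proof cases
      case 1
      then show ?thesis using member_pos[of x] by simp
    next
      case (2 y)
      then show ?thesis using member_pos[of y] tau_uminus[of y] by simp
    qed
    then show "\<bar>x\<bar> \<in> X" "\<bar>\<tau> x\<bar> = \<bar>\<tau> \<bar>x\<bar>\<bar>" by simp_all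
  qed
  have "inj_on \<tau> ?Y"
  proof (rule inj_onI)
    fix x y assume xy: "x \<in> ?Y" "y \<in> ?Y" "\<tau> x = \<tau> y"
    then have "\<bar>x\<bar> = \<bar>y\<bar>" using abY inj by metis
    then have "x = y \<or> x = - y" by (simp add: abs_eq_iff)
    moreover have "x \<noteq> - y"
    proof
      assume "x = - y"
      then have "\<tau> y = 0" using un[OF xy(2)] xy(3) by simp
      then show False using abY[OF xy(2)] ab member_pos by force
    qed
    ultimately show "x = y" by blast
  qed
  moreover have "\<tau> ` ?Y \<subseteq> ?Y"
  proof
    fix z assume "z \<in> \<tau> ` ?Y"
    then obtain x where "x \<in> ?Y" "z = \<tau> x" by blast
    then have "\<bar>z\<bar> \<in> X" using abY ab by metis
    then show "z \<in> ?Y" by (cases "z < 0") (auto simp: image_iff intro: bexI[of _ "- z"])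
  qed
  ultimately have "bij_betw \<tau> ?Y ?Y"
    using fin by (simp add: bij_betw_def endo_inj_surj)
  moreover have "\<tau> x = x" if "x \<notin> ?Y" for x
  proof -
    have "x \<notin> X" "- x \<notin> X" using that by (auto simp: image_iff)
    then show ?thesis by (simp add: \<tau> from_arrangement_def)
  qed
  ultimately have "signed_perm X \<tau>" using un by (simp add: signed_perm_def)
  moreover have "Min X \<in> neg X \<tau>"
    using w0 card_X len unfolding Min_X neg_eq perm_shape_tau by (auto simp: positions_def)
  moreover have "strict_mono_on (neg X \<tau>) (\<lambda>i. \<bar>\<tau> i\<bar>)"
  proof (rule strict_mono_onI)
    fix x y assume "x \<in> neg X \<tau>" "y \<in> neg X \<tau>" "x < y"
    then obtain i j where ij: "i \<in> positions w 1" "j \<in> positions w 1" "x = elem X i" "y = elem X j"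
      unfolding neg_eq perm_shape_tau by blast
    then have l: "i < card X" "j < card X" by (auto simp: positions_def len)
    then have "i < j" using \<open>x < y\<close> ij elem_less by simp
    then have "\<pi> i < \<pi> j" using \<pi> ij by (auto simp: arrangements_def strict_mono_on_def)
    then show "\<bar>\<tau> x\<bar> < \<bar>\<tau> y\<bar>" using ij l elem_less pi_less' by (simp add: abs_tau_elem)
  qed
  ultimately show ?thesis by (simp add: AS_def)
qed

lemma to_from_arrangement: "to_arrangement X \<tau> = \<pi>"
proof
  fix i
  show "to_arrangement X \<tau> i = \<pi> i"
    using \<pi> len by (auto simp: to_arrangement_def abs_tau_elem rank_elem pi_less' arrangements_def PiE_iff extensional_def)
qed

end

lemma to_arrangement_bij:
  assumes "set w \<subseteq> {0, 1, 2}" "length w = card X" "w ! 0 = 1"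
  shows "bij_betw (to_arrangement X) {\<tau> \<in> AS X. perm_shape X \<tau> = w} (arrangements w)"
proof (rule bij_betw_byWitness[where f' = "from_arrangement X w"])
  show "\<forall>\<tau>\<in>{\<tau> \<in> AS X. perm_shape X \<tau> = w}. from_arrangement X w (to_arrangement X \<tau>) = \<tau>"
    using from_to_arrangement by blast
  show "\<forall>\<pi>\<in>arrangements w. to_arrangement X (from_arrangement X w \<pi>) = \<pi>"
    using to_from_arrangement[OF assms] by blast
  show "to_arrangement X ` {\<tau> \<in> AS X. perm_shape X \<tau> = w} \<subseteq> arrangements w"
    using pi_arrangement by blast
  show "from_arrangement X w ` arrangements w \<subseteq> {\<tau> \<in> AS X. perm_shape X \<tau> = w}"
    using tau_AS[OF assms] perm_shape_tau[OF assms] by blast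
qed

end

section \<open>Extended rhombic alternative tableaux\<close>

definition cells_with :: "word \<Rightarrow> (tile \<Rightarrow> arrow option) \<Rightarrow> arrow \<Rightarrow> (nat \<times> nat) set" where
  "cells_with w F a = {c \<in> inversions w. F (cell w c) = Some a}"

definition to_filling :: "word \<Rightarrow> tableau \<Rightarrow> (nat \<times> nat) set \<times> (nat \<times> nat) set" where
  "to_filling w R = (cells_with w (filling R) Left_Arrow, cells_with w (filling R) Up_Arrow)"

definition from_filling :: "word \<Rightarrow> int list \<Rightarrow> (nat \<times> nat) set \<times> (nat \<times> nat) set \<Rightarrow> tableau" where
  "from_filling w xs T = \<lparr>shape = w, labels = xs,
     filling = (\<lambda>t. if t \<in> cell w ` fst T then Some Left_Arrow
       else if t \<in> cell w ` snd T then Some Up_Arrow else None)\<rparr>"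

lemma cells_with_disjoint: "cells_with w F Left_Arrow \<inter> cells_with w F Up_Arrow = {}"
  by (auto simp: cells_with_def)

lemma above_iff_key: "i < length w \<Longrightarrow> j < length w \<Longrightarrow> above w i j \<longleftrightarrow> key w i < key w j"
  by (simp add: above_def key_less_iff)

text \<open>The conditions of \<open>fillings\<close> say which cells an arrow forbids. Read from
  the side of the forbidden cell, they say that no cell with an arrow is pointed to, which is the
  form used by \<open>is_RAT\<close>.\<close>

lemma fillings_iff_pointed:
  "(L, U) \<in> fillings w \<longleftrightarrow> L \<subseteq> {(i, m) \<in> inversions w. w ! i = 2} \<and>
     U \<subseteq> {(i, m) \<in> inversions w. w ! m = 0} \<and> L \<inter> U = {} \<and>
     (\<forall>(i, m)\<in>L \<union> U. \<not> (\<exists>m'<m. (i, m') \<in> L) \<and> \<not> (\<exists>i'. above w i i' \<and> (i', m) \<in> U)) \<and>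
     (\<forall>m<length w. w ! m = 0 \<longrightarrow> (\<exists>i. (i, m) \<in> U))"
proof -
  let ?P = "\<lambda>i m. \<not> (\<exists>m'<m. (i, m') \<in> L) \<and> \<not> (\<exists>i'. above w i i' \<and> (i', m) \<in> U)"
  have "(\<forall>(i, m)\<in>L \<union> U. P i m) \<longleftrightarrow> (\<forall>i m. (i, m) \<in> L \<union> U \<longrightarrow> P i m)" for P
    by auto
  note this[of ?P]
  moreover have "(\<forall>i m m'. (i, m) \<in> L \<longrightarrow> m < m' \<longrightarrow> (i, m') \<notin> L \<union> U) \<and>
      (\<forall>i m i'. (i, m) \<in> U \<longrightarrow> above w i' i \<longrightarrow> (i', m) \<notin> L \<union> U) \<longleftrightarrow>
      (\<forall>i m. (i, m) \<in> L \<union> U \<longrightarrow> \<not> (\<exists>m'<m. (i, m') \<in> L) \<and> \<not> (\<exists>i'. above w i i' \<and> (i', m) \<in> U))"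
    by blast
  ultimately show ?thesis
    unfolding fillings_def mem_Collect_eq prod.case by argo
qed

context
  fixes w :: word
  assumes w: "is_word w"
begin

lemma word_le_2: "k < length w \<Longrightarrow> w ! k \<le> 2"
  using letter_cases[OF w, of k] by auto

lemma inversion_row: "(i, m) \<in> inversions w \<Longrightarrow> w ! m \<noteq> 2"
  using word_le_2[of i] by (auto simp: inversions_def)

lemma inversion_column: "(i, m) \<in> inversions w \<Longrightarrow> w ! i \<noteq> 0"
  by (auto simp: inversions_def)

lemma cell_in_row_strip:
  assumes "c \<in> inversions w" "i < length w" "w ! i = 2"
  shows "cell w c \<in> strip w i \<longleftrightarrow> fst c = i"
proof -
  have "snd c \<noteq> i" using inversion_row[of "fst c" "snd c"] assms by auto
  then show ?thesis
    unfolding strip_eq[OF w assms(2)] using assms(1) cell_inj[OF w]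
    by (auto dest: inj_onD)
qed

lemma cell_in_column_strip:
  assumes "c \<in> inversions w" "i < length w" "w ! i = 0"
  shows "cell w c \<in> strip w i \<longleftrightarrow> snd c = i"
proof -
  have "fst c \<noteq> i" using inversion_column[of "fst c" "snd c"] assms by auto
  then show ?thesis
    unfolding strip_eq[OF w assms(2)] using assms(1) cell_inj[OF w]
    by (auto dest: inj_onD)
qed

context
  fixes R :: tableau and L U
  assumes shape: "shape R = w" and dom: "dom (filling R) \<subseteq> tiles R"
    and LU: "(L, U) = to_filling w R"
begin

lemma tiles_eq: "tiles R = cell w ` inversions w"
  by (simp add: tiles_def shape maximal_tiling_eq)

lemma left_iff: "filling R t = Some Left_Arrow \<longleftrightarrow> t \<in> cell w ` L"
  using LU dom cell_inj[OF w] unfolding tiles_eq to_filling_def cells_with_def by (auto dest: inj_onD)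

lemma up_iff: "filling R t = Some Up_Arrow \<longleftrightarrow> t \<in> cell w ` U"
  using LU dom cell_inj[OF w] unfolding tiles_eq to_filling_def cells_with_def by (auto dest: inj_onD)

lemma none_iff: "filling R t = None \<longleftrightarrow> t \<notin> cell w ` L \<and> t \<notin> cell w ` U"
  using left_iff up_iff by (metis arrow.exhaust option.exhaust option.distinct(1))

lemma LU_subset: "L \<subseteq> inversions w" "U \<subseteq> inversions w"
  using LU by (auto simp: to_filling_def cells_with_def)

lemma cell_mem_iff:
  assumes "S \<subseteq> inversions w" "c \<in> inversions w"
  shows "cell w c \<in> cell w ` S \<longleftrightarrow> c \<in> S"
  using assms cell_inj[OF w] by (auto dest: inj_onD)

lemma up_columns:
  "(\<forall>t. filling R t = Some Up_Arrow \<longrightarrow> (\<exists>i<length w. w ! i = 0 \<and> t \<in> strip w i)) \<longleftrightarrow>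
    U \<subseteq> {(i, m) \<in> inversions w. w ! m = 0}"
proof -
  have "(\<exists>i<length w. w ! i = 0 \<and> cell w c \<in> strip w i) \<longleftrightarrow> w ! snd c = 0" if "c \<in> U" for c
  proof -
    have c: "c \<in> inversions w" "snd c < length w" using that LU_subset by (auto simp: inversions_def)
    then show ?thesis using cell_in_column_strip[OF c(1)] by auto
  qed
  then show ?thesis unfolding up_iff using LU_subset by auto
qed

lemma left_rows:
  "(\<forall>t. filling R t = Some Left_Arrow \<longrightarrow> (\<exists>i<length w. w ! i = 2 \<and> t \<in> strip w i)) \<longleftrightarrow>
    L \<subseteq> {(i, m) \<in> inversions w. w ! i = 2}"
proof -
  have "(\<exists>i<length w. w ! i = 2 \<and> cell w c \<in> strip w i) \<longleftrightarrow> w ! fst c = 2" if "c \<in> L" for c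
  proof -
    have c: "c \<in> inversions w" "fst c < length w" using that LU_subset by (auto simp: inversions_def)
    then show ?thesis using cell_in_row_strip[OF c(1)] by auto
  qed
  then show ?thesis unfolding left_iff using LU_subset by auto
qed

lemma up_in_columns:
  "(\<forall>i<length w. w ! i = 0 \<longrightarrow> (\<exists>t\<in>strip w i. filling R t = Some Up_Arrow)) \<longleftrightarrow>
   (\<forall>m<length w. w ! m = 0 \<longrightarrow> (\<exists>i. (i, m) \<in> U))"
proof -
  have "(\<exists>t\<in>strip w m. filling R t = Some Up_Arrow) \<longleftrightarrow> (\<exists>i. (i, m) \<in> U)"
    if m: "m < length w" "w ! m = 0" for m
  proof
    assume "\<exists>t\<in>strip w m. filling R t = Some Up_Arrow"
    then obtain c where c: "c \<in> U" "cell w c \<in> strip w m" unfolding up_iff by blast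
    then have "snd c = m" using cell_in_column_strip[OF _ m] LU_subset by blast
    then show "\<exists>i. (i, m) \<in> U" using c by (metis prod.collapse)
  next
    assume "\<exists>i. (i, m) \<in> U"
    then obtain i where i: "(i, m) \<in> U" by blast
    then have "cell w (i, m) \<in> strip w m" using cell_in_column_strip[OF _ m] LU_subset by force
    then show "\<exists>t\<in>strip w m. filling R t = Some Up_Arrow" unfolding up_iff using i by blast
  qed
  then show ?thesis by blast
qed

text \<open>With left-arrows confined to rows and up-arrows to columns, the cells onward from an
  arrow are given by \<open>onward_west\<close> and \<open>onward_north\<close>, that is, by a later
  position or a smaller key.\<close>

lemma pointed_iff:
  assumes L: "L \<subseteq> {(i, m) \<in> inversions w. w ! i = 2}" and U: "U \<subseteq> {(i, m) \<in> inversions w. w ! m = 0}"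
    and c: "(i, m) \<in> inversions w"
  shows "cell w (i, m) \<in> pointed R \<longleftrightarrow>
    (\<exists>m'<m. (i, m') \<in> L) \<or> (\<exists>i'. above w i i' \<and> (i', m) \<in> U)"
proof -
  have T: "tiles R = maximal_tiling w" by (simp add: tiles_def shape)
  have im: "i < length w" using c by (auto simp: inversions_def)
  have "{t \<in> tiles R. filling R t = Some Left_Arrow} = cell w ` L"
    unfolding left_iff tiles_eq using LU_subset by blast
  moreover have "{t \<in> tiles R. filling R t = Some Up_Arrow} = cell w ` U"
    unfolding up_iff tiles_eq using LU_subset by blast
  ultimately have "cell w (i, m) \<in> pointed R \<longleftrightarrow>
      (\<exists>d\<in>L. cell w (i, m) \<in> onward (maximal_tiling w) (west (cell w d))) \<or>
      (\<exists>d\<in>U. cell w (i, m) \<in> onward (maximal_tiling w) (north (cell w d)))"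
    unfolding pointed_def T by simp
  moreover have "cell w (i, m) \<in> onward (maximal_tiling w) (west (cell w d)) \<longleftrightarrow> fst d = i \<and> snd d < m"
    if "d \<in> L" for d
  proof -
    have d: "(fst d, snd d) \<in> inversions w" "w ! fst d = 2" using L that by auto
    have "onward (maximal_tiling w) (west (cell w d)) = cell w ` {c \<in> inversions w. fst c = fst d \<and> snd d < snd c}"
      using onward_west[OF w d] by simp
    then show ?thesis using cell_mem_iff[OF _ c, of "{c \<in> inversions w. fst c = fst d \<and> snd d < snd c}"] c by auto
  qed
  moreover have "cell w (i, m) \<in> onward (maximal_tiling w) (north (cell w d)) \<longleftrightarrow> snd d = m \<and> above w i (fst d)"
    if "d \<in> U" for d
  proof -
    have d: "(fst d, snd d) \<in> inversions w" "w ! snd d = 0" using U that by auto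
    then have "above w i (fst d) \<longleftrightarrow> key w i < key w (fst d)"
      using im by (intro above_iff_key) (auto simp: inversions_def)
    moreover have "onward (maximal_tiling w) (north (cell w d)) =
        cell w ` {c \<in> inversions w. snd c = snd d \<and> key w (fst c) < key w (fst d)}"
      using onward_north[OF w d] by simp
    ultimately show ?thesis
      using cell_mem_iff[OF _ c, of "{c \<in> inversions w. snd c = snd d \<and> key w (fst c) < key w (fst d)}"] c by auto
  qed
  ultimately show ?thesis by (auto; force)
qed

text \<open>If some arrow violates the restriction to rows or columns, both sides are false;
  otherwise \<open>pointed_iff\<close> translates the condition on pointed cells.\<close>

lemma is_RAT_iff_fillings:
  "is_RAT R \<and> (\<forall>i<length w. w ! i = 0 \<longrightarrow> (\<exists>t\<in>strip w i. filling R t = Some Up_Arrow)) \<longleftrightarrow>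
   length (labels R) = length w \<and> sorted_wrt (<) (labels R) \<and> (L, U) \<in> fillings w"
proof (cases "L \<subseteq> {(i, m) \<in> inversions w. w ! i = 2} \<and> U \<subseteq> {(i, m) \<in> inversions w. w ! m = 0}")
  case True
  have "(\<forall>t\<in>pointed R. filling R t = None) \<longleftrightarrow>
      (\<forall>(i, m)\<in>L \<union> U. \<not> (\<exists>m'<m. (i, m') \<in> L) \<and> \<not> (\<exists>i'. above w i i' \<and> (i', m) \<in> U))"
  proof -
    have "(\<forall>t\<in>pointed R. filling R t = None) \<longleftrightarrow> (\<forall>c\<in>L \<union> U. cell w c \<notin> pointed R)"
      unfolding none_iff by blast
    also have "\<dots> \<longleftrightarrow> (\<forall>(i, m)\<in>L \<union> U. \<not> (\<exists>m'<m. (i, m') \<in> L) \<and> \<not> (\<exists>i'. above w i i' \<and> (i', m) \<in> U))"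
    proof (intro ball_cong refl, clarify)
      fix i m assume "(i, m) \<in> L \<union> U"
      then have "(i, m) \<in> inversions w" using LU_subset by blast
      then show "(cell w (i, m) \<notin> pointed R) =
          (\<not> (\<exists>m'<m. (i, m') \<in> L) \<and> \<not> (\<exists>i'. above w i i' \<and> (i', m) \<in> U))"
        using pointed_iff True by blast
    qed
    finally show ?thesis .
  qed
  moreover have "L \<inter> U = {}" using LU cells_with_disjoint by (simp add: to_filling_def)
  ultimately show ?thesis
    unfolding is_RAT_def shape up_columns left_rows up_in_columns fillings_iff_pointed
    using w dom True by argo
next
  case False
  then show ?thesis
    unfolding is_RAT_def shape up_columns left_rows fillings_iff_pointed by argo
qed

lemma tableau_stats:
  assumes "(L, U) \<in> fillings w"
  shows "fcell R = card (free_cells w L U)" "frow R = card (live w L)"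
    "w \<noteq> [] \<Longrightarrow> topup R = card {m. (0, m) \<in> U}"
proof -
  have LU': "L \<subseteq> {(i, m) \<in> inversions w. w ! i = 2}" "U \<subseteq> {(i, m) \<in> inversions w. w ! m = 0}"
    using assms by (simp_all add: fillings_def)
  have "{t \<in> tiles R. filling R t = None \<and> t \<notin> pointed R} = cell w ` free_cells w L U"
  proof (intro set_eqI iffI)
    fix t assume t: "t \<in> {t \<in> tiles R. filling R t = None \<and> t \<notin> pointed R}"
    then obtain i m where c: "(i, m) \<in> inversions w" "t = cell w (i, m)" by (auto simp: tiles_eq)
    then have "(i, m) \<notin> L \<union> U" using t none_iff[of t] by blast
    moreover have "\<not> ((\<exists>m'<m. (i, m') \<in> L) \<or> (\<exists>i'. above w i i' \<and> (i', m) \<in> U))"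
      using pointed_iff[OF LU' c(1)] t c by simp
    ultimately have "(i, m) \<in> free_cells w L U" using c by (auto simp: free_cells_def)
    then show "t \<in> cell w ` free_cells w L U" using c by blast
  next
    fix t assume "t \<in> cell w ` free_cells w L U"
    then obtain i m where c: "(i, m) \<in> free_cells w L U" "t = cell w (i, m)" by auto
    then have i: "(i, m) \<in> inversions w" by (simp add: free_cells_def)
    have "t \<in> tiles R" using i c by (simp add: tiles_eq)
    moreover have "t \<notin> cell w ` L" "t \<notin> cell w ` U"
      using c cell_mem_iff[OF LU_subset(1) i] cell_mem_iff[OF LU_subset(2) i] by (auto simp: free_cells_def)
    moreover have "t \<notin> pointed R"
      using pointed_iff[OF LU' i] c by (auto simp: free_cells_def)
    ultimately show "t \<in> {t \<in> tiles R. filling R t = None \<and> t \<notin> pointed R}"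
      using none_iff by simp
  qed
  moreover have "inj_on (cell w) (free_cells w L U)"
    by (rule inj_on_subset[OF cell_inj[OF w]]) (auto simp: free_cells_def)
  ultimately show "fcell R = card (free_cells w L U)" by (simp add: fcell_def card_image)
  have "(\<forall>t\<in>strip w i. filling R t \<noteq> Some Left_Arrow) \<longleftrightarrow> (\<forall>m. (i, m) \<notin> L)"
    if i: "i < length w" "w ! i = 2" for i
  proof -
    have "(\<exists>t\<in>strip w i. t \<in> cell w ` L) \<longleftrightarrow> (\<exists>c\<in>L. cell w c \<in> strip w i)" by blast
    also have "\<dots> \<longleftrightarrow> (\<exists>c\<in>L. fst c = i)"
      using cell_in_row_strip[OF _ i] LU_subset by blast
    also have "\<dots> \<longleftrightarrow> (\<exists>m. (i, m) \<in> L)" by force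
    finally show ?thesis unfolding left_iff by blast
  qed
  then have "{i. i < length w \<and> w ! i = 2 \<and> (\<forall>t\<in>strip w i. filling R t \<noteq> Some Left_Arrow)} = live w L"
    unfolding live_def by blast
  then show "frow R = card (live w L)" by (simp add: frow_def shape)
  assume "w \<noteq> []"
  then have n: "0 < length w" by simp
  have "{t \<in> strip w 0. filling R t = Some Up_Arrow} = (\<lambda>m. cell w (0, m)) ` {m. (0, m) \<in> U}"
  proof (intro set_eqI iffI)
    fix t assume "t \<in> {t \<in> strip w 0. filling R t = Some Up_Arrow}"
    then obtain c where c: "c \<in> U" "t = cell w c" "cell w c \<in> strip w 0" unfolding up_iff by blast
    then have ci: "c \<in> inversions w" using LU_subset by blast
    obtain d where d: "d \<in> inversions w" "fst d = 0 \<or> snd d = 0" "cell w c = cell w d"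
      using c(3) unfolding strip_eq[OF w n] by blast
    have "c = d" using d(3) ci d(1) cell_inj[OF w] by (auto dest: inj_onD)
    then have "fst c = 0" using d by (auto simp: inversions_def)
    then show "t \<in> (\<lambda>m. cell w (0, m)) ` {m. (0, m) \<in> U}"
      using c by (intro image_eqI[of _ _ "snd c"]) (auto simp: prod_eq_iff intro: subst[of c "(0, snd c)"])
  next
    fix t assume "t \<in> (\<lambda>m. cell w (0, m)) ` {m. (0, m) \<in> U}"
    then obtain m where m: "(0, m) \<in> U" "t = cell w (0, m)" by blast
    then have "t \<in> strip w 0" unfolding strip_eq[OF w n] using LU_subset by force
    then show "t \<in> {t \<in> strip w 0. filling R t = Some Up_Arrow}" unfolding up_iff using m by blast
  qed
  moreover have "inj_on (\<lambda>m. cell w (0, m)) {m. (0, m) \<in> U}"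
  proof (rule inj_onI)
    fix a b assume ab: "a \<in> {m. (0, m) \<in> U}" "b \<in> {m. (0, m) \<in> U}" "cell w (0, a) = cell w (0, b)"
    have "(0, a) = (0 :: nat, b)"
      using ab(1,2) LU_subset by (intro inj_onD[OF cell_inj[OF w] ab(3)]) auto
    then show "a = b" by simp
  qed
  ultimately show "topup R = card {m. (0, m) \<in> U}" by (simp add: topup_def shape card_image)
qed

end

lemma to_filling_bij:
  assumes "length w = card X" "finite X" "w \<noteq> []" "hd w = 1"
  shows "bij_betw (to_filling w) {R \<in> RAT_ext X. shape R = w} (fillings w)"
proof (rule bij_betw_byWitness[where f' = "from_filling w (sorted_list_of_set X)"])
  let ?from = "from_filling w (sorted_list_of_set X)"
  have xs: "length (sorted_list_of_set X) = length w" "sorted_wrt (<) (sorted_list_of_set X)"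
    using assms by simp_all
  show "\<forall>R\<in>{R \<in> RAT_ext X. shape R = w}. ?from (to_filling w R) = R"
  proof
    fix R assume R: "R \<in> {R \<in> RAT_ext X. shape R = w}"
    then have s: "shape R = w" and d: "dom (filling R) \<subseteq> tiles R" and l: "labels R = sorted_list_of_set X"
      by (auto simp: RAT_ext_def is_RAT_def)
    obtain L U where LU: "(L, U) = to_filling w R" by (metis surj_pair)
    have f: "filling (?from (L, U)) = filling R"
    proof
      fix t
      show "filling (?from (L, U)) t = filling R t"
        using left_iff[OF s d LU, of t] up_iff[OF s d LU, of t] none_iff[OF s d LU, of t]
        by (auto simp: from_filling_def)
    qed
    show "?from (to_filling w R) = R"
      unfolding LU[symmetric] by (rule tableau.equality) (use f s l in \<open>simp_all add: from_filling_def\<close>)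
  qed
  show "to_filling w ` {R \<in> RAT_ext X. shape R = w} \<subseteq> fillings w"
  proof
    fix T assume "T \<in> to_filling w ` {R \<in> RAT_ext X. shape R = w}"
    then obtain R where T: "T = to_filling w R" and R: "R \<in> RAT_ext X" "shape R = w" by blast
    obtain L U where LU: "(L, U) = to_filling w R" by (metis surj_pair)
    have "dom (filling R) \<subseteq> tiles R" using R by (simp add: RAT_ext_def is_RAT_def)
    then have "(L, U) \<in> fillings w"
      using is_RAT_iff_fillings[OF R(2) _ LU] R by (simp add: RAT_ext_def)
    then show "T \<in> fillings w" using T LU by simp
  qed
  have from_facts: "shape (?from T) = w" "dom (filling (?from T)) \<subseteq> tiles (?from T)" "to_filling w (?from T) = T"
    if T: "T \<in> fillings w" for T
  proof -
    obtain L U where LU: "T = (L, U)" by fastforce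
    have sub: "L \<subseteq> inversions w" "U \<subseteq> inversions w" and disj: "L \<inter> U = {}"
      using T unfolding LU fillings_def by blast+
    show "shape (?from T) = w" by (simp add: from_filling_def)
    show "dom (filling (?from T)) \<subseteq> tiles (?from T)"
    proof
      fix t assume "t \<in> dom (filling (?from T))"
      then have "t \<in> cell w ` (L \<union> U)"
        by (auto simp: from_filling_def LU split: if_splits)
      then show "t \<in> tiles (?from T)"
        using sub by (auto simp: from_filling_def tiles_def maximal_tiling_eq)
    qed
    have mem: "cell w c \<in> cell w ` S \<longleftrightarrow> c \<in> S" if "S \<subseteq> inversions w" "c \<in> inversions w" for S c
      using that cell_inj[OF w] by (auto dest: inj_onD)
    show "to_filling w (?from T) = T"
    proof -
      have F: "filling (?from T) (cell w c) =
          (if c \<in> L then Some Left_Arrow else if c \<in> U then Some Up_Arrow else None)"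
        if "c \<in> inversions w" for c
        using mem[OF sub(1) that] mem[OF sub(2) that] by (simp add: from_filling_def LU)
      have "(c \<in> cells_with w (filling (?from T)) Left_Arrow \<longleftrightarrow> c \<in> L) \<and>
        (c \<in> cells_with w (filling (?from T)) Up_Arrow \<longleftrightarrow> c \<in> U)" for c
      proof -
        have "c \<in> U \<longrightarrow> c \<in> inversions w \<and> c \<notin> L" "c \<in> L \<longrightarrow> c \<in> inversions w"
          using sub disj by blast+
        then show ?thesis
          using F[of c] unfolding cells_with_def mem_Collect_eq by (auto split: if_splits)
      qed
      then have "cells_with w (filling (?from T)) Left_Arrow = L"
        "cells_with w (filling (?from T)) Up_Arrow = U" by blast+
      then show ?thesis by (simp add: to_filling_def LU)
    qed
  qed
  show "\<forall>T\<in>fillings w. to_filling w (?from T) = T" using from_facts by blast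
  show "?from ` fillings w \<subseteq> {R \<in> RAT_ext X. shape R = w}"
  proof
    fix R assume "R \<in> ?from ` fillings w"
    then obtain T where T: "T \<in> fillings w" "R = ?from T" by blast
    obtain L U where LU: "T = (L, U)" by fastforce
    have l: "labels R = sorted_list_of_set X" by (simp add: T from_filling_def)
    have s: "shape R = w" and d: "dom (filling R) \<subseteq> tiles R" and tf: "(L, U) = to_filling w R"
      using from_facts[OF T(1)] LU unfolding T(2) by simp_all
    have "is_RAT R \<and> (\<forall>i<length w. w ! i = 0 \<longrightarrow> (\<exists>t\<in>strip w i. filling R t = Some Up_Arrow))"
      unfolding is_RAT_iff_fillings[OF s d tf] using T(1) LU l xs by simp
    then show "R \<in> {R \<in> RAT_ext X. shape R = w}"
      using s l assms(3,4) by (simp add: RAT_ext_def)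
  qed
qed

end

section \<open>The bijection\<close>

text \<open>The identities are specialised to independent indeterminates, whose monomials separate
  the triples of statistics; the coefficients are the sizes of the fibres.\<close>

lemma card_eq_if_sum_eq:
  fixes f g h :: "'b \<Rightarrow> nat" and f' g' h' :: "'c \<Rightarrow> nat"
  assumes "finite A" "finite B"
    and sums: "\<And>q y z :: int poly poly poly.
      (\<Sum>a\<in>A. q ^ f a * y ^ g a * z ^ h a) = (\<Sum>b\<in>B. q ^ f' b * y ^ g' b * z ^ h' b)"
  shows "card {a \<in> A. (f a, g a, h a) = s} = card {b \<in> B. (f' b, g' b, h' b) = s}"
proof -
  \<comment> \<open>The iterated polynomial ring serves as Z[q, y, z]. Here \<open>z\<close> is the
    outermost variable and \<open>q\<close> the innermost, so coefficients are extracted in the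
    order \<open>k\<close>, \<open>j\<close>, \<open>i\<close>.\<close>
  define q y z :: "int poly poly poly"
    where "q = monom (monom (monom 1 1) 0) 0" and "y = monom (monom 1 1) 0" and "z = monom 1 1"
  obtain i j k where s: "s = (i, j, k)" by (metis surj_pair)
  have c: "coeff (coeff (coeff (q ^ a * y ^ b * z ^ c) k) j) i = (if (a, b, c) = s then 1 else 0)" for a b c
    by (simp add: q_def y_def z_def s monom_power mult_monom)
  have e: "coeff (coeff (coeff (\<Sum>a\<in>S. q ^ u a * y ^ v a * z ^ w a) k) j) i =
      int (card {a \<in> S. (u a, v a, w a) = s})" if "finite S" for S :: "'d set" and u v w
    unfolding coeff_sum c by (subst sum.inter_filter[symmetric, OF that]) simp
  show ?thesis
    using sums[of q y z] e[OF assms(1), of f g h] e[OF assms(2), of f' g' h'] by simp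
qed

lemma ex_bij_betw_fibres:
  assumes "finite A" "finite B"
    and "\<And>s. card {a \<in> A. f a = s} = card {b \<in> B. g b = s}"
  shows "\<exists>\<zeta>. bij_betw \<zeta> A B \<and> (\<forall>a\<in>A. g (\<zeta> a) = f a)"
proof -
  have "\<exists>\<eta>. bij_betw \<eta> {a \<in> A. f a = s} {b \<in> B. g b = s}" for s
    using assms by (intro finite_same_card_bij) auto
  then obtain \<eta> where \<eta>: "\<And>s. bij_betw (\<eta> s) {a \<in> A. f a = s} {b \<in> B. g b = s}" by metis
  define \<zeta> where "\<zeta> a = \<eta> (f a) a" for a
  have \<zeta>: "\<zeta> a \<in> B" "g (\<zeta> a) = f a" if "a \<in> A" for a
    using bij_betwE[OF \<eta>[of "f a"]] that by (auto simp: \<zeta>_def)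
  have "inj_on \<zeta> A"
  proof (rule inj_onI)
    fix a b assume ab: "a \<in> A" "b \<in> A" "\<zeta> a = \<zeta> b"
    then have "f a = f b" using \<zeta> by metis
    then show "a = b"
      using ab bij_betw_imp_inj_on[OF \<eta>[of "f a"]] by (auto simp: \<zeta>_def dest: inj_onD)
  qed
  moreover have "B \<subseteq> \<zeta> ` A"
  proof
    fix b assume "b \<in> B"
    then have "b \<in> \<eta> (g b) ` {a \<in> A. f a = g b}" using \<eta>[of "g b"] by (auto simp: bij_betw_def)
    then obtain a where "a \<in> A" "f a = g b" "b = \<eta> (g b) a" by blast
    then have "b = \<zeta> a" by (simp add: \<zeta>_def)
    then show "b \<in> \<zeta> ` A" using \<open>a \<in> A\<close> by (rule image_eqI)
  qed
  ultimately have "bij_betw \<zeta> A B" using \<zeta> by (auto simp: bij_betw_def)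
  then show ?thesis using \<zeta> by blast
qed

lemma bij_betw_filter:
  assumes "bij_betw \<zeta> A B" "\<And>a. a \<in> A \<Longrightarrow> P a \<longleftrightarrow> Q (\<zeta> a)"
  shows "bij_betw \<zeta> {a \<in> A. P a} {b \<in> B. Q b}"
  using assms by (auto simp: bij_betw_def inj_on_def)

context
  fixes X :: "int set"
  assumes fin: "finite X" and ne: "X \<noteq> {}" and pos: "\<forall>x\<in>X. 0 < x"
begin

lemma RAT_ext_shape:
  assumes "R \<in> RAT_ext X"
  shows "shape R \<in> words (card X)" "hd (shape R) = 1" "shape R \<noteq> []"
  using assms by (auto simp: RAT_ext_def is_RAT_def words_def is_word_def)

lemma AS_shape:
  assumes "\<tau> \<in> AS X"
  shows "perm_shape X \<tau> \<in> words (card X)" "hd (perm_shape X \<tau>) = 1" "perm_shape X \<tau> \<noteq> []"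
proof -
  show n: "perm_shape X \<tau> \<noteq> []"
    using perm_shape_length[OF fin ne pos, of \<tau>] card_X[OF fin ne pos] by auto
  then show "hd (perm_shape X \<tau>) = 1"
    using w_0[OF fin ne pos assms refl refl] by (simp add: hd_conv_nth)
  show "perm_shape X \<tau> \<in> words (card X)"
    using perm_shape_length[OF fin ne pos] perm_shape_letters[OF fin ne pos] by (simp add: words_def)
qed

lemma shape_bijections:
  assumes "w \<in> words (card X)" "hd w = 1" "w \<noteq> []"
  shows "bij_betw (to_filling w) {R \<in> RAT_ext X. shape R = w} (fillings w)"
    "bij_betw (to_arrangement X) {\<tau> \<in> AS X. perm_shape X \<tau> = w} (arrangements w)"
  using to_filling_bij[of w X] to_arrangement_bij[OF fin ne pos, of w] assms fin
  by (auto simp: words_def is_word_def hd_conv_nth)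

text \<open>A filling is a function on the infinite type of tiles, so finiteness is obtained from
  the encoding by \<open>fillings\<close> for each of the finitely many shapes.\<close>

lemma finite_RAT_ext: "finite (RAT_ext X)"
proof -
  have "finite {R \<in> RAT_ext X. shape R = w}" for w
  proof (cases "w \<in> words (card X) \<and> hd w = 1 \<and> w \<noteq> []")
    case True
    then show ?thesis using shape_bijections(1)[of w] bij_betw_finite finite_fillings by blast
  next
    case False
    then have e: "{R \<in> RAT_ext X. shape R = w} = {}" using RAT_ext_shape by blast
    show ?thesis unfolding e by simp
  qed
  then have "finite (\<Union>w\<in>words (card X). {R \<in> RAT_ext X. shape R = w})" by simp
  moreover have "RAT_ext X = (\<Union>w\<in>words (card X). {R \<in> RAT_ext X. shape R = w})"
    using RAT_ext_shape by blast
  ultimately show ?thesis by (simp only:)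
qed

lemma finite_AS: "finite (AS X)"
proof -
  have "finite {\<tau> \<in> AS X. perm_shape X \<tau> = w}" for w
  proof (cases "w \<in> words (card X) \<and> hd w = 1 \<and> w \<noteq> []")
    case True
    then show ?thesis using shape_bijections(2)[of w] bij_betw_finite finite_arrangements by blast
  next
    case False
    then have e: "{\<tau> \<in> AS X. perm_shape X \<tau> = w} = {}" using AS_shape by blast
    show ?thesis unfolding e by simp
  qed
  then have "finite (\<Union>w\<in>words (card X). {\<tau> \<in> AS X. perm_shape X \<tau> = w})" by simp
  moreover have "AS X = (\<Union>w\<in>words (card X). {\<tau> \<in> AS X. perm_shape X \<tau> = w})"
    using AS_shape by blast
  ultimately show ?thesis by (simp only:)
qed

text \<open>Both sides equal the value of the matrix ansatz at \<open>w\<close>: tableaux through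
  \<open>live_value\<close>, signed permutations through \<open>arc_value\<close>. For words that
  are not shapes both sums are empty.\<close>

lemma shape_generating_functions:
  fixes q y z :: "'a::comm_ring_1"
  shows "(\<Sum>R | R \<in> RAT_ext X \<and> shape R = w. q ^ fcell R * y ^ topup R * z ^ frow R) =
    (\<Sum>\<tau> | \<tau> \<in> AS X \<and> perm_shape X \<tau> = w. q ^ cro X \<tau> * y ^ RLmin X \<tau> * z ^ LRmax X \<tau>)"
proof (cases "w \<in> words (card X) \<and> hd w = 1 \<and> w \<noteq> []")
  case True
  then have w: "is_word w" "set w \<subseteq> {0, 1, 2}" "w \<noteq> []" "hd w = 1"
    by (auto simp: words_def is_word_def)
  interpret weights q y z .
  have "q ^ fcell R * y ^ topup R * z ^ frow R =
      filling_weight w (to_filling w R) * z ^ card (live w (fst (to_filling w R)))"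
    if R: "R \<in> {R \<in> RAT_ext X. shape R = w}" for R
  proof -
    obtain L U where LU: "(L, U) = to_filling w R" by (metis surj_pair)
    have s: "shape R = w" and d: "dom (filling R) \<subseteq> tiles R"
      using R by (auto simp: RAT_ext_def is_RAT_def)
    have "(L, U) \<in> fillings w"
      using LU bij_betwE[OF shape_bijections(1)] True R by auto
    then show ?thesis
      using tableau_stats[OF w(1) s d LU] w(3) by (simp add: filling_weight_def LU[symmetric])
  qed
  then have "(\<Sum>R | R \<in> RAT_ext X \<and> shape R = w. q ^ fcell R * y ^ topup R * z ^ frow R) =
      (\<Sum>R | R \<in> RAT_ext X \<and> shape R = w. filling_weight w (to_filling w R) * z ^ card (live w (fst (to_filling w R))))"
    by (intro sum.cong) auto
  also have "\<dots> = (\<Sum>T\<in>fillings w. filling_weight w T * z ^ card (live w (fst T)))"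
    using shape_bijections(1)[of w] True by (intro sum.reindex_bij_betw) auto
  also have "\<dots> = live_value 1 (tl w) 0"
    by (rule sum_fillings[OF w(2,3,4)])
  also have "\<dots> = arc_value (int (count_list w 1)) w 0 (int (count_list w 1)) 0"
    using live_value_eq_arc_value[of "tl w" "int (count_list w 1)"] w by (cases w) auto
  also have "\<dots> = (\<Sum>\<pi>\<in>arrangements w.
      q ^ (card (upper_crossings w \<pi>) + card (lower_crossings w \<pi>)) *
      y ^ card (rl_minima w \<pi>) * z ^ card (lr_maxima w \<pi>))"
    by (rule sum_arrangements[OF w(2) refl, symmetric])
  also have "\<dots> = (\<Sum>\<tau> | \<tau> \<in> AS X \<and> perm_shape X \<tau> = w.
      q ^ (card (upper_crossings w (to_arrangement X \<tau>)) + card (lower_crossings w (to_arrangement X \<tau>))) *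
      y ^ card (rl_minima w (to_arrangement X \<tau>)) * z ^ card (lr_maxima w (to_arrangement X \<tau>)))"
    using shape_bijections(2)[of w] True by (intro sum.reindex_bij_betw[symmetric]) auto
  also have "\<dots> = (\<Sum>\<tau> | \<tau> \<in> AS X \<and> perm_shape X \<tau> = w. q ^ cro X \<tau> * y ^ RLmin X \<tau> * z ^ LRmax X \<tau>)"
  proof (rule sum.cong[OF refl])
    fix \<tau> assume "\<tau> \<in> {\<tau>. \<tau> \<in> AS X \<and> perm_shape X \<tau> = w}"
    then have \<tau>: "\<tau> \<in> AS X" "w = perm_shape X \<tau>" by auto
    note fs = fin ne pos \<tau> refl
    show "q ^ (card (upper_crossings w (to_arrangement X \<tau>)) + card (lower_crossings w (to_arrangement X \<tau>))) *
      y ^ card (rl_minima w (to_arrangement X \<tau>)) * z ^ card (lr_maxima w (to_arrangement X \<tau>)) =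
      q ^ cro X \<tau> * y ^ RLmin X \<tau> * z ^ LRmax X \<tau>"
      unfolding cro_eq[OF fs] RLmin_eq[OF fs] LRmax_eq[OF fs] ..
  qed
  finally show ?thesis .
next
  case False
  then have "{R. R \<in> RAT_ext X \<and> shape R = w} = {}" "{\<tau>. \<tau> \<in> AS X \<and> perm_shape X \<tau> = w} = {}"
    using RAT_ext_shape AS_shape by blast+
  then show ?thesis by (simp only: sum.empty)
qed

lemma ex_statistic_preserving_bijection:
  "\<exists>\<zeta>. bij_betw \<zeta> (RAT_ext X) (AS X) \<and> (\<forall>R\<in>RAT_ext X. perm_shape X (\<zeta> R) = shape R \<and>
     cro X (\<zeta> R) = fcell R \<and> RLmin X (\<zeta> R) = topup R \<and> LRmax X (\<zeta> R) = frow R)"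
proof -
  let ?f = "\<lambda>R. (shape R, fcell R, topup R, frow R)"
  let ?g = "\<lambda>\<tau>. (perm_shape X \<tau>, cro X \<tau>, RLmin X \<tau>, LRmax X \<tau>)"
  have "card {R \<in> RAT_ext X. ?f R = s} = card {\<tau> \<in> AS X. ?g \<tau> = s}" for s
  proof -
    obtain w t where s: "s = (w, t)" by (cases s)
    have "card {R \<in> {R. R \<in> RAT_ext X \<and> shape R = w}. (fcell R, topup R, frow R) = t} =
        card {\<tau> \<in> {\<tau>. \<tau> \<in> AS X \<and> perm_shape X \<tau> = w}. (cro X \<tau>, RLmin X \<tau>, LRmax X \<tau>) = t}"
      using finite_RAT_ext finite_AS
      by (intro card_eq_if_sum_eq shape_generating_functions) auto
    moreover have "{R \<in> RAT_ext X. ?f R = s} = {R \<in> {R. R \<in> RAT_ext X \<and> shape R = w}. (fcell R, topup R, frow R) = t}"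
      "{\<tau> \<in> AS X. ?g \<tau> = s} = {\<tau> \<in> {\<tau>. \<tau> \<in> AS X \<and> perm_shape X \<tau> = w}. (cro X \<tau>, RLmin X \<tau>, LRmax X \<tau>) = t}"
      by (auto simp: s)
    ultimately show ?thesis by (simp only:)
  qed
  from ex_bij_betw_fibres[of _ _ ?f ?g, OF finite_RAT_ext finite_AS this] show ?thesis
    by simp
qed

text \<open>These statistics are read off from the common shape; for the tiles this uses that the
  cells of the maximal tiling are the inversions of the word.\<close>

lemma statistics_of_shape:
  assumes R: "R \<in> RAT_ext X" and s: "perm_shape X \<tau> = shape R"
  shows "diag R = neg X \<tau>" "tile_number R = sinv X \<tau>" "row_number R = wex X \<tau>"
    "card (neg X \<tau>) = count_list (shape R) 1"
proof -
  have w: "is_word (shape R)" and l: "labels R = sorted_list_of_set X"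
    using R by (auto simp: RAT_ext_def is_RAT_def)
  have inj: "inj_on (elem X) (positions (shape R) c)" for c
    by (rule inj_on_subset[OF bij_betw_imp_inj_on[OF elem_bij[OF fin ne pos]]])
      (auto simp: positions_def s[symmetric] perm_shape_length[OF fin ne pos])
  have neg: "neg X \<tau> = elem X ` positions (shape R) 1"
    using neg_eq[OF fin ne pos, of \<tau>] s by simp
  show "diag R = neg X \<tau>"
    unfolding neg diag_def l by (auto simp: positions_def elem_def)
  show "card (neg X \<tau>) = count_list (shape R) 1"
    unfolding neg using inj by (simp add: card_image card_positions)
  show "tile_number R = sinv X \<tau>"
    unfolding tile_number_def tiles_def maximal_tiling_eq sinv_def s
    using card_image[OF cell_inj[OF w]] by (simp add: inversions_def conj_assoc)
  have "{a \<in> X. \<tau> a \<ge> a} = elem X ` positions (shape R) 2"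
  proof (intro set_eqI iffI)
    fix a assume a: "a \<in> {a \<in> X. \<tau> a \<ge> a}"
    then obtain i where "i < card X" "a = elem X i" using X_obtain[OF fin ne pos] by blast
    then show "a \<in> elem X ` positions (shape R) 2"
      using a by (auto simp: positions_def s[symmetric] perm_shape_length[OF fin ne pos] perm_shape_nth[OF fin ne pos])
  next
    fix a assume "a \<in> elem X ` positions (shape R) 2"
    then obtain i where "i < card X" "a = elem X i" "perm_shape X \<tau> ! i = 2"
      by (auto simp: positions_def s[symmetric] perm_shape_length[OF fin ne pos])
    then show "a \<in> {a \<in> X. \<tau> a \<ge> a}"
      using elem_in[OF fin ne pos] by (auto simp: perm_shape_nth[OF fin ne pos] split: if_splits)
  qed
  then show "row_number R = wex X \<tau>"
    unfolding row_number_def wex_def using card_image[OF inj[of 2]] by (simp add: positions_def)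
qed

end

theorem theorem5p12:
  fixes X :: "int set"
  assumes "finite X" and "X \<noteq> {}" and "\<forall>x\<in>X. 0 < x"
  shows "\<exists>\<zeta> :: tableau \<Rightarrow> (int \<Rightarrow> int).
    bij_betw \<zeta> (RAT_ext X) (AS X) \<and>
    (\<forall>R\<in>RAT_ext X.
       diag R = neg X (\<zeta> R) \<and>
       tile_number R = sinv X (\<zeta> R) \<and>
       row_number R = wex X (\<zeta> R) \<and>
       topup R = RLmin X (\<zeta> R) \<and>
       frow R = LRmax X (\<zeta> R) \<and>
       fcell R = cro X (\<zeta> R)) \<and>
    (\<forall>n r :: nat. X = {1..int (n + 1)} \<longrightarrow>
       bij_betw \<zeta> (RAT_ext_nat (n + 1) (r + 1)) (AS_nat (n + 1) (r + 1)))"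
proof -
  obtain \<zeta> where \<zeta>: "bij_betw \<zeta> (RAT_ext X) (AS X)"
    and stats: "\<And>R. R \<in> RAT_ext X \<Longrightarrow> perm_shape X (\<zeta> R) = shape R \<and>
     cro X (\<zeta> R) = fcell R \<and> RLmin X (\<zeta> R) = topup R \<and> LRmax X (\<zeta> R) = frow R"
    using ex_statistic_preserving_bijection[OF assms] by blast
  note shape_stats = statistics_of_shape[OF assms]
  \<comment> \<open>The number of diagonal steps equals the number of negative arguments of the
    image, so the bijection restricts.\<close>
  have "bij_betw \<zeta> (RAT_ext_nat (n + 1) (r + 1)) (AS_nat (n + 1) (r + 1))"
    if X: "X = {1..int (n + 1)}" for n r
    unfolding RAT_ext_nat_def AS_nat_def X[symmetric]
    by (rule bij_betw_filter[OF \<zeta>]) (use shape_stats(4) stats in auto)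
  then show ?thesis
    using \<zeta> stats shape_stats(1-3) by (intro exI[of _ \<zeta>]) auto
qed

end
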